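(* Let $K$ be a non-archimedean local field of residue characteristic $p\ne2$ and let $O$ be a Cayley octad over $\overline K$ with valuation data $v$. If $v$ admits a compatible block decomposition, then this decomposition is unique up to $\mathrm{PGL}$-equivalence: any two compatible block decompositions of $v$ (ignoring blocks occurring with coefficient $0$) have the same set of $\mathrm{PGL}$-equivalence classes of blocks, i.e. the same set of pictures.
   Context: **Valuation data.** $\nu:\overline K^\times\to\mathbb Q$ is the valuation with $\nu(K^\times)=\mathbb Z$. A Cayley octad is an ordered 8-tuple $O=(O_A,\dots,O_H)$ of points of $\mathbb P^3(\overline K)$ which is the common intersection of three quadrics. Lift each $O_i$ to a vector whose coordinates have minimum valuation $0$ and put $p_{ijkl}=\det(O_i|O_j|O_k|O_l)$ (assumed non-zero). Let $\mathcal P$ be the set of 4-element subsets of $\{A,\dots,H\}$. The valuation data of $O$ is $v:\mathcal P\cup\{\dagger\}\to\mathbb Q$ with $v_{\{i,j,k,l\}}=\nu(p_{ijkl})$ and $v_\dagger$ the twisted cubic index: the minimum, over the 840 polynomials $f=p_{iabc}p_{iade}p_{ibdf}p_{icef}-p_{iabd}p_{iace}p_{ibcf}p_{idef}$ ($i,a,\dots,f$ distinct labels), of $\nu(f(O))-\nu_{\rm gen}(f)$, where $\nu_{\rm gen}(f)$ is the valuation of $f$ at a generic octad with the same Plücker valuations, i.e. the minimum of $\nu(f)$ over all Cayley octads with the same values of $v$ on $\mathcal P$. **Elementary vectors.** For $T\subset\{A,\dots,H\}$, $S\in\mathcal P$: $v^T_{\rm pt},v^T_{\rm ln},v^T_{\rm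 pl}$ have values $\max(0,|S\cap T|-1)$, $\max(0,|S\cap T|-2)$, $\max(0,|S\cap T|-3)$ at $S$ and $0$ at $\dagger$; $v_{\rm tc}$ is $0$ on $\mathcal P$ and $1$ at $\dagger$. Sums and $\max$ are componentwise. **Building blocks** (up to permuting labels): $\alpha_{1a}^{AB}=v_{\rm pt}^{AB}$, $\alpha_{1b}^{AB}=v_{\rm pl}^{CDEFGH}$; $\alpha_{2a}^{ABCD}=v_{\rm pl}^{ABCD}+v_{\rm pl}^{EFGH}$, $\alpha_{2b}^{ABCD}=v_{\rm pl}^{ABCD}+v_{\rm pt}^{ABCD}$; $\chi_{1a}^{AB|CDE|FGH}=\max(v_{\rm ln}^{CDE}+v_{\rm ln}^{FGH},v_{\rm pl}^{CDEFGH})$, $\chi_{1b}^{AB|CDE|FGH}=\max(v_{\rm pt}^{AB},v_{\rm pl}^{ABCDE}+v_{\rm pl}^{ABFGH})$, $\chi_{1c}^{AB|CDE|FGH}=\max(v_{\rm ln}^{ABCDE}+v_{\rm ln}^{CDE},v_{\rm pt}^{CDE})$; $\chi_{2a}^{ABC}=v_{\rm ln}^{DEFGH}+v_{\rm pl}^{DEFGH}$, $\chi_{2b}^{ABC}=v_{\rm ln}^{ABC}+v_{\rm pt}^{ABC}$, $\chi_{2c}^{ABC}=v_{\rm ln}^{ABC}+v_{\rm pl}^{DEFGH}$; $\phi_{1a}^{AB|CD\|EF|GH}=v_{\rm ln}^{ABEF}+v_{\rm ln}^{ABGH}+v_{\rm pl}^{ABCD}+v_{\rm pl}^{EFGH}$,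 $\phi_{1b}^{AB|CD\|EF|GH}=\max(v_{\rm pt}^{AB}+v_{\rm pt}^{CD},v_{\rm pl}^{ABCDEF}+v_{\rm pl}^{ABCDGH})$; $\phi_{2a}^{ABC|FGH}=\max(v_{\rm ln}^{ABC}+v_{\rm ln}^{FGH},v_{\rm pl}^{ABCDE}+v_{\rm pl}^{DEFGH})$, $\phi_{2b}^{ABC|FGH}=v_{\rm pt}^{DE}+v_{\rm ln}^{ABCD}+v_{\rm ln}^{ABCE}$, $\phi_{2c}^{ABC|FGH}=v_{\rm ln}^{ABCD}+v_{\rm ln}^{ABCE}+v_{\rm pl}^{ABCFGH}$; $\phi_{3a}^{ABCD}=v_{\rm ln}^{ABCD}+v_{\rm pl}^{ABCD}+v_{\rm pl}^{EFGH}$, $\phi_{3b}^{ABCD}=v_{\rm pt}^{ABCD}+v_{\rm ln}^{ABCD}+v_{\rm pl}^{ABCD}$; $\mathbf{TCu}=v_{\rm tc}$, $\mathbf{Line}^{ABCD}=v_{\rm ln}^{ABCD}$. **Pictures.** The picture of a block (which records its $\mathrm{PGL}$-equivalence class) is its symbol with the letter a/b/c dropped, modulo: $\alpha_2^{ABCD}=\alpha_2^{EFGH}$; $\chi_1^{AB|CDE|FGH}=\chi_1^{AB|FGH|CDE}$; $\phi_1^{AB|CD\|EF|GH}$ unchanged by swapping $AB,CD$, by swapping $EF,GH$, and by swapping the two halves; $\phi_2^{ABC|FGH}=\phi_2^{FGH|ABC}$; $\phi_3^{ABCD}=\phi_3^{EFGH}$; $\mathbf{Line}^{ABCD}=\mathbf{Line}^{EFGH}$.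 **Compatibility.** Blocks with the same picture are compatible. Blocks with different pictures are compatible iff, up to permuting labels, their pictures are one of: ($\alpha,\alpha$) $\alpha_1^{AB},\alpha_1^{CD}$; $\alpha_1^{AB},\alpha_2^{ABCD}$; $\alpha_2^{ABCD},\alpha_2^{ABEF}$; ($\chi,\alpha$) $\chi_1^{AB|CDE|FGH}$ with $\alpha_1^{AB}$, $\alpha_1^{CD}$, $\alpha_2^{BCDE}$ or $\alpha_2^{ABCH}$; $\chi_2^{ABC}$ with $\alpha_1^{AB}$, $\alpha_1^{DE}$ or $\alpha_2^{ABCD}$; ($\chi,\chi$) $\chi_1^{AH|BCD|EFG},\chi_1^{BC|DEF|AGH}$; $\chi_1^{AH|BCD|EFG},\chi_2^{BCD}$; $\chi_2^{CDE},\chi_2^{FGH}$; ($\phi,\alpha$) $\phi_1^{AB|CD\|EF|GH}$ with $\alpha_1^{AB}$ or $\alpha_2^{ABEG}$; $\phi_2^{CDE|FGH}$ with $\alpha_1^{CD}$ or $\alpha_2^{EFGH}$; $\phi_3^{ABCD}$ with $\alpha_1^{AB}$; ($\phi,\chi$) $\phi_1^{AB|CD\|EF|GH},\chi_1^{AB|CEF|DGH}$; $\phi_2^{AGH|BCD},\chi_1^{AH|BCD|EFG}$; $\phi_2^{CDE|FGH},\chi_2^{FGH}$; $\phi_3^{BCDE},\chi_2^{BCD}$; (hyperelliptic) $\mathbf{TCu}$ with $\alpha_1^{AB}$ or $\chi_2^{ABC}$; $\mathbf{Line}^{ABCD}$ with $\alpha_1^{AB}$, $\alpha_2^{BCDE}$,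 $\chi_1^{AB|CDE|FGH}$ or $\chi_2^{ABC}$. **Auxiliary blocks** of a $\phi$-block: for $\phi_1^{AB|CD\|EF|GH}$: $\alpha_2^{ABCD}$ and $\mathbf{Line}$ on $ABEF,ABGH,CDEF,CDGH$; for $\phi_2^{ABC|FGH}$: $\alpha_1^{DE}$ and $\mathbf{Line}$ on $ABCD,ABCE,DFGH,EFGH$; for $\phi_3^{ABCD}$: $\alpha_2^{ABCD}$, $\mathbf{TCu}$, $\mathbf{Line}^{ABCD}$, $\mathbf{Line}^{EFGH}$. **Block decompositions.** A compatible block decomposition of $v$ is a set $\{B_1,\dots,B_n,b_1,\dots,b_k\}$, where the $B_i$ are building blocks, the $b_j$ are auxiliary blocks of $\phi$-blocks among the $B_i$, all $b_j$ having the same picture, such that $v=\sum m_iB_i+\sum l_jb_j$ with rational $m_i>0$, $l_j\ge0$, and the $B_i$ are pairwise compatible (auxiliary blocks being excluded from this test). *)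

theory Defs
  imports "HOL-Analysis.Analysis" "HOL-Algebra.Algebraic_Closure_Type"
begin

section \<open>Valued fields\<close>

text \<open>
  The field \<open>K\<close> is the type \<open>'k\<close>, and \<open>'k alg_closure\<close> is its algebraic closure.  A valuation is a
  rational-valued function on the whole type of which only the values at nonzero arguments matter;
  the value at \<open>0\<close>, mathematically \<open>\<infinity>\<close>, is unspecified and never used.
\<close>

definition valuation :: "('a::field \<Rightarrow> rat) \<Rightarrow> bool" where
  "valuation \<nu> \<longleftrightarrow>
     (\<forall>x y. x \<noteq> 0 \<longrightarrow> y \<noteq> 0 \<longrightarrow> \<nu> (x * y) = \<nu> x + \<nu> y) \<and>
     (\<forall>x y. x \<noteq> 0 \<longrightarrow> y \<noteq> 0 \<longrightarrow> x + y \<noteq> 0 \<longrightarrow> min (\<nu> x) (\<nu> y) \<le> \<nu> (x + y))"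

definition val_ge :: "('a::field \<Rightarrow> rat) \<Rightarrow> rat \<Rightarrow> 'a \<Rightarrow> bool" where
  "val_ge \<nu> r x \<longleftrightarrow> x = 0 \<or> r \<le> \<nu> x"

definition valuation_ring :: "('a::field \<Rightarrow> rat) \<Rightarrow> 'a set" where
  "valuation_ring \<nu> = {x. x = 0 \<or> 0 \<le> \<nu> x}"

definition valuation_ideal :: "('a::field \<Rightarrow> rat) \<Rightarrow> 'a set" where
  "valuation_ideal \<nu> = {x. x = 0 \<or> 0 < \<nu> x}"

text \<open>The underlying set of the residue field.\<close>

definition residue_classes :: "('a::field \<Rightarrow> rat) \<Rightarrow> 'a set set" where
  "residue_classes \<nu> = valuation_ring \<nu> //
     {(x, y). x \<in> valuation_ring \<nu> \<and> y \<in> valuation_ring \<nu> \<and> x - y \<in> valuation_ideal \<nu>}"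

definition residue_characteristic :: "('a::field \<Rightarrow> rat) \<Rightarrow> nat" where
  "residue_characteristic \<nu> = (LEAST n. 0 < n \<and> of_nat n \<in> valuation_ideal \<nu>)"

definition complete_valuation :: "('a::field \<Rightarrow> rat) \<Rightarrow> bool" where
  "complete_valuation \<nu> \<longleftrightarrow>
     (\<forall>s :: nat \<Rightarrow> 'a.
        (\<forall>r. \<exists>N. \<forall>m\<ge>N. \<forall>n\<ge>N. val_ge \<nu> r (s m - s n)) \<longrightarrow>
        (\<exists>t. \<forall>r. \<exists>N. \<forall>n\<ge>N. val_ge \<nu> r (s n - t)))"

text \<open>
  The type \<open>'k\<close> is a non-archimedean local field, and \<open>\<nu>\<close> is the extension to its algebraic closure
  of its normalised valuation.
\<close>

definition local_field_valuation :: "('k::field alg_closure \<Rightarrow> rat) \<Rightarrow> bool" where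
  "local_field_valuation \<nu> \<longleftrightarrow>
     valuation \<nu> \<and>
     (\<lambda>x. \<nu> (to_ac x)) ` {x :: 'k. x \<noteq> 0} = \<int> \<and>
     complete_valuation (\<lambda>x :: 'k. \<nu> (to_ac x)) \<and>
     finite (residue_classes (\<lambda>x :: 'k. \<nu> (to_ac x)))"


section \<open>Cayley octads\<close>

datatype label = A | B | C | D | E | F | G | H

text \<open>Points of projective 3-space are one-dimensional subspaces of the space of 4-vectors.\<close>

definition projective_points :: "('a::field ^ 4) set set" where
  "projective_points = {L. vec.subspace L \<and> vec.dim L = 1}"

definition quadratic_form :: "'a::field ^ 4 ^ 4 \<Rightarrow> 'a ^ 4 \<Rightarrow> 'a" where
  "quadratic_form M x = (\<Sum>i\<in>UNIV. \<Sum>j\<in>UNIV. M $ i $ j * x $ i * x $ j)"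

text \<open>
  A quadric is given by a nonzero symmetric matrix; this is the general quadratic form because only
  fields of characteristic other than 2 are considered.
\<close>

definition quadric :: "'a::field ^ 4 ^ 4 \<Rightarrow> ('a ^ 4) set set" where
  "quadric M = {L \<in> projective_points. \<forall>x\<in>L. quadratic_form M x = 0}"

definition cayley_octad :: "(label \<Rightarrow> ('a::field ^ 4) set) \<Rightarrow> bool" where
  "cayley_octad oct \<longleftrightarrow>
     inj oct \<and>
     (\<exists>M1 M2 M3 :: 'a ^ 4 ^ 4.
        (\<forall>M\<in>{M1, M2, M3}. M \<noteq> 0 \<and> transpose M = M) \<and>
        range oct = quadric M1 \<inter> quadric M2 \<inter> quadric M3)"

text \<open>\<open>x\<close> lifts each point of \<open>oct\<close> to a vector whose coordinates have minimum valuation 0.\<close>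

definition normalized_lift ::
    "('a::field \<Rightarrow> rat) \<Rightarrow> (label \<Rightarrow> ('a ^ 4) set) \<Rightarrow> (label \<Rightarrow> 'a ^ 4) \<Rightarrow> bool" where
  "normalized_lift \<nu> oct x \<longleftrightarrow>
     (\<forall>i. x i \<in> oct i \<and> x i \<noteq> 0 \<and> Min {\<nu> (x i $ c) | c. x i $ c \<noteq> 0} = 0)"

definition plucker :: "(label \<Rightarrow> 'a::field ^ 4) \<Rightarrow> label \<Rightarrow> label \<Rightarrow> label \<Rightarrow> label \<Rightarrow> 'a" where
  "plucker x i j k l = det (transpose (vector [x i, x j, x k, x l] :: 'a ^ 4 ^ 4))"

definition plucker_valuations ::
    "('a::field \<Rightarrow> rat) \<Rightarrow> (label \<Rightarrow> 'a ^ 4) \<Rightarrow> (label set \<Rightarrow> rat) \<Rightarrow> bool" where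
  "plucker_valuations \<nu> x u \<longleftrightarrow>
     (\<forall>i j k l. distinct [i, j, k, l] \<longrightarrow>
        plucker x i j k l \<noteq> 0 \<and> u {i, j, k, l} = \<nu> (plucker x i j k l))"

definition twisted_cubic_polys :: "((label \<Rightarrow> 'a::field ^ 4) \<Rightarrow> 'a) set" where
  "twisted_cubic_polys =
     {(\<lambda>x. plucker x i a b c * plucker x i a d e * plucker x i b d f * plucker x i c e f -
           plucker x i a b d * plucker x i a c e * plucker x i b c f * plucker x i d e f)
      | i a b c d e f. distinct [i, a, b, c, d, e, f]}"

text \<open>
  Octads at which \<open>f\<close> vanishes have valuation \<open>\<infinity>\<close> and so do not affect the minima below, neither
  over octads nor over twisted cubic polynomials.
\<close>

definition generic_valuation ::
    "('a::field \<Rightarrow> rat) \<Rightarrow> (label set \<Rightarrow> rat) \<Rightarrow> ((label \<Rightarrow> 'a ^ 4) \<Rightarrow> 'a) \<Rightarrow> rat" where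
  "generic_valuation \<nu> u f =
     (LEAST q. \<exists>oct x. cayley_octad oct \<and> normalized_lift \<nu> oct x \<and> plucker_valuations \<nu> x u \<and>
                     f x \<noteq> 0 \<and> q = \<nu> (f x))"

datatype coord = Pl "label set" | Dagger

definition coords :: "coord set" where
  "coords = insert Dagger (Pl ` {S. card S = 4})"

text \<open>
  The valuations involved do not depend on the chosen lift.  The nonvanishing of the Pluecker
  coordinates is part of \<^const>\<open>plucker_valuations\<close>.
\<close>

definition valuation_data ::
    "('a::field \<Rightarrow> rat) \<Rightarrow> (label \<Rightarrow> ('a ^ 4) set) \<Rightarrow> (coord \<Rightarrow> rat) \<Rightarrow> bool" where
  "valuation_data \<nu> oct v \<longleftrightarrow>
     (\<exists>x. normalized_lift \<nu> oct x \<and>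
          plucker_valuations \<nu> x (\<lambda>S. v (Pl S)) \<and>
          v Dagger = Min {\<nu> (f x) - generic_valuation \<nu> (\<lambda>S. v (Pl S)) f
                          | f. f \<in> twisted_cubic_polys \<and> f x \<noteq> 0})"


section \<open>Building blocks\<close>

fun elementary :: "nat \<Rightarrow> label set \<Rightarrow> coord \<Rightarrow> rat" where
  "elementary k T (Pl S) = max 0 (of_nat (card (S \<inter> T)) - of_nat k)"
| "elementary k T Dagger = 0"

abbreviation v_pt :: "label set \<Rightarrow> coord \<Rightarrow> rat" where "v_pt \<equiv> elementary 1"
abbreviation v_ln :: "label set \<Rightarrow> coord \<Rightarrow> rat" where "v_ln \<equiv> elementary 2"
abbreviation v_pl :: "label set \<Rightarrow> coord \<Rightarrow> rat" where "v_pl \<equiv> elementary 3"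

fun v_tc :: "coord \<Rightarrow> rat" where
  "v_tc (Pl S) = 0"
| "v_tc Dagger = 1"

text \<open>
  A symbol is the name of a building block without its letter a/b/c; the arguments are the groups
  of labels of the superscript, in the order in which they are written.
\<close>

datatype symbol =
    Alpha1 "label set"
  | Alpha2 "label set"
  | Chi1 "label set" "label set" "label set"
  | Chi2 "label set"
  | Phi1 "label set" "label set" "label set" "label set"
  | Phi2 "label set" "label set"
  | Phi3 "label set"
  | TCu
  | Line "label set"

fun valid_symbol :: "symbol \<Rightarrow> bool" where
  "valid_symbol (Alpha1 ab) \<longleftrightarrow> card ab = 2"
| "valid_symbol (Alpha2 abcd) \<longleftrightarrow> card abcd = 4"
| "valid_symbol (Chi1 ab cde fgh) \<longleftrightarrow>
     card ab = 2 \<and> card cde = 3 \<and> card fgh = 3 \<and> ab \<union> cde \<union> fgh = UNIV"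
| "valid_symbol (Chi2 abc) \<longleftrightarrow> card abc = 3"
| "valid_symbol (Phi1 ab cd ef gh) \<longleftrightarrow>
     card ab = 2 \<and> card cd = 2 \<and> card ef = 2 \<and> card gh = 2 \<and> ab \<union> cd \<union> ef \<union> gh = UNIV"
| "valid_symbol (Phi2 abc fgh) \<longleftrightarrow> card abc = 3 \<and> card fgh = 3 \<and> abc \<inter> fgh = {}"
| "valid_symbol (Phi3 abcd) \<longleftrightarrow> card abcd = 4"
| "valid_symbol TCu \<longleftrightarrow> True"
| "valid_symbol (Line abcd) \<longleftrightarrow> card abcd = 4"

datatype letter = LetterA | LetterB | LetterC | NoLetter

type_synonym block = "symbol \<times> letter"

fun letters :: "symbol \<Rightarrow> letter set" where
  "letters (Alpha1 _) = {LetterA, LetterB}"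
| "letters (Alpha2 _) = {LetterA, LetterB}"
| "letters (Chi1 _ _ _) = {LetterA, LetterB, LetterC}"
| "letters (Chi2 _) = {LetterA, LetterB, LetterC}"
| "letters (Phi1 _ _ _ _) = {LetterA, LetterB}"
| "letters (Phi2 _ _) = {LetterA, LetterB, LetterC}"
| "letters (Phi3 _) = {LetterA, LetterB}"
| "letters TCu = {NoLetter}"
| "letters (Line _) = {NoLetter}"

definition building_blocks :: "block set" where
  "building_blocks = {(s, t). valid_symbol s \<and> t \<in> letters s}"

text \<open>
  In the equations for \<open>Phi2\<close>, where the labels \<open>D\<close>, \<open>E\<close> do not occur in the symbol, the sum
  \<open>v\<^sub>l\<^sub>n\<close> of \<open>ABCD\<close> plus \<open>v\<^sub>l\<^sub>n\<close> of \<open>ABCE\<close> is the sum over the two labels outside \<open>ABC\<close> and \<open>FGH\<close>.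
  Pairs outside \<^const>\<open>building_blocks\<close> get the junk value 0.
\<close>

fun block_vector :: "block \<Rightarrow> coord \<Rightarrow> rat" where
  "block_vector (Alpha1 ab, LetterA) z = v_pt ab z"
| "block_vector (Alpha1 ab, LetterB) z = v_pl (- ab) z"
| "block_vector (Alpha2 abcd, LetterA) z = v_pl abcd z + v_pl (- abcd) z"
| "block_vector (Alpha2 abcd, LetterB) z = v_pl abcd z + v_pt abcd z"
| "block_vector (Chi1 ab cde fgh, LetterA) z =
     max (v_ln cde z + v_ln fgh z) (v_pl (cde \<union> fgh) z)"
| "block_vector (Chi1 ab cde fgh, LetterB) z =
     max (v_pt ab z) (v_pl (ab \<union> cde) z + v_pl (ab \<union> fgh) z)"
| "block_vector (Chi1 ab cde fgh, LetterC) z =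
     max (v_ln (ab \<union> cde) z + v_ln cde z) (v_pt cde z)"
| "block_vector (Chi2 abc, LetterA) z = v_ln (- abc) z + v_pl (- abc) z"
| "block_vector (Chi2 abc, LetterB) z = v_ln abc z + v_pt abc z"
| "block_vector (Chi2 abc, LetterC) z = v_ln abc z + v_pl (- abc) z"
| "block_vector (Phi1 ab cd ef gh, LetterA) z =
     v_ln (ab \<union> ef) z + v_ln (ab \<union> gh) z + v_pl (ab \<union> cd) z + v_pl (ef \<union> gh) z"
| "block_vector (Phi1 ab cd ef gh, LetterB) z =
     max (v_pt ab z + v_pt cd z) (v_pl (ab \<union> cd \<union> ef) z + v_pl (ab \<union> cd \<union> gh) z)"
| "block_vector (Phi2 abc fgh, LetterA) z =
     max (v_ln abc z + v_ln fgh z) (v_pl (- fgh) z + v_pl (- abc) z)"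
| "block_vector (Phi2 abc fgh, LetterB) z =
     v_pt (- (abc \<union> fgh)) z + (\<Sum>d\<in>- (abc \<union> fgh). v_ln (insert d abc) z)"
| "block_vector (Phi2 abc fgh, LetterC) z =
     (\<Sum>d\<in>- (abc \<union> fgh). v_ln (insert d abc) z) + v_pl (abc \<union> fgh) z"
| "block_vector (Phi3 abcd, LetterA) z = v_ln abcd z + v_pl abcd z + v_pl (- abcd) z"
| "block_vector (Phi3 abcd, LetterB) z = v_pt abcd z + v_ln abcd z + v_pl abcd z"
| "block_vector (TCu, NoLetter) z = v_tc z"
| "block_vector (Line abcd, NoLetter) z = v_ln abcd z"
| "block_vector _ z = 0"


section \<open>Pictures and compatibility\<close>

text \<open>
  Pictures are symbols modulo the identifications, which are built into the types: unordered
  groups are collected in a set.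
\<close>

datatype picture =
    Alpha1_pic "label set"
  | Alpha2_pic "label set set"
  | Chi1_pic "label set" "label set set"
  | Chi2_pic "label set"
  | Phi1_pic "label set set set"
  | Phi2_pic "label set set"
  | Phi3_pic "label set set"
  | TCu_pic
  | Line_pic "label set set"

fun symbol_picture :: "symbol \<Rightarrow> picture" where
  "symbol_picture (Alpha1 ab) = Alpha1_pic ab"
| "symbol_picture (Alpha2 abcd) = Alpha2_pic {abcd, - abcd}"
| "symbol_picture (Chi1 ab cde fgh) = Chi1_pic ab {cde, fgh}"
| "symbol_picture (Chi2 abc) = Chi2_pic abc"
| "symbol_picture (Phi1 ab cd ef gh) = Phi1_pic {{ab, cd}, {ef, gh}}"
| "symbol_picture (Phi2 abc fgh) = Phi2_pic {abc, fgh}"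
| "symbol_picture (Phi3 abcd) = Phi3_pic {abcd, - abcd}"
| "symbol_picture TCu = TCu_pic"
| "symbol_picture (Line abcd) = Line_pic {abcd, - abcd}"

definition picture :: "block \<Rightarrow> picture" where
  "picture b = symbol_picture (fst b)"

fun relabel :: "(label \<Rightarrow> label) \<Rightarrow> symbol \<Rightarrow> symbol" where
  "relabel \<pi> (Alpha1 ab) = Alpha1 (\<pi> ` ab)"
| "relabel \<pi> (Alpha2 abcd) = Alpha2 (\<pi> ` abcd)"
| "relabel \<pi> (Chi1 ab cde fgh) = Chi1 (\<pi> ` ab) (\<pi> ` cde) (\<pi> ` fgh)"
| "relabel \<pi> (Chi2 abc) = Chi2 (\<pi> ` abc)"
| "relabel \<pi> (Phi1 ab cd ef gh) = Phi1 (\<pi> ` ab) (\<pi> ` cd) (\<pi> ` ef) (\<pi> ` gh)"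
| "relabel \<pi> (Phi2 abc fgh) = Phi2 (\<pi> ` abc) (\<pi> ` fgh)"
| "relabel \<pi> (Phi3 abcd) = Phi3 (\<pi> ` abcd)"
| "relabel \<pi> TCu = TCu"
| "relabel \<pi> (Line abcd) = Line (\<pi> ` abcd)"

definition compatibility_table :: "(symbol \<times> symbol) set" where
  "compatibility_table =
    {(Alpha1 {A,B}, Alpha1 {C,D}),
     (Alpha1 {A,B}, Alpha2 {A,B,C,D}),
     (Alpha2 {A,B,C,D}, Alpha2 {A,B,E,F}),

     (Chi1 {A,B} {C,D,E} {F,G,H}, Alpha1 {A,B}),
     (Chi1 {A,B} {C,D,E} {F,G,H}, Alpha1 {C,D}),
     (Chi1 {A,B} {C,D,E} {F,G,H}, Alpha2 {B,C,D,E}),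
     (Chi1 {A,B} {C,D,E} {F,G,H}, Alpha2 {A,B,C,H}),
     (Chi2 {A,B,C}, Alpha1 {A,B}),
     (Chi2 {A,B,C}, Alpha1 {D,E}),
     (Chi2 {A,B,C}, Alpha2 {A,B,C,D}),

     (Chi1 {A,H} {B,C,D} {E,F,G}, Chi1 {B,C} {D,E,F} {A,G,H}),
     (Chi1 {A,H} {B,C,D} {E,F,G}, Chi2 {B,C,D}),
     (Chi2 {C,D,E}, Chi2 {F,G,H}),

     (Phi1 {A,B} {C,D} {E,F} {G,H}, Alpha1 {A,B}),
     (Phi1 {A,B} {C,D} {E,F} {G,H}, Alpha2 {A,B,E,G}),
     (Phi2 {C,D,E} {F,G,H}, Alpha1 {C,D}),
     (Phi2 {C,D,E} {F,G,H}, Alpha2 {E,F,G,H}),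
     (Phi3 {A,B,C,D}, Alpha1 {A,B}),

     (Phi1 {A,B} {C,D} {E,F} {G,H}, Chi1 {A,B} {C,E,F} {D,G,H}),
     (Phi2 {A,G,H} {B,C,D}, Chi1 {A,H} {B,C,D} {E,F,G}),
     (Phi2 {C,D,E} {F,G,H}, Chi2 {F,G,H}),
     (Phi3 {B,C,D,E}, Chi2 {B,C,D}),

     (TCu, Alpha1 {A,B}),
     (TCu, Chi2 {A,B,C}),
     (Line {A,B,C,D}, Alpha1 {A,B}),
     (Line {A,B,C,D}, Alpha2 {B,C,D,E}),
     (Line {A,B,C,D}, Chi1 {A,B} {C,D,E} {F,G,H}),
     (Line {A,B,C,D}, Chi2 {A,B,C})}"

definition compatible :: "block \<Rightarrow> block \<Rightarrow> bool" where
  "compatible b c \<longleftrightarrow>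
     picture b = picture c \<or>
     (\<exists>\<pi>. bij \<pi> \<and> (\<exists>(s, t)\<in>compatibility_table.
        {picture b, picture c} = {symbol_picture (relabel \<pi> s), symbol_picture (relabel \<pi> t)}))"

fun auxiliary_symbols :: "symbol \<Rightarrow> symbol set" where
  "auxiliary_symbols (Phi1 ab cd ef gh) =
     {Alpha2 (ab \<union> cd), Line (ab \<union> ef), Line (ab \<union> gh), Line (cd \<union> ef), Line (cd \<union> gh)}"
| "auxiliary_symbols (Phi2 abc fgh) =
     insert (Alpha1 (- (abc \<union> fgh)))
       ((\<lambda>(S, d). Line (insert d S)) ` ({abc, fgh} \<times> - (abc \<union> fgh)))"
| "auxiliary_symbols (Phi3 abcd) = {Alpha2 abcd, TCu, Line abcd, Line (- abcd)}"
| "auxiliary_symbols _ = {}"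

text \<open>
  The list of auxiliary blocks leaves out the letters a/b of the \<open>\<alpha>\<close>-blocks in it, so every block
  with one of the listed pictures counts.
\<close>

definition auxiliary_blocks :: "block \<Rightarrow> block set" where
  "auxiliary_blocks b =
     {c \<in> building_blocks. picture c \<in> symbol_picture ` auxiliary_symbols (fst b)}"


section \<open>Block decompositions\<close>

text \<open>
  \<open>Bs\<close> are the main blocks, with coefficients \<open>m\<close>, and \<open>bs\<close> the auxiliary ones, with
  coefficients \<open>l\<close>.
\<close>

definition compatible_block_decomposition ::
    "(coord \<Rightarrow> rat) \<Rightarrow> block set \<Rightarrow> (block \<Rightarrow> rat) \<Rightarrow> block set \<Rightarrow> (block \<Rightarrow> rat) \<Rightarrow> bool" where
  "compatible_block_decomposition v Bs m bs l \<longleftrightarrow>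
     finite Bs \<and> finite bs \<and>
     Bs \<subseteq> building_blocks \<and>
     bs \<subseteq> (\<Union>b\<in>Bs. auxiliary_blocks b) \<and>
     (\<forall>b\<in>bs. \<forall>c\<in>bs. picture b = picture c) \<and>
     (\<forall>b\<in>Bs. 0 < m b) \<and>
     (\<forall>b\<in>bs. 0 \<le> l b) \<and>
     (\<forall>b\<in>Bs. \<forall>c\<in>Bs. compatible b c) \<and>
     (\<forall>z\<in>coords. v z = (\<Sum>b\<in>Bs. m b * block_vector b z) + (\<Sum>b\<in>bs. l b * block_vector b z))"

definition decomposition_pictures ::
    "block set \<Rightarrow> (block \<Rightarrow> rat) \<Rightarrow> block set \<Rightarrow> (block \<Rightarrow> rat) \<Rightarrow> picture set" where
  "decomposition_pictures Bs m bs l =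
     picture ` ({b \<in> Bs. m b \<noteq> 0} \<union> {b \<in> bs. l b \<noteq> 0})"

hide_const (open) A B C D E F G H

end

theory Submission
  imports Defs
begin

text \<open>
  Up to the ambiguity of \<open>PGL\<close>, which changes the values at 4-element sets \<open>S\<close> by
  \<open>c + (\<Sum>i\<in>S. w\<^sub>i)\<close>, the vector of a building block depends on its picture only.  The theorem
  therefore says that the cones spanned by the sets of pictures that may occur in a decomposition have disjoint
  relative interiors.

  The ambiguity is removed by adding the values of \<open>v\<close> at \<open>S\<close> and at the complement of \<open>S\<close>, and by
  looking at differences of such sums in which constants cancel.  Two kinds of differences, called tests here,
  suffice.  The first compares two monomials of a three-term Pluecker relation between the points
  seen from two of them, the second compares the two monomials of a twisted cubic polynomial.
  Two properties of tests carry the proof.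

  First, pictures which occur together in a decomposition, auxiliary ones included, never have
  strictly opposite signs on a test (\<open>compatible_conform\<close>).  Hence no cancellation takes place when a
  test is evaluated on a decomposition: the positive part of a test, which is only piecewise linear,
  is additive on it (\<open>positive_part\<close>).  Moreover the sign of a test at \<open>v\<close> can be read off from any
  picture at which it is nonzero, so pictures of two decompositions of the same \<open>v\<close> do not
  have opposite signs either.

  Second, tests isolate pictures.  Order the kinds of pictures as \<open>\<phi>\<^sub>1, \<phi>\<^sub>2, \<phi>\<^sub>3\<close>, \<open>Line\<close>,
  \<open>\<chi>\<^sub>1, \<chi>\<^sub>2, \<alpha>\<^sub>1, \<alpha>\<^sub>2\<close>.  In a set of pictures without opposite signs on any test, for every picture \<open>P\<close> some
  test is positive at \<open>P\<close> and at no other picture of the same or a later kind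
  (\<open>admissible_witnessed\<close>).

  Given two decompositions of \<open>v\<close>, the union of their sets of pictures has no opposite signs.
  Comparing the positive parts of tests shows that the differences \<open>d\<^sub>P\<close> of the two coefficients
  satisfy \<open>\<Sum> d\<^sub>P t\<^sup>+(P) = 0\<close> for every test \<open>t\<close>.  Going through the kinds in the above order, a test that
  isolates \<open>P\<close> from the pictures whose difference is not yet known to vanish gives \<open>d\<^sub>P = 0\<close>.
  The twisted cubic block is the only one with a nonzero entry at \<open>\<dagger>\<close>, which gives its coefficient
  directly.  So even the total coefficients of the pictures agree (\<open>pictures_unique\<close>).

  Both properties of tests are finite statements, invariant under relabelling.  For the first one
  it suffices to go through the table of compatible pairs and, up to sign and symmetry,
  630 tests of the first and 105 of the second kind.  For the second property one picture of each kind is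
  enough.  Here a short list of tests already has opposite signs at \<open>P\<close> and at most of the other pictures,
  and a search tree, in which a chosen test either isolates \<open>P\<close> or is positive at some other picture
  and thereby excludes many more, deals with the remaining ones.  These finite checks are carried
  out by rewriting.
\<close>

section \<open>The level of a symbol on a splitting of the labels\<close>

text \<open>
  A symbol is described by its kind and by the colouring of the eight labels by the groups of its
  superscript.  This makes relabelling a composition of functions and lets the finite checks
  run over colourings.
\<close>

datatype colour = First | Second | Third | Fourth

datatype kind = Alpha1_kind | Alpha2_kind | Chi1_kind | Chi2_kind | Phi1_kind | Phi2_kind | Phi3_kind | TCu_kind | Line_kind

fun kind_of :: "symbol \<Rightarrow> kind" where
  "kind_of (Alpha1 _) = Alpha1_kind"
| "kind_of (Alpha2 _) = Alpha2_kind"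
| "kind_of (Chi1 _ _ _) = Chi1_kind"
| "kind_of (Chi2 _) = Chi2_kind"
| "kind_of (Phi1 _ _ _ _) = Phi1_kind"
| "kind_of (Phi2 _ _) = Phi2_kind"
| "kind_of (Phi3 _) = Phi3_kind"
| "kind_of TCu = TCu_kind"
| "kind_of (Line _) = Line_kind"

fun colouring :: "symbol \<Rightarrow> label \<Rightarrow> colour" where
  "colouring (Alpha1 ab) x = (if x \<in> ab then First else Second)"
| "colouring (Alpha2 abcd) x = (if x \<in> abcd then First else Second)"
| "colouring (Chi1 ab cde fgh) x =
     (if x \<in> ab then First else if x \<in> cde then Second else Third)"
| "colouring (Chi2 abc) x = (if x \<in> abc then First else Second)"
| "colouring (Phi1 ab cd ef gh) x =
     (if x \<in> ab then First else if x \<in> cd then Second else if x \<in> ef then Third else Fourth)"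
| "colouring (Phi2 abc fgh) x =
     (if x \<in> abc then First else if x \<in> fgh then Second else Third)"
| "colouring (Phi3 abcd) x = (if x \<in> abcd then First else Second)"
| "colouring TCu x = First"
| "colouring (Line abcd) x = (if x \<in> abcd then First else Second)"

datatype tally = Tally nat nat nat nat

text \<open>
  Up to a constant, the sum of the entries of a block vector at \<open>S\<close> and at the complement of \<open>S\<close> depends
  only on how many labels of each colour \<open>S\<close> has.  The level is this value, normalised to
  have minimum 0.  Numbers are written in unary because the function is evaluated by rewriting.
\<close>

fun level :: "kind \<Rightarrow> tally \<Rightarrow> nat" where
  "level Alpha1_kind (Tally a b c d) = (if a = Suc 0 then 0 else Suc 0)"
| "level Alpha2_kind (Tally a b c d) = (if a = 0 \<or> b = 0 then Suc (Suc 0) else 0)"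
| "level Chi1_kind (Tally a b c d) =
     (if a = Suc 0 then if b = 0 \<or> c = 0 then Suc (Suc 0) else 0 else Suc 0)"
| "level Chi2_kind (Tally a b c d) = (if a = 0 \<or> a = Suc (Suc (Suc 0)) then Suc (Suc 0) else 0)"
| "level Phi1_kind (Tally a b c d) =
     (if (a = Suc 0) = (b = Suc 0) then if a = Suc 0 \<and> c = Suc 0 then 0 else Suc (Suc 0)
      else Suc 0)"
| "level Phi2_kind (Tally a b c d) =
     (if a = 0 \<or> a = Suc (Suc (Suc 0)) \<or> b = 0 \<or> b = Suc (Suc (Suc 0)) then Suc (Suc 0) else 0)"
| "level Phi3_kind (Tally a b c d) =
     (if a = 0 \<or> b = 0 then Suc (Suc (Suc (Suc 0))) else if a = Suc (Suc 0) then 0 else Suc 0)"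
| "level TCu_kind (Tally a b c d) = 0"
| "level Line_kind (Tally a b c d) =
     (if a = 0 \<or> b = 0 then Suc (Suc 0) else if a = Suc (Suc 0) then 0 else Suc 0)"

definition tally_of :: "(label \<Rightarrow> colour) \<Rightarrow> label set \<Rightarrow> tally" where
  "tally_of f S = Tally (card {x \<in> S. f x = First}) (card {x \<in> S. f x = Second})
     (card {x \<in> S. f x = Third}) (card {x \<in> S. f x = Fourth})"

definition symbol_level :: "symbol \<Rightarrow> label set \<Rightarrow> nat" where
  "symbol_level s S = level (kind_of s) (tally_of (colouring s) S)"

lemma UNIV_label: "UNIV = {label.A, label.B, label.C, label.D, label.E, label.F, label.G, label.H}"
  by (auto intro: label.exhaust)

instance label :: finite
  by standard (simp add: UNIV_label)

lemma card_UNIV_label: "card (UNIV :: label set) = 8"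
  by (simp add: UNIV_label)

lemma card_Compl_label: "card (- V) = 8 - card V" for V :: "label set"
  by (simp add: card_UNIV_label Compl_eq_Diff_UNIV card_Diff_subset)

lemma card_Compl_Int: "card (- S \<inter> T) = card T - card (S \<inter> (T :: label set))"
proof -
  have "- S \<inter> T = T - S \<inter> T" by auto
  then show ?thesis by (simp add: card_Diff_subset)
qed

lemma card_Int_Compl: "card (S \<inter> - T) = card S - card (S \<inter> (T :: label set))"
  by (metis Int_commute card_Compl_Int)

text \<open>
  The validity of a symbol prescribes the sizes of the groups and their union; it is the count of
  eight labels which makes the groups disjoint.
\<close>

lemma disjoint_of_card:
  "finite V \<Longrightarrow> finite W \<Longrightarrow> card V + card W \<le> card (V \<union> W) \<Longrightarrow> V \<inter> W = {}"
  by (metis add_le_same_cancel1 card_Un_Int card_eq_0_iff finite_Int le_zero_eq)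

lemma Chi1_groups:
  assumes "valid_symbol (Chi1 ab cde fgh)"
  shows "ab \<inter> cde = {}" "ab \<inter> fgh = {}" "cde \<inter> fgh = {}"
proof -
  have c: "card ab = 2" "card cde = 3" "card fgh = 3" and u: "ab \<union> cde \<union> fgh = UNIV"
    using assms by auto
  have "8 \<le> card (ab \<union> cde) + card fgh"
    using card_Un_le[of "ab \<union> cde" fgh] by (simp add: u card_UNIV_label)
  then have le: "card ab + card cde \<le> card (ab \<union> cde)" using c by simp
  then show 1: "ab \<inter> cde = {}" by (intro disjoint_of_card) auto
  have "(ab \<union> cde) \<inter> fgh = {}"
    by (rule disjoint_of_card) (use c u card_Un_disjoint[OF _ _ 1] in \<open>auto simp: card_UNIV_label\<close>)
  then show "ab \<inter> fgh = {}" "cde \<inter> fgh = {}" by auto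
qed

lemma Phi1_groups:
  assumes "valid_symbol (Phi1 ab cd ef gh)"
  shows "ab \<inter> cd = {}" "ab \<inter> ef = {}" "ab \<inter> gh = {}" "cd \<inter> ef = {}" "cd \<inter> gh = {}" "ef \<inter> gh = {}"
proof -
  have c: "card ab = 2" "card cd = 2" "card ef = 2" "card gh = 2" and u: "ab \<union> cd \<union> ef \<union> gh = UNIV"
    using assms by auto
  have le: "8 \<le> card (ab \<union> cd \<union> ef) + card gh"
    using card_Un_le[of "ab \<union> cd \<union> ef" gh] by (simp add: u card_UNIV_label)
  have le': "card (ab \<union> cd \<union> ef) \<le> card (ab \<union> cd) + card ef"
    by (rule card_Un_le)
  have 1: "ab \<inter> cd = {}" by (rule disjoint_of_card) (use le le' c in auto)
  have 2: "(ab \<union> cd) \<inter> ef = {}"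
    by (rule disjoint_of_card) (use le c card_Un_disjoint[OF _ _ 1] in auto)
  have 3: "(ab \<union> cd \<union> ef) \<inter> gh = {}"
    by (rule disjoint_of_card)
      (use c u card_Un_disjoint[OF _ _ 1] card_Un_disjoint[OF _ _ 2] in \<open>auto simp: card_UNIV_label\<close>)
  show "ab \<inter> cd = {}" "ab \<inter> ef = {}" "ab \<inter> gh = {}" "cd \<inter> ef = {}" "cd \<inter> gh = {}" "ef \<inter> gh = {}"
    using 1 2 3 by auto
qed

lemma tally_two:
  "tally_of (colouring (Alpha1 T)) S = Tally (card (S \<inter> T)) (card S - card (S \<inter> T)) 0 0"
  "tally_of (colouring (Alpha2 T)) S = Tally (card (S \<inter> T)) (card S - card (S \<inter> T)) 0 0"
  "tally_of (colouring (Chi2 T)) S = Tally (card (S \<inter> T)) (card S - card (S \<inter> T)) 0 0"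
  "tally_of (colouring (Phi3 T)) S = Tally (card (S \<inter> T)) (card S - card (S \<inter> T)) 0 0"
  "tally_of (colouring (Line T)) S = Tally (card (S \<inter> T)) (card S - card (S \<inter> T)) 0 0"
proof -
  have "{x \<in> S. (if x \<in> T then First else Second) = First} = S \<inter> T"
    "{x \<in> S. (if x \<in> T then First else Second) = Second} = S \<inter> - T"
    "{x \<in> S. (if x \<in> T then First else Second) = Third} = {}"
    "{x \<in> S. (if x \<in> T then First else Second) = Fourth} = {}"
    by (auto split: if_splits)
  then have "tally_of (\<lambda>x. if x \<in> T then First else Second) S
      = Tally (card (S \<inter> T)) (card S - card (S \<inter> T)) 0 0"
    by (simp add: tally_of_def card_Int_Compl)
  then show "tally_of (colouring (Alpha1 T)) S = Tally (card (S \<inter> T)) (card S - card (S \<inter> T)) 0 0"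
    "tally_of (colouring (Alpha2 T)) S = Tally (card (S \<inter> T)) (card S - card (S \<inter> T)) 0 0"
    "tally_of (colouring (Chi2 T)) S = Tally (card (S \<inter> T)) (card S - card (S \<inter> T)) 0 0"
    "tally_of (colouring (Phi3 T)) S = Tally (card (S \<inter> T)) (card S - card (S \<inter> T)) 0 0"
    "tally_of (colouring (Line T)) S = Tally (card (S \<inter> T)) (card S - card (S \<inter> T)) 0 0"
    by (simp_all add: tally_of_def)
qed

lemma tally_Chi1:
  assumes "valid_symbol (Chi1 ab cde fgh)"
  shows "tally_of (colouring (Chi1 ab cde fgh)) S
    = Tally (card (S \<inter> ab)) (card (S \<inter> cde)) (card (S \<inter> fgh)) 0"
proof -
  have u: "x \<in> ab \<or> x \<in> cde \<or> x \<in> fgh" for x using assms by auto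
  have "{x \<in> S. colouring (Chi1 ab cde fgh) x = First} = S \<inter> ab"
    "{x \<in> S. colouring (Chi1 ab cde fgh) x = Second} = S \<inter> cde"
    "{x \<in> S. colouring (Chi1 ab cde fgh) x = Third} = S \<inter> fgh"
    "{x \<in> S. colouring (Chi1 ab cde fgh) x = Fourth} = {}"
    using Chi1_groups[OF assms] u by (auto split: if_splits)
  then show ?thesis by (simp add: tally_of_def)
qed

lemma tally_Phi1:
  assumes "valid_symbol (Phi1 ab cd ef gh)"
  shows "tally_of (colouring (Phi1 ab cd ef gh)) S
    = Tally (card (S \<inter> ab)) (card (S \<inter> cd)) (card (S \<inter> ef)) (card (S \<inter> gh))"
proof -
  have u: "x \<in> gh \<longleftrightarrow> x \<notin> ab \<and> x \<notin> cd \<and> x \<notin> ef" for x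
    using assms Phi1_groups[OF assms] by auto
  have "{x \<in> S. colouring (Phi1 ab cd ef gh) x = First} = S \<inter> ab"
    "{x \<in> S. colouring (Phi1 ab cd ef gh) x = Second} = S \<inter> cd"
    "{x \<in> S. colouring (Phi1 ab cd ef gh) x = Third} = S \<inter> ef"
    "{x \<in> S. colouring (Phi1 ab cd ef gh) x = Fourth} = S \<inter> gh"
    using Phi1_groups[OF assms] by (auto simp: u split: if_splits)
  then show ?thesis by (simp add: tally_of_def)
qed

lemma tally_Phi2:
  assumes "valid_symbol (Phi2 abc fgh)"
  shows "tally_of (colouring (Phi2 abc fgh)) S
    = Tally (card (S \<inter> abc)) (card (S \<inter> fgh)) (card (S \<inter> - (abc \<union> fgh))) 0"
proof -
  have "{x \<in> S. colouring (Phi2 abc fgh) x = First} = S \<inter> abc"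
    "{x \<in> S. colouring (Phi2 abc fgh) x = Second} = S \<inter> fgh"
    "{x \<in> S. colouring (Phi2 abc fgh) x = Third} = S \<inter> - (abc \<union> fgh)"
    "{x \<in> S. colouring (Phi2 abc fgh) x = Fourth} = {}"
    using assms by (auto split: if_splits)
  then show ?thesis by (simp add: tally_of_def)
qed

lemma card_Int_sum2:
  "V \<inter> W = {} \<Longrightarrow> card (S \<inter> (V \<union> W)) = card (S \<inter> V) + card (S \<inter> (W :: label set))"
  by (subst card_Un_disjoint[symmetric]) (auto intro!: arg_cong[where f = card])

lemma Chi1_sum:
  assumes "valid_symbol (Chi1 ab cde fgh)"
  shows "card (S \<inter> ab) + card (S \<inter> cde) + card (S \<inter> fgh) = card S"
proof -
  have "card S = card (S \<inter> (ab \<union> cde \<union> fgh))" using assms by simp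
  also have "\<dots> = card (S \<inter> ab) + card (S \<inter> cde) + card (S \<inter> fgh)"
    using Chi1_groups[OF assms] by (subst card_Int_sum2, blast, subst card_Int_sum2, auto)
  finally show ?thesis by simp
qed

lemma Phi1_sum:
  assumes "valid_symbol (Phi1 ab cd ef gh)"
  shows "card (S \<inter> ab) + card (S \<inter> cd) + card (S \<inter> ef) + card (S \<inter> gh) = card S"
proof -
  have "card S = card (S \<inter> (ab \<union> cd \<union> ef \<union> gh))" using assms by simp
  also have "\<dots> = card (S \<inter> ab) + card (S \<inter> cd) + card (S \<inter> ef) + card (S \<inter> gh)"
    using Phi1_groups[OF assms]
    by (subst card_Int_sum2, blast, subst card_Int_sum2, blast, subst card_Int_sum2, auto)
  finally show ?thesis by simp
qed

lemma Phi2_sum: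
  assumes "valid_symbol (Phi2 abc fgh)"
  shows "card (S \<inter> abc) + card (S \<inter> fgh) + card (S \<inter> - (abc \<union> fgh)) = card S"
proof -
  have "card (S \<inter> (abc \<union> fgh)) = card (S \<inter> abc) + card (S \<inter> fgh)"
    using assms by (subst card_Int_sum2) auto
  moreover have "card (S \<inter> (abc \<union> fgh)) \<le> card S" by (rule card_mono) auto
  ultimately show ?thesis by (simp only: card_Int_Compl)
qed

lemma card_Int_le: "card (S \<inter> T) \<le> card (T :: label set)"
  by (rule card_mono) auto

definition split_sum :: "(coord \<Rightarrow> rat) \<Rightarrow> label set \<Rightarrow> rat" where
  "split_sum v S = v (Pl S) + v (Pl (- S))"

lemma le_1_cases: "(n::nat) \<le> 1 \<Longrightarrow> n = 0 \<or> n = 1" by arith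
lemma le_2_cases: "(n::nat) \<le> 2 \<Longrightarrow> n = 0 \<or> n = 1 \<or> n = 2" by arith
lemma le_3_cases: "(n::nat) \<le> 3 \<Longrightarrow> n = 0 \<or> n = 1 \<or> n = 2 \<or> n = 3" by arith
lemma le_4_cases: "(n::nat) \<le> 4 \<Longrightarrow> n = 0 \<or> n = 1 \<or> n = 2 \<or> n = 3 \<or> n = 4" by arith


text \<open>
  The constants by which block vectors of the same picture differ are the traces of the
  \<open>PGL\<close>-ambiguity on complementary pairs.
\<close>

lemma split_sum_two_groups:
  assumes "card S = 4"
  shows "card ab = 2 \<Longrightarrow> t \<in> letters (Alpha1 ab) \<Longrightarrow>
      split_sum (block_vector (Alpha1 ab, t)) S = of_nat (symbol_level (Alpha1 ab) S)"
    and "card abcd = 4 \<Longrightarrow> t \<in> letters (Alpha2 abcd) \<Longrightarrow>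
      split_sum (block_vector (Alpha2 abcd, t)) S
        = of_nat (symbol_level (Alpha2 abcd) S) + (if t = LetterA then 0 else 2)"
    and "card abc = 3 \<Longrightarrow> t \<in> letters (Chi2 abc) \<Longrightarrow>
      split_sum (block_vector (Chi2 abc, t)) S
        = of_nat (symbol_level (Chi2 abc) S) + (if t = LetterC then 0 else 1)"
    and "card abcd = 4 \<Longrightarrow> t \<in> letters (Phi3 abcd) \<Longrightarrow>
      split_sum (block_vector (Phi3 abcd, t)) S
        = of_nat (symbol_level (Phi3 abcd) S) + (if t = LetterA then 0 else 2)"
    and "card abcd = 4 \<Longrightarrow> t \<in> letters (Line abcd) \<Longrightarrow>
      split_sum (block_vector (Line abcd, t)) S = of_nat (symbol_level (Line abcd) S)"
proof -
  show "split_sum (block_vector (Alpha1 ab, t)) S = of_nat (symbol_level (Alpha1 ab) S)"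
    if c: "card ab = 2" and t: "t \<in> letters (Alpha1 ab)"
  proof -
    define n where "n = card (S \<inter> ab)"
    have "n \<le> 2" using card_Int_le[of S ab] c by (simp add: n_def)
    from le_2_cases[OF this] show ?thesis
      using t by (elim disjE; auto simp: split_sum_def symbol_level_def tally_two card_Compl_Int
          card_Int_Compl card_Compl_label assms c simp flip: n_def)
  qed
  show "split_sum (block_vector (Chi2 abc, t)) S
        = of_nat (symbol_level (Chi2 abc) S) + (if t = LetterC then 0 else 1)"
    if c: "card abc = 3" and t: "t \<in> letters (Chi2 abc)"
  proof -
    define n where "n = card (S \<inter> abc)"
    have "n \<le> 3" using card_Int_le[of S abc] c by (simp add: n_def)
    from le_3_cases[OF this] show ?thesis
      using t by (elim disjE; auto simp: split_sum_def symbol_level_def tally_two card_Compl_Int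
          card_Int_Compl card_Compl_label assms c simp flip: n_def)
  qed
  define n where "n = card (S \<inter> abcd)"
  have n: "n = 0 \<or> n = 1 \<or> n = 2 \<or> n = 3 \<or> n = 4" if "card abcd = 4"
    using card_Int_le[of S abcd] that by (intro le_4_cases) (simp add: n_def)
  show "split_sum (block_vector (Alpha2 abcd, t)) S
        = of_nat (symbol_level (Alpha2 abcd) S) + (if t = LetterA then 0 else 2)"
    if c: "card abcd = 4" and t: "t \<in> letters (Alpha2 abcd)"
    using n[OF c] t by (elim disjE; auto simp: split_sum_def symbol_level_def tally_two card_Compl_Int
          card_Int_Compl card_Compl_label assms c simp flip: n_def)
  show "split_sum (block_vector (Phi3 abcd, t)) S
        = of_nat (symbol_level (Phi3 abcd) S) + (if t = LetterA then 0 else 2)"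
    if c: "card abcd = 4" and t: "t \<in> letters (Phi3 abcd)"
    using n[OF c] t by (elim disjE; auto simp: split_sum_def symbol_level_def tally_two card_Compl_Int
          card_Int_Compl card_Compl_label assms c simp flip: n_def)
  show "split_sum (block_vector (Line abcd, t)) S = of_nat (symbol_level (Line abcd) S)"
    if c: "card abcd = 4" and t: "t \<in> letters (Line abcd)"
    using n[OF c] t by (elim disjE; auto simp: split_sum_def symbol_level_def tally_two card_Compl_Int
          card_Int_Compl card_Compl_label assms c simp flip: n_def)
qed

lemma split_sum_Chi1:
  assumes S: "card S = 4" and v: "valid_symbol (Chi1 ab cde fgh)"
    and t: "t \<in> letters (Chi1 ab cde fgh)"
  shows "split_sum (block_vector (Chi1 ab cde fgh, t)) S
    = of_nat (symbol_level (Chi1 ab cde fgh) S) + (if t = LetterC then 1 else 0)"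
proof -
  define a where "a = card (S \<inter> ab)"
  define b where "b = card (S \<inter> cde)"
  define c where "c = card (S \<inter> fgh)"
  have bounds: "a \<le> 2" "b \<le> 3" "c \<le> 3" "a + b + c = 4"
    using v S Chi1_sum[OF v, of S] card_Int_le[of S ab] card_Int_le[of S cde] card_Int_le[of S fgh]
    by (auto simp: a_def b_def c_def)
  from bounds have abc: "(a, b, c) \<in> {(0,1,3), (0,2,2), (0,3,1), (1,0,3), (1,1,2), (1,2,1), (1,3,0),
      (2,0,2), (2,1,1), (2,2,0)}"
    using le_2_cases[OF bounds(1)] le_3_cases[OF bounds(2)] by (elim disjE) simp_all
  note g = Chi1_groups[OF v]
  have sizes: "card ab = 2" "card cde = 3" "card fgh = 3" "card (cde \<union> fgh) = 6"
    "card (ab \<union> cde) = 5" "card (ab \<union> fgh) = 5"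
    using v g by (auto simp: card_Un_disjoint)
  have counts: "card (S \<inter> (cde \<union> fgh)) = b + c" "card (S \<inter> (ab \<union> cde)) = a + b"
    "card (S \<inter> (ab \<union> fgh)) = a + c" "card (S \<inter> ab) = a" "card (S \<inter> cde) = b" "card (S \<inter> fgh) = c"
    using g by (auto simp: card_Int_sum2 a_def b_def c_def)
  show ?thesis
    using abc t by (elim insertE emptyE; auto simp: split_sum_def symbol_level_def tally_Chi1[OF v]
        card_Compl_Int sizes counts simp del: colouring.simps)
qed

lemma split_sum_Phi1:
  assumes S: "card S = 4" and v: "valid_symbol (Phi1 ab cd ef gh)"
    and t: "t \<in> letters (Phi1 ab cd ef gh)"
  shows "split_sum (block_vector (Phi1 ab cd ef gh, t)) S
    = of_nat (symbol_level (Phi1 ab cd ef gh) S)"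
proof -
  define a where "a = card (S \<inter> ab)"
  define b where "b = card (S \<inter> cd)"
  define c where "c = card (S \<inter> ef)"
  define d where "d = card (S \<inter> gh)"
  have bounds: "a \<le> 2" "b \<le> 2" "c \<le> 2" "d \<le> 2" "a + b + c + d = 4"
    using v S Phi1_sum[OF v, of S] card_Int_le[of S ab] card_Int_le[of S cd] card_Int_le[of S ef]
      card_Int_le[of S gh]
    by (auto simp: a_def b_def c_def d_def)
  from bounds have abcd: "(a, b, c, d) \<in> {(0,0,2,2), (0,1,1,2), (0,1,2,1), (0,2,0,2), (0,2,1,1), (0,2,2,0),
      (1,0,1,2), (1,0,2,1), (1,1,0,2), (1,1,1,1), (1,1,2,0), (1,2,0,1), (1,2,1,0),
      (2,0,0,2), (2,0,1,1), (2,0,2,0), (2,1,0,1), (2,1,1,0), (2,2,0,0)}"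
    using le_2_cases[OF bounds(1)] le_2_cases[OF bounds(2)] le_2_cases[OF bounds(3)] by (elim disjE) simp_all
  note g = Phi1_groups[OF v]
  have g': "(ab \<union> cd) \<inter> ef = {}" "(ab \<union> cd) \<inter> gh = {}" using g by auto
  have sizes: "card ab = 2" "card cd = 2" "card ef = 2" "card gh = 2" "card (ab \<union> ef) = 4"
    "card (ab \<union> gh) = 4" "card (ab \<union> cd) = 4" "card (ef \<union> gh) = 4"
    "card (ab \<union> cd \<union> ef) = 6" "card (ab \<union> cd \<union> gh) = 6"
    using v g g' by (auto simp: card_Un_disjoint)
  have counts: "card (S \<inter> (ab \<union> ef)) = a + c" "card (S \<inter> (ab \<union> gh)) = a + d"
    "card (S \<inter> (ab \<union> cd)) = a + b" "card (S \<inter> (ef \<union> gh)) = c + d"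
    "card (S \<inter> (ab \<union> cd \<union> ef)) = a + b + c" "card (S \<inter> (ab \<union> cd \<union> gh)) = a + b + d"
    "card (S \<inter> ab) = a" "card (S \<inter> cd) = b" "card (S \<inter> ef) = c" "card (S \<inter> gh) = d"
    using g g' by (auto simp: card_Int_sum2 a_def b_def c_def d_def)
  show ?thesis
    using abcd t by (elim insertE emptyE; auto simp: split_sum_def symbol_level_def tally_Phi1[OF v]
        card_Compl_Int sizes counts simp del: colouring.simps)
qed

lemma split_sum_Phi2:
  assumes S: "card S = 4" and v: "valid_symbol (Phi2 abc fgh)" and t: "t \<in> letters (Phi2 abc fgh)"
  shows "split_sum (block_vector (Phi2 abc fgh, t)) S
    = of_nat (symbol_level (Phi2 abc fgh) S) + (if t = LetterA then 0 else 1)"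
proof -
  define a where "a = card (S \<inter> abc)"
  define b where "b = card (S \<inter> fgh)"
  have six: "card (abc \<union> fgh) = 6" using v by (simp add: card_Un_disjoint)
  then have "card (- (abc \<union> fgh)) = 2" by (subst card_Compl_label) simp
  then obtain d e where de: "- (abc \<union> fgh) = {d, e}" "d \<noteq> e" by (auto simp: card_2_iff)
  define \<delta> where "\<delta> = (if d \<in> S then 1 else 0 :: nat)"
  define \<epsilon> where "\<epsilon> = (if e \<in> S then 1 else 0 :: nat)"
  have de': "d \<notin> abc" "e \<notin> abc" using de by auto
  have cde: "card (S \<inter> {d, e}) = \<delta> + \<epsilon>"
    using de(2) by (auto simp: Int_insert_right \<delta>_def \<epsilon>_def)
  have "a + b + card (S \<inter> {d, e}) = 4"
    using Phi2_sum[OF v, of S, unfolded de(1)] S by (simp add: a_def b_def)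
  then have bounds: "a \<le> 3" "b \<le> 3" "\<delta> \<le> 1" "\<epsilon> \<le> 1" "a + b + (\<delta> + \<epsilon>) = 4"
    using v card_Int_le[of S abc] card_Int_le[of S fgh]
    by (simp_all add: cde, auto simp: a_def b_def \<delta>_def \<epsilon>_def)
  from bounds have ab: "(a, b, \<delta>, \<epsilon>) \<in> {(1,3,0,0), (2,2,0,0), (3,1,0,0), (0,3,0,1), (1,2,0,1), (2,1,0,1), (3,0,0,1),
     (0,3,1,0), (1,2,1,0), (2,1,1,0), (3,0,1,0), (0,2,1,1), (1,1,1,1), (2,0,1,1)}"
    using le_3_cases[OF bounds(1)] le_3_cases[OF bounds(2)] le_1_cases[OF bounds(3)] le_1_cases[OF bounds(4)]
    by (elim disjE) simp_all
  have sizes: "card abc = 3" "card fgh = 3" "card (- fgh) = 5" "card (- abc) = 5"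
    "card {d, e} = 2" "card (insert d abc) = 4" "card (insert e abc) = 4"
    using v de(2) de' by (auto simp: card_Compl_label)
  have counts: "card (S \<inter> abc) = a" "card (S \<inter> fgh) = b" "card (S \<inter> (abc \<union> fgh)) = a + b"
    "card (S \<inter> - fgh) = 4 - b" "card (S \<inter> - abc) = 4 - a" "card (S \<inter> {d, e}) = \<delta> + \<epsilon>"
    "card (S \<inter> insert d abc) = a + \<delta>" "card (S \<inter> insert e abc) = a + \<epsilon>"
    using v S de' cde
    by (auto simp: card_Int_sum2 card_Int_Compl a_def b_def \<delta>_def \<epsilon>_def Int_insert_right)
  have vec: "block_vector (Phi2 abc fgh, LetterA) z
      = max (v_ln abc z + v_ln fgh z) (v_pl (- fgh) z + v_pl (- abc) z)"
    "block_vector (Phi2 abc fgh, LetterB) z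
      = v_pt {d, e} z + (v_ln (insert d abc) z + v_ln (insert e abc) z)"
    "block_vector (Phi2 abc fgh, LetterC) z
      = v_ln (insert d abc) z + v_ln (insert e abc) z + v_pl (abc \<union> fgh) z" for z
    using de(2) by (simp_all only: block_vector.simps de(1)) auto
  show ?thesis
    using ab t
    by (elim insertE emptyE; auto simp: split_sum_def symbol_level_def
        tally_Phi2[OF v, unfolded de(1)] card_Compl_Int sizes counts six vec
        simp del: colouring.simps block_vector.simps Int_insert_right Int_insert_left card_insert_if)
qed

text \<open>
  The vector of a block matters only through its symbol, whichever of the letters a, b, c it has.
\<close>

lemma split_sum_block:
  assumes "(s, t) \<in> building_blocks"
  shows "\<exists>c. \<forall>S. card S = 4 \<longrightarrow> split_sum (block_vector (s, t)) S = of_nat (symbol_level s S) + c"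
proof -
  have v: "valid_symbol s" and t: "t \<in> letters s"
    using assms by (auto simp: building_blocks_def)
  show ?thesis
  proof (cases s)
    case (Alpha1 ab)
    then show ?thesis using split_sum_two_groups(1) v t by (intro exI[of _ 0]) auto
  next
    case (Alpha2 abcd)
    then show ?thesis using split_sum_two_groups(2) v t
      by (intro exI[of _ "if t = LetterA then 0 else 2"] allI impI) (simp only: valid_symbol.simps)
  next
    case (Chi1 ab cde fgh)
    then show ?thesis using split_sum_Chi1 v t by blast
  next
    case (Chi2 abc)
    then show ?thesis using split_sum_two_groups(3) v t
      by (intro exI[of _ "if t = LetterC then 0 else 1"] allI impI) (simp only: valid_symbol.simps)
  next
    case (Phi1 ab cd ef gh)
    then show ?thesis using split_sum_Phi1[OF _ v[unfolded Phi1] t[unfolded Phi1]]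
      by (intro exI[of _ 0]) simp
  next
    case (Phi2 abc fgh)
    then show ?thesis using split_sum_Phi2 v t by blast
  next
    case (Phi3 abcd)
    then show ?thesis using split_sum_two_groups(4) v t
      by (intro exI[of _ "if t = LetterA then 0 else 2"] allI impI) (simp only: valid_symbol.simps)
  next
    case TCu
    then show ?thesis using t
      by (intro exI[of _ 0]) (auto simp: split_sum_def symbol_level_def tally_of_def)
  next
    case (Line abcd)
    then show ?thesis using split_sum_two_groups(5) v t by (intro exI[of _ 0]) auto
  qed
qed

section \<open>Tests\<close>

text \<open>
  Each test is a difference of sums over 4-element sets, with as many sets in \<open>upper\<close> as in \<open>lower\<close>.
  In \<open>T4 i j a b c d\<close> these sets index the monomials \<open>p\<^sub>i\<^sub>j\<^sub>a\<^sub>b p\<^sub>i\<^sub>j\<^sub>c\<^sub>d\<close> and \<open>p\<^sub>i\<^sub>j\<^sub>a\<^sub>c p\<^sub>i\<^sub>j\<^sub>b\<^sub>d\<close> of a Pluecker relation.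
  In \<open>T8\<close> the labels are matched in four pairs; \<open>upper\<close> and \<open>lower\<close> take one label of each pair, with an
  even and an odd number of primed ones.  Up to complements these are the two monomials of a
  twisted cubic polynomial in which the label \<open>a\<close> occurs in all factors.
\<close>

datatype 'a test = T4 'a 'a 'a 'a 'a 'a | T8 'a 'a 'a 'a 'a 'a 'a 'a

fun upper :: "'a test \<Rightarrow> 'a list list" where
  "upper (T4 i j a b c d) = [[i, j, a, b], [i, j, c, d]]"
| "upper (T8 a a' b b' c c' d d') = [[a, b, c, d], [a, b, c', d'], [a, b', c, d'], [a, b', c', d]]"

fun lower :: "'a test \<Rightarrow> 'a list list" where
  "lower (T4 i j a b c d) = [[i, j, a, c], [i, j, b, d]]"
| "lower (T8 a a' b b' c c' d d') = [[a', b, c, d], [a, b', c, d], [a, b, c', d], [a, b, c, d']]"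

fun labels_of :: "'a test \<Rightarrow> 'a list" where
  "labels_of (T4 i j a b c d) = [i, j, a, b, c, d]"
| "labels_of (T8 a a' b b' c c' d d') = [a, a', b, b', c, c', d, d']"

fun tick :: "colour \<Rightarrow> tally \<Rightarrow> tally" where
  "tick First (Tally a b c d) = Tally (Suc a) b c d"
| "tick Second (Tally a b c d) = Tally a (Suc b) c d"
| "tick Third (Tally a b c d) = Tally a b (Suc c) d"
| "tick Fourth (Tally a b c d) = Tally a b c (Suc d)"

text \<open>
  Levels of sets given by lists, counted one label at a time for the sake of rewriting.
\<close>

definition list_level :: "kind \<Rightarrow> (label \<Rightarrow> colour) \<Rightarrow> label list \<Rightarrow> nat" where
  "list_level k f xs = level k (fold (\<lambda>x. tick (f x)) xs (Tally 0 0 0 0))"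

datatype sign = Neg | Zero | Pos

fun compare :: "nat \<Rightarrow> nat \<Rightarrow> sign" where
  "compare 0 0 = Zero"
| "compare 0 (Suc n) = Neg"
| "compare (Suc m) 0 = Pos"
| "compare (Suc m) (Suc n) = compare m n"

definition sign :: "kind \<Rightarrow> (label \<Rightarrow> colour) \<Rightarrow> label test \<Rightarrow> sign" where
  "sign k f T = compare (sum_list (map (list_level k f) (upper T))) (sum_list (map (list_level k f) (lower T)))"

abbreviation "lA \<equiv> label.A"
abbreviation "lB \<equiv> label.B"
abbreviation "lC \<equiv> label.C"
abbreviation "lD \<equiv> label.D"
abbreviation "lE \<equiv> label.E"
abbreviation "lF \<equiv> label.F"
abbreviation "lG \<equiv> label.G"
abbreviation "lH \<equiv> label.H"

definition labels :: "label list" where "labels = [lA, lB, lC, lD, lE, lF, lG, lH]"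

text \<open>
  A colouring as a table, so that colourings can be enumerated and compared.
\<close>

datatype palette = Palette colour colour colour colour colour colour colour colour

fun paint :: "palette \<Rightarrow> label \<Rightarrow> colour" where
  "paint (Palette a b c d e f g h) label.A = a"
| "paint (Palette a b c d e f g h) label.B = b"
| "paint (Palette a b c d e f g h) label.C = c"
| "paint (Palette a b c d e f g h) label.D = d"
| "paint (Palette a b c d e f g h) label.E = e"
| "paint (Palette a b c d e f g h) label.F = f"
| "paint (Palette a b c d e f g h) label.G = g"
| "paint (Palette a b c d e f g h) label.H = h"

definition palette_of :: "(label \<Rightarrow> colour) \<Rightarrow> palette" where
  "palette_of f = Palette (f lA) (f lB) (f lC) (f lD) (f lE) (f lF) (f lG) (f lH)"

fun index :: "label \<Rightarrow> nat" where
  "index label.A = 0"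
| "index label.B = Suc 0"
| "index label.C = Suc (Suc 0)"
| "index label.D = Suc (Suc (Suc 0))"
| "index label.E = Suc (Suc (Suc (Suc 0)))"
| "index label.F = Suc (Suc (Suc (Suc (Suc 0))))"
| "index label.G = Suc (Suc (Suc (Suc (Suc (Suc 0)))))"
| "index label.H = Suc (Suc (Suc (Suc (Suc (Suc (Suc 0))))))"

definition above :: "label \<Rightarrow> label list \<Rightarrow> label list" where
  "above x = filter (\<lambda>y. index x < index y)"

text \<open>
  The value of \<open>T4 i j a b c d\<close> does not change, up to sign, when \<open>i\<close> and \<open>j\<close> are swapped, when \<open>a, d\<close> or \<open>b, c\<close> are
  swapped, when the pairs \<open>a, d\<close> and \<open>b, c\<close> change places, and when \<open>i, j\<close> are replaced by the two
  labels which do not occur.  The inequalities pick one test from each class of 32.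
\<close>

definition representative_T4s :: "label test list" where
  "representative_T4s = [T4 i j a b c d. i \<leftarrow> labels, j \<leftarrow> above i labels, r \<leftarrow> [filter (\<lambda>x. x \<noteq> i \<and> x \<noteq> j) labels],
     a \<leftarrow> r, d \<leftarrow> above a r, b \<leftarrow> above a r, b \<noteq> d, c \<leftarrow> above b r, c \<noteq> d,
     list_all (\<lambda>k. index i < index k \<or> k = a \<or> k = b \<or> k = c \<or> k = d) r]"

text \<open>
  Up to sign, the value of a \<open>T8\<close> depends only on the matching, and each of the 105 matchings occurs once.
\<close>

definition representative_T8s :: "label test list" where
  "representative_T8s = [T8 lA a' b b' c c' d d'. a' \<leftarrow> above lA labels, r \<leftarrow> [filter (\<lambda>x. x \<noteq> a') (above lA labels)],
     b \<leftarrow> r, b' \<leftarrow> above b r, r' \<leftarrow> [filter (\<lambda>x. x \<noteq> b') (above b r)],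
     c \<leftarrow> r', c' \<leftarrow> above c r', r'' \<leftarrow> [filter (\<lambda>x. x \<noteq> c') (above c r')],
     d \<leftarrow> r'', d' \<leftarrow> above d r'']"

fun opposite :: "sign \<Rightarrow> sign \<Rightarrow> bool" where
  "opposite Pos Neg = True"
| "opposite Neg Pos = True"
| "opposite _ _ = False"

type_synonym code = "kind \<times> palette"
definition code_of :: "symbol \<Rightarrow> code" where
  "code_of s = (kind_of s, palette_of (colouring s))"
fun code_sign :: "code \<Rightarrow> label test \<Rightarrow> sign" where
  "code_sign (k, p) T = sign k (paint p) T"

text \<open>
  The test is evaluated at \<open>x\<close> once for all \<open>ys\<close>, and not at all at \<open>ys\<close> if it vanishes at \<open>x\<close>.
\<close>

fun agree :: "label test \<Rightarrow> code \<Rightarrow> code list \<Rightarrow> bool" where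
  "agree T x ys = (case code_sign x T of Zero \<Rightarrow> True
     | Pos \<Rightarrow> list_all (\<lambda>y. code_sign y T \<noteq> Neg) ys
     | Neg \<Rightarrow> list_all (\<lambda>y. code_sign y T \<noteq> Pos) ys)"

lemma fold_tick:
  "fold (\<lambda>x. tick (f x)) xs (Tally a b c d) =
     Tally (a + length (filter (\<lambda>x. f x = First) xs)) (b + length (filter (\<lambda>x. f x = Second) xs))
       (c + length (filter (\<lambda>x. f x = Third) xs)) (d + length (filter (\<lambda>x. f x = Fourth) xs))"
proof (induction xs arbitrary: a b c d)
  case (Cons x xs)
  then show ?case by (cases "f x") simp_all
qed simp

lemma list_level_eq:
  assumes "distinct xs"
  shows "list_level (kind_of s) (colouring s) xs = symbol_level s (set xs)"
proof -
  have *: "{x. f x = c} \<inter> set xs = {x \<in> set xs. f x = c}" for f :: "label \<Rightarrow> colour" and c by auto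
  show ?thesis
    by (simp add: list_level_def symbol_level_def tally_of_def fold_tick distinct_length_filter[OF assms] *)
qed

lemma compare_iff:
  "compare m n = Pos \<longleftrightarrow> n < m"
  "compare m n = Neg \<longleftrightarrow> m < n"
  by (induction m n rule: compare.induct) auto

definition test_value :: "(label set \<Rightarrow> rat) \<Rightarrow> label test \<Rightarrow> rat" where
  "test_value g T = (\<Sum>xs\<leftarrow>upper T. g (set xs)) - (\<Sum>xs\<leftarrow>lower T. g (set xs))"

definition proper :: "'a test \<Rightarrow> bool" where
  "proper T \<longleftrightarrow> distinct (labels_of T)"

abbreviation symbol_value :: "symbol \<Rightarrow> label test \<Rightarrow> rat" where
  "symbol_value s \<equiv> test_value (\<lambda>S. of_nat (symbol_level s S))"

lemma proper_lists:
  "proper T \<Longrightarrow> xs \<in> set (upper T) \<union> set (lower T) \<Longrightarrow> distinct xs \<and> length xs = 4"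
  by (cases T) (auto simp: proper_def)

lemma sign_iff:
  assumes "proper T"
  shows "sign (kind_of s) (colouring s) T = Pos \<longleftrightarrow> 0 < symbol_value s T"
    and "sign (kind_of s) (colouring s) T = Neg \<longleftrightarrow> symbol_value s T < 0"
proof -
  have "sum_list (map (list_level (kind_of s) (colouring s)) yss) = (\<Sum>xs\<leftarrow>yss. symbol_level s (set xs))"
    if "\<forall>xs\<in>set yss. distinct xs" for yss
    using that by (induction yss) (auto simp: list_level_eq)
  from this[of "upper T"] this[of "lower T"]
  have "sum_list (map (list_level (kind_of s) (colouring s)) (upper T)) = (\<Sum>xs\<leftarrow>upper T. symbol_level s (set xs))"
    "sum_list (map (list_level (kind_of s) (colouring s)) (lower T)) = (\<Sum>xs\<leftarrow>lower T. symbol_level s (set xs))"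
    using proper_lists[OF assms] by blast+
  moreover have "(\<Sum>xs\<leftarrow>yss. of_nat (symbol_level s (set xs))) = (of_nat (\<Sum>xs\<leftarrow>yss. symbol_level s (set xs)) :: rat)" for yss
    by (induction yss) auto
  ultimately show "sign (kind_of s) (colouring s) T = Pos \<longleftrightarrow> 0 < symbol_value s T"
    "sign (kind_of s) (colouring s) T = Neg \<longleftrightarrow> symbol_value s T < 0"
    by (simp_all add: sign_def compare_iff test_value_def)
qed

lemma length_upper: "length (upper T) = length (lower T)"
  by (cases T) auto

text \<open>
  Constants cancel because \<open>upper\<close> and \<open>lower\<close> have equal length.
\<close>

lemma test_value_cong_const:
  assumes "proper T" and "\<And>S. card S = 4 \<Longrightarrow> g S = h S + c"
  shows "test_value g T = test_value h T"
proof -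
  have "(\<Sum>xs\<leftarrow>yss. g (set xs)) = (\<Sum>xs\<leftarrow>yss. h (set xs)) + of_nat (length yss) * c"
    if "\<And>xs. xs \<in> set yss \<Longrightarrow> distinct xs \<and> length xs = 4" for yss
    using that by (induction yss) (auto simp: assms(2) distinct_card algebra_simps)
  from this[of "upper T"] this[of "lower T"] show ?thesis
    using proper_lists[OF assms(1)] by (simp add: test_value_def length_upper)
qed

lemma test_value_block:
  assumes "b \<in> building_blocks" and "proper T"
  shows "test_value (split_sum (block_vector b)) T = symbol_value (fst b) T"
proof -
  obtain s t where b: "b = (s, t)" by (cases b)
  obtain c where "\<And>S. card S = 4 \<Longrightarrow> split_sum (block_vector (s, t)) S = of_nat (symbol_level s S) + c"
    using split_sum_block assms(1) b by blast
  then show ?thesis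
    using test_value_cong_const[OF assms(2)] b by simp
qed

lemma paint_palette_of [simp]: "paint (palette_of f) = f"
proof
  show "paint (palette_of f) x = f x" for x by (cases x) (auto simp: palette_of_def)
qed

lemma code_sign_code_of: "code_sign (code_of s) T = sign (kind_of s) (colouring s) T"
  by (simp add: code_of_def)

text \<open>
  The level inherits this symmetry from the sum over a set and its complement that it describes.
\<close>

lemma symbol_level_Compl:
  assumes "valid_symbol s" "card S = 4"
  shows "symbol_level s (- S) = symbol_level s S"
proof -
  obtain t where "t \<in> letters s" by (cases s) auto
  then have "(s, t) \<in> building_blocks" using assms by (auto simp: building_blocks_def)
  then obtain c where "\<And>S. card S = 4 \<Longrightarrow> split_sum (block_vector (s, t)) S = of_nat (symbol_level s S) + c"
    using split_sum_block by blast
  from this[of S] this[of "- S"] show ?thesis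
    using assms(2) by (simp add: card_Compl_label split_sum_def)
qed

lemma colouring_relabel: "inj \<pi> \<Longrightarrow> colouring (relabel \<pi> s) (\<pi> x) = colouring s x"
  by (cases s) (auto simp: inj_image_mem_iff)

lemma kind_of_relabel: "kind_of (relabel \<pi> s) = kind_of s"
  by (cases s) auto

lemma symbol_level_relabel:
  assumes "inj \<pi>"
  shows "symbol_level (relabel \<pi> s) (\<pi> ` S) = symbol_level s S"
proof -
  have "{y \<in> \<pi> ` S. colouring (relabel \<pi> s) y = c} = \<pi> ` {x \<in> S. colouring s x = c}" for c
    by (auto simp: colouring_relabel[OF assms])
  then show ?thesis
    by (simp add: symbol_level_def kind_of_relabel tally_of_def card_image inj_on_subset[OF assms])
qed

lemma symbol_value_relabel:
  assumes "inj \<pi>"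
  shows "symbol_value (relabel \<pi> s) (map_test \<pi> T) = symbol_value s T"
proof -
  have "upper (map_test \<pi> T) = map (map \<pi>) (upper T)" "lower (map_test \<pi> T) = map (map \<pi>) (lower T)"
    by (cases T; simp)+
  then show ?thesis
    by (simp add: test_value_def comp_def symbol_level_relabel[OF assms])
qed

lemma proper_map_test: "inj \<pi> \<Longrightarrow> proper (map_test \<pi> T) = proper T"
proof -
  assume "inj \<pi>"
  moreover have "labels_of (map_test \<pi> T) = map \<pi> (labels_of T)" by (cases T) auto
  ultimately show ?thesis by (auto simp: proper_def distinct_map intro: inj_on_subset)
qed

lemma relabel_comp: "relabel \<pi> (relabel \<sigma> s) = relabel (\<pi> \<circ> \<sigma>) s"
  by (cases s) (auto simp: image_comp)

lemma relabel_id: "relabel id s = s"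
  by (cases s) auto

lemma valid_symbol_relabel:
  assumes "bij \<pi>" "valid_symbol s"
  shows "valid_symbol (relabel \<pi> s)"
proof -
  have c: "card (\<pi> ` S) = card S" for S
    using assms(1) by (metis bij_is_inj card_image inj_on_subset subset_UNIV)
  have u: "\<pi> ` S = UNIV" if "S = UNIV" for S using assms(1) that by (simp add: bij_is_surj)
  show ?thesis
    using assms c by (cases s) (auto simp: u image_Un[symmetric] image_Int[symmetric] bij_is_inj)
qed

text \<open>
  These swaps generate the identifications of the pictures of \<open>\<phi>\<^sub>1\<close>.
\<close>

lemma level_Phi1_sym:
  assumes "a \<le> 2" "b \<le> 2" "c \<le> 2" "d \<le> 2" "a + b + c + d = 4"
  shows "level Phi1_kind (Tally b a c d) = level Phi1_kind (Tally a b c d)"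
    and "level Phi1_kind (Tally a b d c) = level Phi1_kind (Tally a b c d)"
    and "level Phi1_kind (Tally c d a b) = level Phi1_kind (Tally a b c d)"
  using le_2_cases[OF assms(1)] le_2_cases[OF assms(2)] le_2_cases[OF assms(3)] assms(4,5) by (elim disjE; simp)+

lemma level_two_sym:
  assumes "n \<le> 4"
  shows "level Alpha2_kind (Tally (4 - n) (4 - (4 - n)) 0 0) = level Alpha2_kind (Tally n (4 - n) 0 0)"
    and "level Phi3_kind (Tally (4 - n) (4 - (4 - n)) 0 0) = level Phi3_kind (Tally n (4 - n) 0 0)"
    and "level Line_kind (Tally (4 - n) (4 - (4 - n)) 0 0) = level Line_kind (Tally n (4 - n) 0 0)"
  using le_4_cases[OF assms] by (elim disjE; simp)+

lemma symbol_level_picture: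
  assumes "valid_symbol s" "valid_symbol s'" "symbol_picture s = symbol_picture s'" "card S = 4"
  shows "symbol_level s S = symbol_level s' S"
proof (cases s)
  case (Phi1 ab cd ef gh)
  then obtain ab' cd' ef' gh' where s': "s' = Phi1 ab' cd' ef' gh'"
    using assms(3) by (cases s') auto
  let ?l = "\<lambda>a b c d. symbol_level (Phi1 a b c d) S"
  have sym: "?l b a c d = ?l a b c d" "?l a b d c = ?l a b c d" "?l c d a b = ?l a b c d"
    if v: "valid_symbol (Phi1 a b c d)" for a b c d
  proof -
    have v': "valid_symbol (Phi1 b a c d)" "valid_symbol (Phi1 a b d c)" "valid_symbol (Phi1 c d a b)"
      using v by auto
    have bounds: "card (S \<inter> a) \<le> 2" "card (S \<inter> b) \<le> 2" "card (S \<inter> c) \<le> 2" "card (S \<inter> d) \<le> 2"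
      "card (S \<inter> a) + card (S \<inter> b) + card (S \<inter> c) + card (S \<inter> d) = 4"
      using card_Int_le[of S a] card_Int_le[of S b] card_Int_le[of S c] card_Int_le[of S d] v
        Phi1_sum[OF v] assms(4) by auto
    show "?l b a c d = ?l a b c d" "?l a b d c = ?l a b c d" "?l c d a b = ?l a b c d"
      using level_Phi1_sym[OF bounds]
      by (simp_all only: symbol_level_def kind_of.simps tally_Phi1[OF v] tally_Phi1[OF v'(1)]
          tally_Phi1[OF v'(2)] tally_Phi1[OF v'(3)])
  qed
  have v: "valid_symbol (Phi1 ab cd ef gh)" using assms(1) Phi1 by simp
  have v': "valid_symbol (Phi1 cd ab ef gh)" "valid_symbol (Phi1 ab cd gh ef)" "valid_symbol (Phi1 cd ab gh ef)"
    "valid_symbol (Phi1 ef gh ab cd)" "valid_symbol (Phi1 gh ef ab cd)" "valid_symbol (Phi1 ef gh cd ab)"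
    using v by auto
  have "{{ab, cd}, {ef, gh}} = {{ab', cd'}, {ef', gh'}}" using assms(3) Phi1 s' by simp
  then have cases: "(ab', cd', ef', gh') \<in> {(ab, cd, ef, gh), (cd, ab, ef, gh), (ab, cd, gh, ef),
      (cd, ab, gh, ef), (ef, gh, ab, cd), (gh, ef, ab, cd), (ef, gh, cd, ab), (gh, ef, cd, ab)}"
    unfolding doubleton_eq_iff by (elim disjE conjE) simp_all
  have e1: "?l cd ab ef gh = ?l ab cd ef gh" and e2: "?l ab cd gh ef = ?l ab cd ef gh"
    and e4: "?l ef gh ab cd = ?l ab cd ef gh"
    by (rule sym[OF v])+
  have e3: "?l cd ab gh ef = ?l ab cd ef gh"
    using sym(2)[OF v'(1)] e1 by (rule trans)
  have e5: "?l gh ef ab cd = ?l ab cd ef gh" and e6: "?l ef gh cd ab = ?l ab cd ef gh"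
    using sym(1,2)[OF v'(4)] e4 by (auto intro: trans)
  have e7: "?l gh ef cd ab = ?l ab cd ef gh"
    using sym(2)[OF v'(5)] e5 by (rule trans)
  from cases have "?l ab' cd' ef' gh' = ?l ab cd ef gh"
    by (elim insertE emptyE) (simp_all only: prod.inject e1 e2 e3 e4 e5 e6 e7)
  then show ?thesis using Phi1 s' by simp
next
  case (Chi1 ab cde fgh)
  then obtain cde' fgh' where s': "s' = Chi1 ab cde' fgh'"
    using assms(3) by (cases s') auto
  have "{cde, fgh} = {cde', fgh'}" using assms(3) Chi1 s' by simp
  moreover have "symbol_level s S = symbol_level (Chi1 ab fgh cde) S"
  proof -
    have v: "valid_symbol (Chi1 ab cde fgh)" "valid_symbol (Chi1 ab fgh cde)"
      using assms(1) Chi1 by auto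
    show ?thesis
      by (simp only: Chi1 symbol_level_def kind_of.simps tally_Chi1[OF v(1)] tally_Chi1[OF v(2)]) auto
  qed
  ultimately show ?thesis using Chi1 s' by (auto simp: doubleton_eq_iff)
next
  case (Phi2 abc fgh)
  then obtain abc' fgh' where s': "s' = Phi2 abc' fgh'"
    using assms(3) by (cases s') auto
  have "{abc, fgh} = {abc', fgh'}" using assms(3) Phi2 s' by simp
  moreover have "symbol_level s S = symbol_level (Phi2 fgh abc) S"
  proof -
    have v: "valid_symbol (Phi2 abc fgh)" "valid_symbol (Phi2 fgh abc)"
      using assms(1) Phi2 by auto
    show ?thesis
      by (simp only: Phi2 symbol_level_def kind_of.simps tally_Phi2[OF v(1)] tally_Phi2[OF v(2)]) auto
  qed
  ultimately show ?thesis using Phi2 s' by (auto simp: doubleton_eq_iff)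
next
  case (Alpha1 ab)
  then show ?thesis using assms(3) by (cases s') auto
next
  case (Chi2 abc)
  then show ?thesis using assms(3) by (cases s') auto
next
  case TCu
  then show ?thesis using assms(3) by (cases s') auto
next
  case (Alpha2 T)
  then obtain T' where s': "s' = Alpha2 T'" using assms(3) by (cases s') auto
  then have "T' = T \<or> T' = - T" using assms(3) Alpha2 by (auto simp: doubleton_eq_iff)
  moreover have "card (S \<inter> T) \<le> 4" using card_mono[of S "S \<inter> T"] assms(4) by simp
  ultimately show ?thesis
    using Alpha2 s' assms(4) level_two_sym[of "card (S \<inter> T)"]
    by (elim disjE) (simp_all only: symbol_level_def kind_of.simps tally_two card_Int_Compl)
next
  case (Phi3 T)
  then obtain T' where s': "s' = Phi3 T'" using assms(3) by (cases s') auto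
  then have "T' = T \<or> T' = - T" using assms(3) Phi3 by (auto simp: doubleton_eq_iff)
  moreover have "card (S \<inter> T) \<le> 4" using card_mono[of S "S \<inter> T"] assms(4) by simp
  ultimately show ?thesis
    using Phi3 s' assms(4) level_two_sym[of "card (S \<inter> T)"]
    by (elim disjE) (simp_all only: symbol_level_def kind_of.simps tally_two card_Int_Compl)
next
  case (Line T)
  then obtain T' where s': "s' = Line T'" using assms(3) by (cases s') auto
  then have "T' = T \<or> T' = - T" using assms(3) Line by (auto simp: doubleton_eq_iff)
  moreover have "card (S \<inter> T) \<le> 4" using card_mono[of S "S \<inter> T"] assms(4) by simp
  ultimately show ?thesis
    using Line s' assms(4) level_two_sym[of "card (S \<inter> T)"]
    by (elim disjE) (simp_all only: symbol_level_def kind_of.simps tally_two card_Int_Compl)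
qed

lemma symbol_value_picture:
  assumes "valid_symbol s" "valid_symbol s'" "symbol_picture s = symbol_picture s'" "proper T"
  shows "symbol_value s T = symbol_value s' T"
  by (rule test_value_cong_const[OF assms(4), where c = 0])
    (simp add: symbol_level_picture[OF assms(1-3)])

section \<open>Reduction to representatives of the tests\<close>

lemma set_labels: "set labels = UNIV"
  using UNIV_label by (simp add: labels_def)

lemma inj_index: "index x = index y \<Longrightarrow> x = y"
  by (cases x; cases y; simp)

lemma set_above: "set (above x ys) = {y \<in> set ys. index x < index y}"
  by (auto simp: above_def)

lemma index_linear: "x \<noteq> y \<Longrightarrow> index x < index y \<or> index y < index x"
  using inj_index by (meson linorder_neqE_nat)

lemma representative_T4s_complete:
  assumes "distinct [i, j, a, b, c, d]" "index i < index j" "index a < index d" "index b < index c"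
    "index a < index b" "\<And>k. k \<notin> {i, j, a, b, c, d} \<Longrightarrow> index i < index k"
  shows "T4 i j a b c d \<in> set representative_T4s"
proof -
  have "\<forall>k\<in>set (filter (\<lambda>x. x \<noteq> i \<and> x \<noteq> j) labels). index i < index k \<or> k = a \<or> k = b \<or> k = c \<or> k = d"
    using assms(6) by auto
  then show ?thesis
    using assms(1-5) by (simp add: representative_T4s_def set_above set_labels list_all_iff)
      (smt (verit, ccfv_threshold) UNIV_I order.strict_trans)
qed

lemma representative_T8s_complete:
  assumes "distinct [a, a', b, b', c, c', d, d']"
    "index a < index a'" "index b < index b'" "index c < index c'" "index d < index d'"
    "index a < index b" "index b < index c" "index c < index d"
  shows "T8 a a' b b' c c' d d' \<in> set representative_T8s"
proof -
  have "card {a, a', b, b', c, c', d, d'} = 8" using assms(1) by simp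
  then have "{a, a', b, b', c, c', d, d'} = UNIV"
    by (intro card_subset_eq) (auto simp: card_UNIV_label)
  then have "label.A \<in> {a, a', b, b', c, c', d, d'}" by blast
  then have a: "a = label.A" using assms(2-8) by auto
  have "distinct [d', d, c', c, b', b, a', a]" using assms(1) by auto
  then show ?thesis
    using assms unfolding a
    apply (simp add: representative_T8s_def set_above set_labels)
    apply (rule exI[of _ a'], simp)
    apply (rule exI[of _ b], simp)
    apply (rule exI[of _ b'], simp)
    apply (rule exI[of _ c], simp)
    apply (rule exI[of _ c'], simp)
    apply (rule exI[of _ d], simp)
    done
qed

lemma test_value_T4:
  "test_value g (T4 j i a b c d) = test_value g (T4 i j a b c d)"
  "test_value g (T4 i j d b c a) = - test_value g (T4 i j a b c d)"
  "test_value g (T4 i j a c b d) = - test_value g (T4 i j a b c d)"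
  "test_value g (T4 i j b a d c) = test_value g (T4 i j a b c d)"
  by (simp_all add: test_value_def insert_commute)

lemma test_value_T4_Compl:
  assumes "\<forall>S. card S = 4 \<longrightarrow> g (- S) = g S"
    and "distinct [i, j, k, l, a, b, c, d]"
  shows "test_value g (T4 k l a b c d) = test_value g (T4 i j a b c d)"
proof -
  have "card {i, j, k, l, a, b, c, d} = 8" using assms(2) by simp
  then have u: "{i, j, k, l, a, b, c, d} = UNIV"
    by (intro card_subset_eq) (auto simp: card_UNIV_label)
  have "{k, l, a, b} = - {i, j, c, d}" "{k, l, c, d} = - {i, j, a, b}"
    "{k, l, a, c} = - {i, j, b, d}" "{k, l, b, d} = - {i, j, a, c}"
    using assms(2) u by auto
  moreover have "card {i, j, c, d} = 4" "card {i, j, a, b} = 4" "card {i, j, b, d} = 4"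
    "card {i, j, a, c} = 4"
    using assms(2) by auto
  ultimately show ?thesis by (simp add: test_value_def assms(1)[rule_format])
qed

lemma test_value_T8:
  assumes g: "\<forall>S. card S = 4 \<longrightarrow> g (- S) = g S"
    and dist: "distinct [a, a', b, b', c, c', d, d']"
  shows "test_value g (T8 a' a b b' c c' d d') = - test_value g (T8 a a' b b' c c' d d')"
    and "test_value g (T8 a a' b' b c c' d d') = - test_value g (T8 a a' b b' c c' d d')"
    and "test_value g (T8 a a' b b' c' c d d') = - test_value g (T8 a a' b b' c c' d d')"
    and "test_value g (T8 a a' b b' c c' d' d) = - test_value g (T8 a a' b b' c c' d d')"
    and "test_value g (T8 b b' a a' c c' d d') = test_value g (T8 a a' b b' c c' d d')"
    and "test_value g (T8 a a' c c' b b' d d') = test_value g (T8 a a' b b' c c' d d')"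
    and "test_value g (T8 a a' b b' d d' c c') = test_value g (T8 a a' b b' c c' d d')"
proof -
  have "card {a, a', b, b', c, c', d, d'} = 8" using dist by simp
  then have u: "{a, a', b, b', c, c', d, d'} = UNIV"
    by (intro card_subset_eq) (auto simp: card_UNIV_label)
  have e: "{a', b, c, d} = - {a, b', c', d'}" "{a', b, c', d'} = - {a, b', c, d}"
    "{a', b', c, d'} = - {a, b, c', d}" "{a', b', c', d} = - {a, b, c, d'}"
    using dist u by auto
  have g': "g {a', b, c, d} = g {a, b', c', d'}" "g {a', b, c', d'} = g {a, b', c, d}"
    "g {a', b', c, d'} = g {a, b, c', d}" "g {a', b', c', d} = g {a, b, c, d'}"
    unfolding e using dist by (auto intro: g[rule_format])
  have e': "{a', b', c, d} = - {a, b, c', d'}" "{a', b, c', d} = - {a, b', c, d'}"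
    "{a', b, c, d'} = - {a, b', c', d}" "{a', b', c', d'} = - {a, b, c, d}"
    using dist u by auto
  have g'': "g {a', b', c, d} = g {a, b, c', d'}" "g {a', b, c', d} = g {a, b', c, d'}"
    "g {a', b, c, d'} = g {a, b', c', d}" "g {a', b', c', d'} = g {a, b, c, d}"
    unfolding e' using dist by (auto intro: g[rule_format])
  have i: "{b, a, x, y} = {a, b, x, y}" "{b', a, x, y} = {a, b', x, y}" "{b, a', x, y} = {a', b, x, y}"
    "{b', a', x, y} = {a', b', x, y}" for x y by auto
  show "test_value g (T8 a' a b b' c c' d d') = - test_value g (T8 a a' b b' c c' d d')"
    "test_value g (T8 a a' b' b c c' d d') = - test_value g (T8 a a' b b' c c' d d')"
    "test_value g (T8 a a' b b' c' c d d') = - test_value g (T8 a a' b b' c c' d d')"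
    "test_value g (T8 a a' b b' c c' d' d) = - test_value g (T8 a a' b b' c c' d d')"
    "test_value g (T8 b b' a a' c c' d d') = test_value g (T8 a a' b b' c c' d d')"
    by (simp_all add: test_value_def g' g'' i)
  show "test_value g (T8 a a' c c' b b' d d') = test_value g (T8 a a' b b' c c' d d')"
    "test_value g (T8 a a' b b' d d' c c') = test_value g (T8 a a' b b' c c' d d')"
    by (simp_all add: test_value_def insert_commute)
qed

text \<open>
  The symmetries of a \<open>T4\<close> change the two factors by the same sign, so it suffices to know the product
  for one ordering of the labels.
\<close>

lemma agreement_T4:
  assumes g: "\<forall>S. card S = 4 \<longrightarrow> g (- S) = g S" and h: "\<forall>S. card S = 4 \<longrightarrow> h (- S) = h S"
    and tests: "\<And>T. T \<in> set representative_T4s \<Longrightarrow> 0 \<le> test_value g T * test_value h T"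
    and dist: "distinct [i, j, a, b, c, d]"
  shows "0 \<le> test_value g (T4 i j a b c d) * test_value h (T4 i j a b c d)"
proof -
  define Q where "Q i j a b c d \<longleftrightarrow>
      0 \<le> test_value g (T4 i j a b c d) * test_value h (T4 i j a b c d)" for i j a b c d
  have swap: "Q j i a b c d \<longleftrightarrow> Q i j a b c d" "Q i j d b c a \<longleftrightarrow> Q i j a b c d"
    "Q i j a c b d \<longleftrightarrow> Q i j a b c d" "Q i j b a d c \<longleftrightarrow> Q i j a b c d" for i j a b c d
    by (simp_all only: Q_def test_value_T4(1)[of _ j i] test_value_T4(2)[of _ i j d] test_value_T4(3)[of _ i j a c]
        test_value_T4(4)[of _ i j b] mult_minus_left mult_minus_right minus_minus)
  have Compl: "Q k l a b c d \<longleftrightarrow> Q i j a b c d" if "distinct [i, j, k, l, a, b, c, d]" for i j k l a b c d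
    by (simp only: Q_def test_value_T4_Compl[OF g that] test_value_T4_Compl[OF h that])
  have 1: "Q i j a b c d"
    if "distinct [i, j, a, b, c, d]" "index i < index j" "index a < index d" "index b < index c"
      "index a < index b" for i j a b c d
  \<comment> \<open>If the smallest label outside \<open>a, b, c, d\<close> is not \<open>i\<close>, then it is one of the two unused labels.\<close>
  proof (cases "\<forall>k. k \<notin> {i, j, a, b, c, d} \<longrightarrow> index i < index k")
    case True
    then show ?thesis using tests representative_T4s_complete[of i j a b c d] that by (simp add: Q_def)
  next
    case False
    have "card (- {i, j, a, b, c, d}) = 2" using that(1) by (simp add: card_Compl_label)
    then obtain k l where kl: "- {i, j, a, b, c, d} = {k, l}" "k \<noteq> l" by (auto simp: card_2_iff)
    obtain k l where kl: "- {i, j, a, b, c, d} = {k, l}" "index k < index l"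
      using kl index_linear[of k l] by (metis insert_commute)
    have "k \<in> - {i, j, a, b, c, d}" "l \<in> - {i, j, a, b, c, d}" using kl(1) by blast+
    then have d: "distinct [i, j, k, l, a, b, c, d]" "distinct [k, l, a, b, c, d]"
      using that(1) kl(2) by auto
    have "index k < index m" if "m \<notin> {k, l, a, b, c, d}" for m
    proof -
      have m: "m = i \<or> m = j" using that kl(1) by blast
      obtain n where "n \<in> {k, l}" "\<not> index i < index n" using False kl(1) by blast
      then have "index k < index i"
        using kl(2) d(1) index_linear[of i n] index_linear[of i k] by auto
      then show ?thesis using m \<open>index i < index j\<close> by auto
    qed
    then have "Q k l a b c d"
      using tests representative_T4s_complete[of k l a b c d] that d(2) kl(2) by (simp add: Q_def)
    then show ?thesis using Compl[OF d(1)] by simp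
  qed
  have 2: "Q i j a b c d"
    if "distinct [i, j, a, b, c, d]" "index a < index d" "index b < index c" "index a < index b"
    for i j a b c d
    using 1[of i j a b c d] 1[of j i a b c d] that index_linear[of i j] swap(1)[of i j a b c d] by auto
  have 3: "Q i j a b c d"
    if "distinct [i, j, a, b, c, d]" "index a < index d" "index b < index c" for i j a b c d
    using 2[of i j a b c d] 2[of i j b a d c] that index_linear[of a b] swap(4)[of i j a b c d] by auto
  have 4: "Q i j a b c d"
    if "distinct [i, j, a, b, c, d]" "index a < index d" for i j a b c d
    using 3[of i j a b c d] 3[of i j a c b d] that index_linear[of b c] swap(3)[of i j a b c d] by auto
  have "Q i j a b c d"
    using 4[of i j a b c d] 4[of i j d b c a] dist index_linear[of a d] swap(2)[of i j a b c d] by auto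
  then show ?thesis by (simp add: Q_def)
qed

text \<open>
  As for \<open>T4\<close>: the matching is brought into increasing order by flipping pairs and by exchanging
  neighbouring ones.
\<close>

lemma agreement_T8:
  assumes g: "\<forall>S. card S = 4 \<longrightarrow> g (- S) = g S" and h: "\<forall>S. card S = 4 \<longrightarrow> h (- S) = h S"
    and tests: "\<And>T. T \<in> set representative_T8s \<Longrightarrow> 0 \<le> test_value g T * test_value h T"
    and dist: "distinct [a, a', b, b', c, c', d, d']"
  shows "0 \<le> test_value g (T8 a a' b b' c c' d d') * test_value h (T8 a a' b b' c c' d d')"
proof -
  define Q where "Q p q r s \<longleftrightarrow>
      0 \<le> test_value g (T8 (fst p) (snd p) (fst q) (snd q) (fst r) (snd r) (fst s) (snd s)) *
        test_value h (T8 (fst p) (snd p) (fst q) (snd q) (fst r) (snd r) (fst s) (snd s))" for p q r s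
  define D where "D p q r s \<longleftrightarrow> distinct [fst p, snd p, fst q, snd q, fst r, snd r, fst s, snd s]"
    for p q r s :: "label \<times> label"
  define le where "le p q \<longleftrightarrow> index (fst p) < index (fst q)" for p q :: "label \<times> label"
  define up where "up p \<longleftrightarrow> index (fst p) < index (snd p)" for p
  have sym: "Q (prod.swap p) q r s \<longleftrightarrow> Q p q r s" "Q p (prod.swap q) r s \<longleftrightarrow> Q p q r s"
    "Q p q (prod.swap r) s \<longleftrightarrow> Q p q r s" "Q p q r (prod.swap s) \<longleftrightarrow> Q p q r s"
    "Q q p r s \<longleftrightarrow> Q p q r s" "Q p r q s \<longleftrightarrow> Q p q r s" "Q p q s r \<longleftrightarrow> Q p q r s"
    if "D p q r s" for p q r s
    using test_value_T8[OF g that[unfolded D_def]] test_value_T8[OF h that[unfolded D_def]]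
    by (simp_all add: Q_def)
  have D: "D (prod.swap p) q r s" "D p (prod.swap q) r s" "D p q (prod.swap r) s" "D p q r (prod.swap s)"
    "D q p r s" "D p r q s" "D p q s r" if "D p q r s" for p q r s
    using that by (auto simp: D_def)
  have lin: "D p q r s \<Longrightarrow> (le p q \<or> le q p) \<and> (le p r \<or> le r p) \<and> (le p s \<or> le s p) \<and>
      (le q r \<or> le r q) \<and> (le q s \<or> le s q) \<and> (le r s \<or> le s r)" for p q r s
    using index_linear by (auto simp: D_def le_def)
  have updown: "up p \<or> up (prod.swap p)" "up q \<or> up (prod.swap q)" "up r \<or> up (prod.swap r)"
    "up s \<or> up (prod.swap s)" if "D p q r s" for p q r s
    using index_linear that by (auto simp: D_def up_def)
  have 0: "Q p q r s" if "D p q r s" "up p" "up q" "up r" "up s" "le p q" "le q r" "le r s" for p q r s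
    using tests representative_T8s_complete[of "fst p" "snd p" "fst q" "snd q" "fst r" "snd r" "fst s" "snd s"] that
    by (simp add: Q_def D_def up_def le_def)
  \<comment> \<open>Insertion sort, with the part known to be in order shrinking from step to step.\<close>
  have 1: "Q p q r s" if "D p q r s" "up p" "up q" "up r" "up s" "le p q" "le q r" for p q r s
    using 0[of p q r s] 0[of p q s r] 0[of p s q r] 0[of s p q r] that lin[OF that(1)] sym D by metis
  have 2: "Q p q r s" if "D p q r s" "up p" "up q" "up r" "up s" "le p q" for p q r s
    using 1[of p q r s] 1[of p r q s] 1[of r p q s] that lin[OF that(1)] sym D by metis
  have 3: "Q p q r s" if "D p q r s" "up p" "up q" "up r" "up s" for p q r s
    using 2[of p q r s] 2[of q p r s] that lin[OF that(1)] sym D by metis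
  have 4: "Q p q r s" if "D p q r s" "up q" "up r" "up s" for p q r s
    using 3[of p q r s] 3[of "prod.swap p" q r s] that updown(1)[OF that(1)] sym D by metis
  have 5: "Q p q r s" if "D p q r s" "up r" "up s" for p q r s
    using 4[of p q r s] 4[of p "prod.swap q" r s] that updown(2)[OF that(1)] sym D by metis
  have 6: "Q p q r s" if "D p q r s" "up s" for p q r s
    using 5[of p q r s] 5[of p q "prod.swap r" s] that updown(3)[OF that(1)] sym D by metis
  have 7: "Q p q r s" if "D p q r s" for p q r s
    using 6[of p q r s] 6[of p q r "prod.swap s"] that updown(4)[OF that(1)] sym D by metis
  show ?thesis
    using 7[of "(a, a')" "(b, b')" "(c, c')" "(d, d')"] dist by (simp add: Q_def D_def)
qed

section \<open>Compatible pictures do not have opposite signs\<close>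

text \<open>
  This follows from compatibility, but also holds between a \<open>\<phi>\<close>-symbol and its auxiliary symbols.
\<close>

definition conform :: "symbol \<Rightarrow> symbol \<Rightarrow> bool" where
  "conform s t \<longleftrightarrow> (\<forall>T. proper T \<longrightarrow> 0 \<le> symbol_value s T * symbol_value t T)"

lemma proper_representatives: "T \<in> set representative_T4s \<union> set representative_T8s \<Longrightarrow> proper T"
proof -
  assume "T \<in> set representative_T4s \<union> set representative_T8s"
  then show ?thesis
    by (auto simp: proper_def representative_T4s_def representative_T8s_def set_above)
qed

lemma conformI:
  assumes "valid_symbol s" "valid_symbol t" and t: "t \<in> set ts"
    and "\<forall>T\<in>set representative_T4s \<union> set representative_T8s. agree T (code_of s) (map code_of ts)"
  shows "conform s t"
proof -
  have *: "0 \<le> symbol_value s T * symbol_value t T" if "T \<in> set representative_T4s \<union> set representative_T8s" for T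
  proof -
    have p: "proper T" by (rule proper_representatives[OF that])
    have a: "agree T (code_of s) (map code_of ts)" using assms(4) that by blast
    show ?thesis
    proof (cases "code_sign (code_of s) T")
      case Pos
      then have "0 < symbol_value s T" using sign_iff[OF p, of s] by (simp add: code_sign_code_of)
      moreover have "\<not> symbol_value t T < 0"
        using a t Pos sign_iff[OF p, of t] by (auto simp: list_all_iff code_sign_code_of)
      ultimately show ?thesis by simp
    next
      case Neg
      then have "symbol_value s T < 0" using sign_iff[OF p, of s] by (simp add: code_sign_code_of)
      moreover have "\<not> 0 < symbol_value t T"
        using a t Neg sign_iff[OF p, of t] by (auto simp: list_all_iff code_sign_code_of)
      ultimately show ?thesis by (simp add: mult_nonpos_nonpos)
    next
      case Zero
      then have "\<not> 0 < symbol_value s T" "\<not> symbol_value s T < 0"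
        using sign_iff[OF p, of s] by (simp_all add: code_sign_code_of)
      then show ?thesis by simp
    qed
  qed
  have g: "\<forall>S. card S = 4 \<longrightarrow> rat_of_nat (symbol_level s (- S)) = rat_of_nat (symbol_level s S)"
    "\<forall>S. card S = 4 \<longrightarrow> rat_of_nat (symbol_level t (- S)) = rat_of_nat (symbol_level t S)"
    using symbol_level_Compl assms(1,2) by simp_all
  show ?thesis
    unfolding conform_def
  proof (intro allI impI)
    fix T :: "label test" assume p: "proper T"
    show "0 \<le> symbol_value s T * symbol_value t T"
    proof (cases T)
      case (T4 i j a b c d)
      then show ?thesis
        using agreement_T4[OF g] * p
        by (simp add: proper_def)
    next
      case (T8 a a' b b' c c' d d')
      then show ?thesis
        using agreement_T8[OF g] * p by (simp add: proper_def)
    qed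
  qed
qed

lemma symbol_eqI:
  assumes "valid_symbol s" "valid_symbol s'" "kind_of s = kind_of s'" "colouring s = colouring s'"
  shows "s = s'"
proof -
  note col = fun_cong[OF assms(4)]
  show ?thesis
  proof (cases s)
    case (Alpha1 T)
    then obtain T' where s': "s' = Alpha1 T'" using assms(3) by (cases s') auto
    have "x \<in> T \<longleftrightarrow> x \<in> T'" for x
      using col[of x] unfolding Alpha1 s' by (auto split: if_splits)
    then show ?thesis unfolding Alpha1 s' by blast
  next
    case (Alpha2 T)
    then obtain T' where s': "s' = Alpha2 T'" using assms(3) by (cases s') auto
    have "x \<in> T \<longleftrightarrow> x \<in> T'" for x
      using col[of x] unfolding Alpha2 s' by (auto split: if_splits)
    then show ?thesis unfolding Alpha2 s' by blast
  next
    case (Chi1 ab cde fgh)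
    then obtain ab' cde' fgh' where s': "s' = Chi1 ab' cde' fgh'" using assms(3) by (cases s') auto
    note g = Chi1_groups[OF assms(1)[unfolded Chi1]] Chi1_groups[OF assms(2)[unfolded s']]
    have u: "x \<in> ab \<or> x \<in> cde \<or> x \<in> fgh" "x \<in> ab' \<or> x \<in> cde' \<or> x \<in> fgh'" for x
      using assms(1,2) Chi1 s' by auto
    have "(x \<in> ab \<longleftrightarrow> x \<in> ab') \<and> (x \<in> cde \<longleftrightarrow> x \<in> cde') \<and> (x \<in> fgh \<longleftrightarrow> x \<in> fgh')" for x
      using col[of x] g u[of x] unfolding Chi1 s' by (auto split: if_splits)
    then show ?thesis unfolding Chi1 s' by blast
  next
    case (Chi2 T)
    then obtain T' where s': "s' = Chi2 T'" using assms(3) by (cases s') auto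
    have "x \<in> T \<longleftrightarrow> x \<in> T'" for x
      using col[of x] unfolding Chi2 s' by (auto split: if_splits)
    then show ?thesis unfolding Chi2 s' by blast
  next
    case (Phi1 ab cd ef gh)
    then obtain ab' cd' ef' gh' where s': "s' = Phi1 ab' cd' ef' gh'" using assms(3) by (cases s') auto
    note g = Phi1_groups[OF assms(1)[unfolded Phi1]] Phi1_groups[OF assms(2)[unfolded s']]
    have u: "x \<in> ab \<or> x \<in> cd \<or> x \<in> ef \<or> x \<in> gh" "x \<in> ab' \<or> x \<in> cd' \<or> x \<in> ef' \<or> x \<in> gh'" for x
      using assms(1,2) Phi1 s' by auto
    have "(x \<in> ab \<longleftrightarrow> x \<in> ab') \<and> (x \<in> cd \<longleftrightarrow> x \<in> cd') \<and> (x \<in> ef \<longleftrightarrow> x \<in> ef') \<and>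
        (x \<in> gh \<longleftrightarrow> x \<in> gh')" for x
      using col[of x] g u[of x] unfolding Phi1 s' by (auto split: if_splits)
    then show ?thesis unfolding Phi1 s' by blast
  next
    case (Phi2 abc fgh)
    then obtain abc' fgh' where s': "s' = Phi2 abc' fgh'" using assms(3) by (cases s') auto
    have "abc \<inter> fgh = {}" "abc' \<inter> fgh' = {}" using assms(1,2) Phi2 s' by auto
    then have "(x \<in> abc \<longleftrightarrow> x \<in> abc') \<and> (x \<in> fgh \<longleftrightarrow> x \<in> fgh')" for x
      using col[of x] unfolding Phi2 s' by (auto split: if_splits)
    then show ?thesis unfolding Phi2 s' by blast
  next
    case (Phi3 T)
    then obtain T' where s': "s' = Phi3 T'" using assms(3) by (cases s') auto
    have "x \<in> T \<longleftrightarrow> x \<in> T'" for x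
      using col[of x] unfolding Phi3 s' by (auto split: if_splits)
    then show ?thesis unfolding Phi3 s' by blast
  next
    case TCu
    then show ?thesis using assms col by (cases s') (auto split: if_splits)
  next
    case (Line T)
    then obtain T' where s': "s' = Line T'" using assms(3) by (cases s') auto
    have "x \<in> T \<longleftrightarrow> x \<in> T'" for x
      using col[of x] unfolding Line s' by (auto split: if_splits)
    then show ?thesis unfolding Line s' by blast
  qed
qed

lemma tally_UNIV:
  assumes "valid_symbol s"
  shows "tally_of (colouring s) UNIV = (case kind_of s of Alpha1_kind \<Rightarrow> Tally 2 6 0 0 | Alpha2_kind \<Rightarrow> Tally 4 4 0 0
    | Chi1_kind \<Rightarrow> Tally 2 3 3 0 | Chi2_kind \<Rightarrow> Tally 3 5 0 0 | Phi1_kind \<Rightarrow> Tally 2 2 2 2 | Phi2_kind \<Rightarrow> Tally 3 3 2 0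
    | Phi3_kind \<Rightarrow> Tally 4 4 0 0 | TCu_kind \<Rightarrow> Tally 8 0 0 0 | Line_kind \<Rightarrow> Tally 4 4 0 0)"
proof (cases s)
  case (Chi1 ab cde fgh)
  then show ?thesis using assms tally_Chi1[of ab cde fgh UNIV] by simp
next
  case (Phi1 ab cd ef gh)
  then show ?thesis using assms tally_Phi1[of ab cd ef gh UNIV] by simp
next
  case (Phi2 abc fgh)
  then have "card (abc \<union> fgh) = 6" using assms by (simp add: card_Un_disjoint)
  then have "card (- (abc \<union> fgh)) = 2" by (subst card_Compl_label) simp
  then show ?thesis using assms tally_Phi2[of abc fgh UNIV] Phi2 by simp
next
  case TCu
  then show ?thesis by (simp add: tally_of_def card_UNIV_label)
qed (use assms in \<open>simp_all add: tally_two card_UNIV_label del: colouring.simps\<close>)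

text \<open>
  Bijections between the classes of each colour fit together.
\<close>

lemma exists_recolouring:
  fixes f g :: "label \<Rightarrow> colour"
  assumes "tally_of f UNIV = tally_of g UNIV"
  obtains \<pi> where "bij \<pi>" "\<And>x. g (\<pi> x) = f x"
proof -
  have "card {x. f x = c} = card {x. g x = c}" for c
    using assms by (cases c) (simp_all add: tally_of_def)
  then have "\<exists>h. bij_betw h {x. f x = c} {x. g x = c}" for c
    by (intro finite_same_card_bij) simp_all
  then obtain h where h: "\<And>c. bij_betw (h c) {x. f x = c} {x. g x = c}" by metis
  define \<pi> where "\<pi> x = h (f x) x" for x
  have g: "g (\<pi> x) = f x" for x
    using bij_betwE[OF h[of "f x"]] by (simp add: \<pi>_def)
  have "inj \<pi>"
  proof (rule injI)
    fix x y assume "\<pi> x = \<pi> y"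
    moreover from this have "f x = f y" using g by metis
    ultimately show "x = y"
      using bij_betw_imp_inj_on[OF h[of "f x"]] by (auto simp: \<pi>_def inj_on_def)
  qed
  then have "bij \<pi>" by (simp add: bij_def finite_UNIV_inj_surj)
  then show thesis using g that by blast
qed

text \<open>
  By this lemma a property which is invariant under relabelling needs to be checked for one symbol of each kind.
\<close>

lemma relabel_transitive:
  assumes "valid_symbol s" "valid_symbol s'" "kind_of s = kind_of s'"
  obtains \<pi> where "bij \<pi>" "s' = relabel \<pi> s"
proof -
  have "tally_of (colouring s) UNIV = tally_of (colouring s') UNIV"
    using assms by (simp add: tally_UNIV)
  then obtain \<pi> where \<pi>: "bij \<pi>" "\<And>x. colouring s' (\<pi> x) = colouring s x"
    using exists_recolouring by metis
  have "colouring s' = colouring (relabel \<pi> s)"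
  proof
    fix y
    obtain x where "y = \<pi> x" using \<pi>(1) by (metis bij_is_surj surjD)
    then show "colouring s' y = colouring (relabel \<pi> s) y"
      using \<pi> by (simp add: colouring_relabel bij_is_inj)
  qed
  then have "s' = relabel \<pi> s"
    using assms \<pi>(1) by (intro symbol_eqI) (simp_all add: valid_symbol_relabel kind_of_relabel)
  with \<pi>(1) show thesis by (rule that)
qed

lemma conform_sym: "conform s t \<Longrightarrow> conform t s"
  by (simp add: conform_def mult.commute)

lemma map_test_inv: "bij \<pi> \<Longrightarrow> map_test \<pi> (map_test (inv_into UNIV \<pi>) T) = T"
  by (cases T) (auto simp: bij_is_surj surj_f_inv_f)

lemma conform_relabel:
  assumes "bij \<pi>" "conform s t"
  shows "conform (relabel \<pi> s) (relabel \<pi> t)"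
  unfolding conform_def
proof (intro allI impI)
  fix T :: "label test" assume "proper T"
  define T' where "T' = map_test (inv_into UNIV \<pi>) T"
  have T: "T = map_test \<pi> T'" using map_test_inv[OF assms(1)] by (simp add: T'_def)
  then have "proper T'" using \<open>proper T\<close> proper_map_test[OF bij_is_inj[OF assms(1)]] by simp
  then show "0 \<le> symbol_value (relabel \<pi> s) T * symbol_value (relabel \<pi> t) T"
    using assms(2) unfolding T symbol_value_relabel[OF bij_is_inj[OF assms(1)]] conform_def by simp
qed

lemma conform_picture:
  assumes "valid_symbol s" "valid_symbol s'" "symbol_picture s = symbol_picture s'" "conform s' t"
  shows "conform s t"
  using assms(4) symbol_value_picture[OF assms(1-3)] by (simp add: conform_def)

lemma conform_refl: "conform s s"
  by (simp add: conform_def)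

lemma conform_TCu: "conform TCu s"
  by (simp add: conform_def test_value_def symbol_level_def tally_of_def)

text \<open>
  This list and the next three contain the pairs of the compatibility table, those which arise when a
  \<open>\<phi>\<close>-symbol in it is replaced by one of its auxiliary symbols, and the pairs of a \<open>\<phi>\<close>-symbol
  and an auxiliary symbol of its own.  Of two complementary sets in a \<open>Line\<close> only one is listed, and
  the twisted cubic block, on which all tests vanish, is left out.
\<close>

definition table_checks :: "(symbol \<times> symbol list) list" where
  "table_checks =
    [(Alpha1 {lA, lB}, [Alpha1 {lC, lD}, Alpha2 {lA, lB, lC, lD}]),
     (Alpha2 {lA, lB, lC, lD}, [Alpha2 {lA, lB, lE, lF}]),
     (Chi1 {lA, lB} {lC, lD, lE} {lF, lG, lH}, [Alpha1 {lA, lB}, Alpha1 {lC, lD},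
        Alpha2 {lB, lC, lD, lE}, Alpha2 {lA, lB, lC, lH}, Line {lA, lB, lC, lD}]),
     (Chi2 {lA, lB, lC}, [Alpha1 {lA, lB}, Alpha1 {lD, lE}, Alpha2 {lA, lB, lC, lD},
        Line {lA, lB, lC, lD}]),
     (Chi1 {lA, lH} {lB, lC, lD} {lE, lF, lG}, [Chi1 {lB, lC} {lD, lE, lF} {lA, lG, lH},
        Chi2 {lB, lC, lD}, Phi2 {lA, lG, lH} {lB, lC, lD}, Alpha1 {lE, lF},
        Line {lE, lA, lG, lH}, Line {lF, lA, lG, lH}]),
     (Chi2 {lC, lD, lE}, [Chi2 {lF, lG, lH}]),
     (Line {lA, lB, lC, lD}, [Alpha1 {lA, lB}, Alpha2 {lB, lC, lD, lE}])]"

definition Phi1_checks :: "(symbol \<times> symbol list) list" where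
  "Phi1_checks =
    (let ts = [Alpha1 {lA, lB}, Alpha2 {lA, lB, lE, lG}, Chi1 {lA, lB} {lC, lE, lF} {lD, lG, lH}];
         as = [Alpha2 {lA, lB, lC, lD}, Line {lA, lB, lE, lF}, Line {lA, lB, lG, lH}]
     in (Phi1 {lA, lB} {lC, lD} {lE, lF} {lG, lH}, ts @ as) # map (\<lambda>a. (a, ts)) as)"

definition Phi2_checks :: "(symbol \<times> symbol list) list" where
  "Phi2_checks =
    (let ts = [Alpha1 {lC, lD}, Alpha2 {lE, lF, lG, lH}, Chi2 {lF, lG, lH}];
         as = [Alpha1 {lA, lB}, Line {lA, lC, lD, lE}, Line {lB, lC, lD, lE}]
     in (Phi2 {lC, lD, lE} {lF, lG, lH}, ts @ as) # map (\<lambda>a. (a, ts)) as)"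

definition Phi3_checks :: "(symbol \<times> symbol list) list" where
  "Phi3_checks =
    [(Phi3 {lA, lB, lC, lD}, [Alpha1 {lA, lB}, Alpha2 {lA, lB, lC, lD}, Line {lA, lB, lC, lD}]),
     (Phi3 {lB, lC, lD, lE}, [Chi2 {lB, lC, lD}]),
     (Chi2 {lB, lC, lD}, [Alpha2 {lB, lC, lD, lE}, Line {lB, lC, lD, lE}])]"

definition all_agree :: "(symbol \<times> symbol list) list \<Rightarrow> bool" where
  "all_agree gs = (let cs = map (\<lambda>(s, ts). (code_of s, map code_of ts)) gs
     in list_all (\<lambda>T. list_all (\<lambda>(x, ys). agree T x ys) cs) (representative_T4s @ representative_T8s))"

lemma table_checks_agree: "all_agree table_checks"
  by code_simp
lemma Phi1_checks_agree: "all_agree Phi1_checks"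
  by code_simp
lemma Phi2_checks_agree: "all_agree Phi2_checks"
  by code_simp
lemma Phi3_checks_agree: "all_agree Phi3_checks"
  by code_simp

lemma all_agreeD:
  assumes "all_agree gs" "(s, ts) \<in> set gs" "t \<in> set ts" "valid_symbol s" "valid_symbol t"
  shows "conform s t"
proof -
  have "\<forall>T\<in>set representative_T4s \<union> set representative_T8s. agree T (code_of s) (map code_of ts)"
    using assms(1,2) by (fastforce simp: all_agree_def list_all_iff)
  then show ?thesis by (rule conformI[OF assms(4,5,3)])
qed


lemma conform_Line_Compl:
  assumes "card T = 4" "conform (Line T) t"
  shows "conform (Line (- T)) t"
  using assms by (intro conform_picture[OF _ _ _ assms(2)]) (auto simp: card_Compl_label)

text \<open>
  The complements on the right are not evaluated, so that the pairs with equal pictures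
  remain visible.
\<close>

lemma auxiliary_symbols_explicit:
  "auxiliary_symbols (Phi1 {lA, lB} {lC, lD} {lE, lF} {lG, lH}) =
     {Alpha2 {lA, lB, lC, lD}, Line {lA, lB, lE, lF}, Line {lA, lB, lG, lH},
      Line (- {lA, lB, lG, lH}), Line (- {lA, lB, lE, lF})}"
  "auxiliary_symbols (Phi2 {lC, lD, lE} {lF, lG, lH}) =
     {Alpha1 {lA, lB}, Line {lA, lC, lD, lE}, Line {lB, lC, lD, lE},
      Line (- {lB, lC, lD, lE}), Line (- {lA, lC, lD, lE})}"
  "auxiliary_symbols (Phi2 {lA, lG, lH} {lB, lC, lD}) =
     {Alpha1 {lE, lF}, Line {lE, lA, lG, lH}, Line {lF, lA, lG, lH},
      Line (- {lF, lA, lG, lH}), Line (- {lE, lA, lG, lH})}"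
proof -
  have c: "- {lA, lB, lG, lH} = {lC, lD, lE, lF}" "- {lA, lB, lE, lF} = {lC, lD, lG, lH}"
    "- {lB, lC, lD, lE} = {lA, lF, lG, lH}" "- {lA, lC, lD, lE} = {lB, lF, lG, lH}"
    "- {lF, lA, lG, lH} = {lE, lB, lC, lD}" "- {lE, lA, lG, lH} = {lF, lB, lC, lD}"
    "- ({lC, lD, lE} \<union> {lF, lG, lH}) = {lA, lB}" "- ({lA, lG, lH} \<union> {lB, lC, lD}) = {lE, lF}"
    using UNIV_label by auto
  have u: "{lA, lB} \<union> {lC, lD} = {lA, lB, lC, lD}" "{lA, lB} \<union> {lE, lF} = {lA, lB, lE, lF}"
    "{lA, lB} \<union> {lG, lH} = {lA, lB, lG, lH}" "{lC, lD} \<union> {lE, lF} = {lC, lD, lE, lF}"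
    "{lC, lD} \<union> {lG, lH} = {lC, lD, lG, lH}"
    by auto
  show "auxiliary_symbols (Phi1 {lA, lB} {lC, lD} {lE, lF} {lG, lH}) =
     {Alpha2 {lA, lB, lC, lD}, Line {lA, lB, lE, lF}, Line {lA, lB, lG, lH},
      Line (- {lA, lB, lG, lH}), Line (- {lA, lB, lE, lF})}"
    by (simp only: auxiliary_symbols.simps c u)
  show "auxiliary_symbols (Phi2 {lC, lD, lE} {lF, lG, lH}) =
     {Alpha1 {lA, lB}, Line {lA, lC, lD, lE}, Line {lB, lC, lD, lE},
      Line (- {lB, lC, lD, lE}), Line (- {lA, lC, lD, lE})}"
    by (simp only: auxiliary_symbols.simps c) auto
  show "auxiliary_symbols (Phi2 {lA, lG, lH} {lB, lC, lD}) =
     {Alpha1 {lE, lF}, Line {lE, lA, lG, lH}, Line {lF, lA, lG, lH},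
      Line (- {lF, lA, lG, lH}), Line (- {lE, lA, lG, lH})}"
    by (simp only: auxiliary_symbols.simps c) auto
qed

lemma table_valid: "(s, t) \<in> compatibility_table \<Longrightarrow> valid_symbol s \<and> valid_symbol t"
  unfolding compatibility_table_def by (elim insertE emptyE; simp add: UNIV_label insert_commute)

lemma checks_conform:
  "\<forall>(s, ts)\<in>set (table_checks @ Phi1_checks @ Phi2_checks @ Phi3_checks). \<forall>t\<in>set ts. conform s t"
proof -
  have "\<forall>(s, ts)\<in>set (table_checks @ Phi1_checks @ Phi2_checks @ Phi3_checks). \<forall>t\<in>set ts. valid_symbol s \<and> valid_symbol t"
    by (simp add: table_checks_def Phi1_checks_def Phi2_checks_def Phi3_checks_def Let_def UNIV_label insert_commute)
  then show ?thesis
    using all_agreeD[OF table_checks_agree] all_agreeD[OF Phi1_checks_agree] all_agreeD[OF Phi2_checks_agree] all_agreeD[OF Phi3_checks_agree]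
    by fastforce
qed

lemmas conform_list =
  checks_conform[unfolded table_checks_def Phi1_checks_def Phi2_checks_def Phi3_checks_def Let_def, simplified]

lemma table_conform:
  assumes "(s, t) \<in> compatibility_table"
  shows "conform s t \<and> (\<forall>a\<in>auxiliary_symbols s. conform a t)"
proof -
  note known = conform_list conform_TCu
  have sym: "conform (Phi2 {lA, lG, lH} {lB, lC, lD}) (Chi1 {lA, lH} {lB, lC, lD} {lE, lF, lG})"
    "conform (Alpha1 {lE, lF}) (Chi1 {lA, lH} {lB, lC, lD} {lE, lF, lG})"
    "conform (Line {lE, lA, lG, lH}) (Chi1 {lA, lH} {lB, lC, lD} {lE, lF, lG})"
    "conform (Line {lF, lA, lG, lH}) (Chi1 {lA, lH} {lB, lC, lD} {lE, lF, lG})"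
    "conform (Line {lA, lB, lC, lD}) (Chi1 {lA, lB} {lC, lD, lE} {lF, lG, lH})"
    "conform (Line {lA, lB, lC, lD}) (Chi2 {lA, lB, lC})"
    "conform (Alpha2 {lB, lC, lD, lE}) (Chi2 {lB, lC, lD})"
    "conform (Line {lB, lC, lD, lE}) (Chi2 {lB, lC, lD})"
    by (rule conform_sym, simp add: conform_list)+
  show ?thesis
    using assms unfolding compatibility_table_def
    by (elim insertE emptyE; simp add: known sym auxiliary_symbols_explicit conform_Line_Compl
        del: auxiliary_symbols.simps(1,2))
qed

lemma auxiliary_symbols_relabel:
  assumes "bij \<pi>"
  shows "auxiliary_symbols (relabel \<pi> s) = relabel \<pi> ` auxiliary_symbols s"
proof -
  have c: "- \<pi> ` T = \<pi> ` (- T)" for T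
    using assms by (simp add: bij_image_Compl_eq)
  show ?thesis
  proof (cases s)
    case (Phi2 abc fgh)
    have "- (\<pi> ` abc \<union> \<pi> ` fgh) = \<pi> ` (- (abc \<union> fgh))"
      by (simp only: c[symmetric] image_Un)
    then show ?thesis unfolding Phi2 relabel.simps auxiliary_symbols.simps
      by (auto simp: image_iff)
  next
    case (Phi3 abcd)
    then show ?thesis by (simp add: c)
  qed (simp_all add: image_Un)
qed

lemma auxiliary_symbols_valid:
  assumes "valid_symbol s" "a \<in> auxiliary_symbols s"
  shows "valid_symbol a"
proof (cases s)
  case (Phi1 ab cd ef gh)
  then show ?thesis using assms Phi1_groups[of ab cd ef gh] by (auto simp: card_Un_disjoint)
next
  case (Phi2 abc fgh)
  then have "card (abc \<union> fgh) = 6" using assms by (simp add: card_Un_disjoint)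
  then have "card (- (abc \<union> fgh)) = 2" by (subst card_Compl_label) simp
  then show ?thesis using assms Phi2 by auto
qed (use assms in \<open>auto simp: card_Compl_label\<close>)

text \<open>
  These pairs are not in the table of compatible pairs.
\<close>

lemma conform_auxiliary_self:
  assumes "valid_symbol s" "a \<in> auxiliary_symbols s"
  shows "conform a s"
proof -
  have rep: "conform a s" if r: "valid_symbol r" "kind_of r = kind_of s" "\<forall>a\<in>auxiliary_symbols r. conform a r" for r
  proof -
    obtain \<pi> where \<pi>: "bij \<pi>" "s = relabel \<pi> r"
      using relabel_transitive[OF r(1) assms(1) r(2)] .
    then show ?thesis
      using assms(2) r(3) conform_relabel auxiliary_symbols_relabel by auto
  qed
  show ?thesis
  proof (cases s)
    case (Phi1 ab cd ef gh)
    have "\<forall>a\<in>auxiliary_symbols (Phi1 {lA, lB} {lC, lD} {lE, lF} {lG, lH}).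
        conform a (Phi1 {lA, lB} {lC, lD} {lE, lF} {lG, lH})"
      unfolding auxiliary_symbols_explicit using conform_list
      by (auto intro!: conform_Line_Compl intro: conform_sym)
    then show ?thesis
      using Phi1 by (intro rep[of "Phi1 {lA, lB} {lC, lD} {lE, lF} {lG, lH}"]) (auto simp: UNIV_label)
  next
    case (Phi2 abc fgh)
    have "\<forall>a\<in>auxiliary_symbols (Phi2 {lC, lD, lE} {lF, lG, lH}).
        conform a (Phi2 {lC, lD, lE} {lF, lG, lH})"
      unfolding auxiliary_symbols_explicit using conform_list
      by (auto intro!: conform_Line_Compl intro: conform_sym)
    then show ?thesis
      using Phi2 by (intro rep[of "Phi2 {lC, lD, lE} {lF, lG, lH}"]) auto
  next
    case (Phi3 abcd)
    have "\<forall>a\<in>auxiliary_symbols (Phi3 {lA, lB, lC, lD}). conform a (Phi3 {lA, lB, lC, lD})"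
      using conform_list conform_TCu by (auto intro!: conform_Line_Compl intro: conform_sym)
    then show ?thesis
      using Phi3 by (intro rep[of "Phi3 {lA, lB, lC, lD}"]) auto
  qed (use assms in auto)
qed

lemma auxiliary_pictures:
  assumes "valid_symbol s" "valid_symbol s'" "symbol_picture s = symbol_picture s'"
  shows "symbol_picture ` auxiliary_symbols s = symbol_picture ` auxiliary_symbols s'"
proof (cases s)
  case (Phi1 ab cd ef gh)
  have aux: "symbol_picture ` auxiliary_symbols (Phi1 a b c d) =
      {Alpha2_pic {a \<union> b, c \<union> d}, Line_pic {a \<union> c, b \<union> d}, Line_pic {a \<union> d, b \<union> c}}"
    if v: "valid_symbol (Phi1 a b c d)" for a b c d
  proof -
    have u: "x \<in> a \<or> x \<in> b \<or> x \<in> c \<or> x \<in> d" for x using v by auto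
    have "- (a \<union> b) = c \<union> d" "- (a \<union> c) = b \<union> d" "- (a \<union> d) = b \<union> c" "- (b \<union> c) = a \<union> d"
      "- (b \<union> d) = a \<union> c"
      using u Phi1_groups[OF v] by blast+
    then show ?thesis by (simp add: insert_commute del: Compl_Un)
  qed
  obtain ab' cd' ef' gh' where s': "s' = Phi1 ab' cd' ef' gh'"
    using assms(3) Phi1 by (cases s') auto
  have "{{ab, cd}, {ef, gh}} = {{ab', cd'}, {ef', gh'}}" using assms(3) Phi1 s' by simp
  then have "(ab', cd', ef', gh') \<in> {(ab, cd, ef, gh), (cd, ab, ef, gh), (ab, cd, gh, ef),
      (cd, ab, gh, ef), (ef, gh, ab, cd), (gh, ef, ab, cd), (ef, gh, cd, ab), (gh, ef, cd, ab)}"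
    unfolding doubleton_eq_iff by (elim disjE conjE) simp_all
  moreover note aux[OF assms(1)[unfolded Phi1]] aux[OF assms(2)[unfolded s']]
  ultimately show ?thesis
    unfolding Phi1 s' by (elim insertE emptyE; simp add: Un_commute insert_commute)
next
  case (Phi2 abc fgh)
  then obtain abc' fgh' where s': "s' = Phi2 abc' fgh'"
    using assms(3) by (cases s') auto
  have "{abc, fgh} = {abc', fgh'}" using assms(3) Phi2 s' by simp
  then have "abc' = abc \<and> fgh' = fgh \<or> abc' = fgh \<and> fgh' = abc"
    by (auto simp: doubleton_eq_iff)
  then show ?thesis unfolding Phi2 s' by (elim disjE conjE) (simp_all only: auxiliary_symbols.simps Un_commute insert_commute)
next
  case (Phi3 abcd)
  then obtain abcd' where s': "s' = Phi3 abcd'" using assms(3) by (cases s') auto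
  then have "abcd' = abcd \<or> abcd' = - abcd" using assms(3) Phi3 by (auto simp: doubleton_eq_iff)
  then show ?thesis unfolding Phi3 s' by (elim disjE) (simp_all add: insert_commute)
qed (use assms(3) in \<open>cases s'; auto\<close>)+

text \<open>
  Auxiliary blocks are excluded from the test of compatibility in a decomposition, but they inherit
  a weaker property from the \<open>\<phi>\<close>-block they belong to.
\<close>

lemma compatible_conform:
  assumes "b \<in> building_blocks" "c \<in> building_blocks" "compatible b c"
  shows "conform (fst b) (fst c) \<and> (\<forall>a\<in>auxiliary_blocks b. conform (fst a) (fst c))"
proof -
  have v: "valid_symbol (fst b)" "valid_symbol (fst c)"
    using assms(1,2) by (auto simp: building_blocks_def)
  have main: "conform (fst b) (fst c) \<and> (\<forall>a\<in>auxiliary_blocks b. conform (fst a) (fst c))"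
    if s: "valid_symbol s" "symbol_picture s = picture b" and t: "valid_symbol t" "symbol_picture t = picture c"
      and st: "conform s t" "\<forall>a\<in>auxiliary_symbols s. conform a t" for s t
  proof -
    have tc: "conform x (fst c)" if "conform x t" for x
      using conform_picture[OF v(2) t(1) _ conform_sym[OF that]] t(2) conform_sym by (simp add: picture_def)
    have "conform (fst b) t"
      using conform_picture[OF v(1) s(1) _ st(1)] s(2) by (simp add: picture_def)
    moreover have "conform (fst a) t" if a: "a \<in> auxiliary_blocks b" for a
    proof -
      have va: "valid_symbol (fst a)" using a by (auto simp: auxiliary_blocks_def building_blocks_def)
      have "symbol_picture (fst a) \<in> symbol_picture ` auxiliary_symbols (fst b)"
        using a by (simp add: auxiliary_blocks_def picture_def)
      also have "\<dots> = symbol_picture ` auxiliary_symbols s"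
        using auxiliary_pictures[OF v(1) s(1)] s(2) by (simp add: picture_def)
      finally obtain a' where a': "a' \<in> auxiliary_symbols s" "symbol_picture (fst a) = symbol_picture a'"
        by blast
      then show ?thesis
        using conform_picture[OF va auxiliary_symbols_valid[OF s(1) a'(1)] a'(2)] st(2) by blast
    qed
    ultimately show ?thesis using tc by blast
  qed
  show ?thesis
  proof (cases "picture b = picture c")
    case True
    then show ?thesis
      using main[of "fst b" "fst b"] v conform_refl conform_auxiliary_self by (simp add: picture_def)
  next
    case False
    then obtain \<pi> s t where \<pi>: "bij \<pi>" and st: "(s, t) \<in> compatibility_table"
      and pics: "{picture b, picture c} = {symbol_picture (relabel \<pi> s), symbol_picture (relabel \<pi> t)}"
      using assms(3) unfolding compatible_def by blast
    have val: "valid_symbol (relabel \<pi> s)" "valid_symbol (relabel \<pi> t)"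
      using table_valid[OF st] valid_symbol_relabel[OF \<pi>] by blast+
    have con: "conform (relabel \<pi> s) (relabel \<pi> t)"
      "\<forall>a\<in>auxiliary_symbols (relabel \<pi> s). conform a (relabel \<pi> t)"
      using table_conform[OF st] conform_relabel[OF \<pi>] by (auto simp: auxiliary_symbols_relabel[OF \<pi>])
    \<comment> \<open>The table lists \<open>\<phi>\<close>-symbols in the first place only.\<close>
    have none: "auxiliary_symbols (relabel \<pi> t) = {}"
      using st unfolding compatibility_table_def by auto
    from pics consider "picture b = symbol_picture (relabel \<pi> s)" "picture c = symbol_picture (relabel \<pi> t)"
      | "picture b = symbol_picture (relabel \<pi> t)" "picture c = symbol_picture (relabel \<pi> s)"
      by (auto simp: doubleton_eq_iff)
    then show ?thesis
    proof cases
      case 1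
      then show ?thesis using main[OF val(1) _ val(2) _ con] by simp
    next
      case 2
      then show ?thesis using main[OF val(2) _ val(1) _ conform_sym[OF con(1)]] none by simp
    qed
  qed
qed

section \<open>Enumeration of the pictures of a kind\<close>

fun picks :: "nat \<Rightarrow> 'a list \<Rightarrow> ('a list \<times> 'a list) list" where
  "picks 0 xs = [([], xs)]"
| "picks (Suc n) [] = []"
| "picks (Suc n) (x # xs) =
     map (\<lambda>(ys, zs). (x # ys, zs)) (picks n xs) @ map (\<lambda>(ys, zs). (ys, x # zs)) (picks (Suc n) xs)"

definition colour_by :: "label list \<Rightarrow> label list \<Rightarrow> label list \<Rightarrow> palette" where
  "colour_by xs ys zs = palette_of (\<lambda>x. if x \<in> set xs then First else if x \<in> set ys then Second
     else if x \<in> set zs then Third else Fourth)"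

text \<open>
  One colouring for each picture: among the groups which the picture does not distinguish, the one with the
  first available label comes first.
\<close>

fun palettes :: "kind \<Rightarrow> palette list" where
  "palettes Alpha1_kind = [colour_by xs ys []. (xs, ys) \<leftarrow> picks 2 labels]"
| "palettes Alpha2_kind = [colour_by (hd labels # xs) ys []. (xs, ys) \<leftarrow> picks 3 (tl labels)]"
| "palettes Chi1_kind = [colour_by xs (hd r # ys) zs. (xs, r) \<leftarrow> picks 2 labels, (ys, zs) \<leftarrow> picks 2 (tl r)]"
| "palettes Chi2_kind = [colour_by xs ys []. (xs, ys) \<leftarrow> picks 3 labels]"
| "palettes Phi1_kind = [colour_by (hd labels # ws) xs (hd r' # ys).
     (ws, r) \<leftarrow> picks 1 (tl labels), (xs, r') \<leftarrow> picks 2 r, (ys, zs) \<leftarrow> picks 1 (tl r')]"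
| "palettes Phi2_kind = [colour_by (hd r # xs) ys zs. (zs, r) \<leftarrow> picks 2 labels, (xs, ys) \<leftarrow> picks 2 (tl r)]"
| "palettes Phi3_kind = [colour_by (hd labels # xs) ys []. (xs, ys) \<leftarrow> picks 3 (tl labels)]"
| "palettes TCu_kind = []"
| "palettes Line_kind = [colour_by (hd labels # xs) ys []. (xs, ys) \<leftarrow> picks 3 (tl labels)]"

lemma picks_complete:
  assumes "distinct xs" "T \<subseteq> set xs" "card T = n"
  shows "\<exists>(ys, zs)\<in>set (picks n xs). set ys = T \<and> set zs = set xs - T \<and> distinct zs"
  using assms
proof (induction xs arbitrary: n T)
  case Nil
  then show ?case by auto
next
  case (Cons x xs)
  have fin: "finite T" using Cons.prems(2) by (rule finite_subset) simp
  show ?case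
  proof (cases n)
    case 0
    then show ?thesis using Cons.prems fin by auto
  next
    case (Suc k)
    show ?thesis
    proof (cases "x \<in> T")
      case True
      have "\<exists>(ys, zs)\<in>set (picks k xs). set ys = T - {x} \<and> set zs = set xs - (T - {x}) \<and> distinct zs"
        using Cons.prems True Suc fin by (intro Cons.IH) auto
      then obtain ys zs where "(ys, zs) \<in> set (picks k xs)" "set ys = T - {x}"
        "set zs = set xs - (T - {x})" "distinct zs" by blast
      then show ?thesis using True Cons.prems(1) Suc by (intro bexI[of _ "(x # ys, zs)"]) auto
    next
      case False
      have "\<exists>(ys, zs)\<in>set (picks n xs). set ys = T \<and> set zs = set xs - T \<and> distinct zs"
        using Cons.prems False by (intro Cons.IH) auto
      then obtain ys zs where "(ys, zs) \<in> set (picks n xs)" "set ys = T" "set zs = set xs - T"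
        "distinct zs" by blast
      then show ?thesis using False Cons.prems(1) Suc by (intro bexI[of _ "(ys, x # zs)"]) auto
    qed
  qed
qed

lemma picksE:
  assumes "distinct xs" "T \<subseteq> set xs" "card T = n"
  obtains ys zs where "(ys, zs) \<in> set (picks n xs)" "set ys = T" "set zs = set xs - T" "distinct zs"
  using picks_complete[OF assms] by blast

lemma distinct_labels: "distinct labels"
  by (simp add: labels_def)

lemma labels_hd_tl: "hd labels = lA" "distinct (tl labels)" "set (tl labels) = - {lA}"
  using UNIV_label by (auto simp: labels_def)

lemma hd_tl:
  assumes "distinct xs" "xs \<noteq> []"
  shows "hd xs \<in> set xs" "set (tl xs) = set xs - {hd xs}" "distinct (tl xs)"
  using assms by (cases xs; auto)+

lemma colour_by_two:
  assumes "set ys = - set xs"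
  shows "colour_by xs ys [] = palette_of (\<lambda>x. if x \<in> set xs then First else Second)"
  unfolding colour_by_def using assms by (auto intro!: arg_cong[where f = palette_of])

lemma four_plus_four:
  assumes "card T = 4"
  obtains xs ys T' where "(xs, ys) \<in> set (picks 3 (tl labels))" "T' \<in> {T, - T}"
    "set (hd labels # xs) = T'" "set ys = - T'"
proof -
  define T' where "T' = (if lA \<in> T then T else - T)"
  have T': "lA \<in> T'" "card T' = 4" "T' \<in> {T, - T}"
    using assms by (auto simp: T'_def card_Compl_label)
  have "T' - {lA} \<subseteq> set (tl labels)" "card (T' - {lA}) = 3"
    using T' by (auto simp: labels_hd_tl)
  with labels_hd_tl(2) obtain xs ys where xs: "(xs, ys) \<in> set (picks 3 (tl labels))" "set xs = T' - {lA}"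
    "set ys = set (tl labels) - (T' - {lA})"
    by (rule picksE)
  then have "set (hd labels # xs) = T'" "set ys = - T'"
    using T' by (auto simp: labels_hd_tl)
  with xs(1) T'(3) show thesis by (rule that)
qed

lemma colouring_two:
  "colouring (Alpha1 T) = (\<lambda>x. if x \<in> T then First else Second)"
  "colouring (Alpha2 T) = (\<lambda>x. if x \<in> T then First else Second)"
  "colouring (Chi2 T) = (\<lambda>x. if x \<in> T then First else Second)"
  "colouring (Phi3 T) = (\<lambda>x. if x \<in> T then First else Second)"
  "colouring (Line T) = (\<lambda>x. if x \<in> T then First else Second)"
  by auto

text \<open>
  A symbol is replaced by the one with the same picture whose indistinguishable groups come in
  the order of the enumeration.
\<close>

lemma palettes_complete:
  assumes "valid_symbol s" "kind_of s \<noteq> TCu_kind"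
  shows "\<exists>s'. valid_symbol s' \<and> symbol_picture s' = symbol_picture s \<and> kind_of s' = kind_of s \<and>
    palette_of (colouring s') \<in> set (palettes (kind_of s))"
proof (cases s)
  case (Alpha1 T)
  then have "T \<subseteq> set labels" "card T = 2" using assms(1) by (auto simp: set_labels)
  with distinct_labels obtain xs ys where "(xs, ys) \<in> set (picks 2 labels)" "set xs = T"
    "set ys = set labels - T"
    by (rule picksE)
  moreover from this have "colour_by xs ys [] = palette_of (colouring s)"
    unfolding Alpha1 colouring_two by (subst colour_by_two) (auto simp: set_labels)
  ultimately show ?thesis
    using assms(1) Alpha1 by (intro exI[of _ s]) force
next
  case (Chi2 T)
  then have "T \<subseteq> set labels" "card T = 3" using assms(1) by (auto simp: set_labels)
  with distinct_labels obtain xs ys where "(xs, ys) \<in> set (picks 3 labels)" "set xs = T"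
    "set ys = set labels - T"
    by (rule picksE)
  moreover from this have "colour_by xs ys [] = palette_of (colouring s)"
    unfolding Chi2 colouring_two by (subst colour_by_two) (auto simp: set_labels)
  ultimately show ?thesis
    using assms(1) Chi2 by (intro exI[of _ s]) force
next
  case (Alpha2 T)
  then obtain xs ys T' where xs: "(xs, ys) \<in> set (picks 3 (tl labels))" "T' \<in> {T, - T}"
    "set (hd labels # xs) = T'" "set ys = - T'"
    using four_plus_four[of T] assms(1) by auto
  then have "colour_by (hd labels # xs) ys [] = palette_of (colouring (Alpha2 T'))"
    unfolding colouring_two by (subst colour_by_two) auto
  moreover have "valid_symbol (Alpha2 T')" "symbol_picture (Alpha2 T') = symbol_picture s"
    using xs(2) assms(1) Alpha2 by (auto simp: card_Compl_label)
  ultimately show ?thesis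
    using xs(1) Alpha2 by (intro exI[of _ "Alpha2 T'"]) force
next
  case (Phi3 T)
  then obtain xs ys T' where xs: "(xs, ys) \<in> set (picks 3 (tl labels))" "T' \<in> {T, - T}"
    "set (hd labels # xs) = T'" "set ys = - T'"
    using four_plus_four[of T] assms(1) by auto
  then have "colour_by (hd labels # xs) ys [] = palette_of (colouring (Phi3 T'))"
    unfolding colouring_two by (subst colour_by_two) auto
  moreover have "valid_symbol (Phi3 T')" "symbol_picture (Phi3 T') = symbol_picture s"
    using xs(2) assms(1) Phi3 by (auto simp: card_Compl_label)
  ultimately show ?thesis
    using xs(1) Phi3 by (intro exI[of _ "Phi3 T'"]) force
next
  case (Line T)
  then obtain xs ys T' where xs: "(xs, ys) \<in> set (picks 3 (tl labels))" "T' \<in> {T, - T}"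
    "set (hd labels # xs) = T'" "set ys = - T'"
    using four_plus_four[of T] assms(1) by auto
  then have "colour_by (hd labels # xs) ys [] = palette_of (colouring (Line T'))"
    unfolding colouring_two by (subst colour_by_two) auto
  moreover have "valid_symbol (Line T')" "symbol_picture (Line T') = symbol_picture s"
    using xs(2) assms(1) Line by (auto simp: card_Compl_label)
  ultimately show ?thesis
    using xs(1) Line by (intro exI[of _ "Line T'"]) force
next
  case (Chi1 ab cde fgh)
  note v = assms(1)[unfolded Chi1]
  note g = Chi1_groups[OF v]
  have card: "card ab = 2" "card cde = 3" "card fgh = 3" and u: "ab \<union> cde \<union> fgh = UNIV" using v by auto
  have "ab \<subseteq> set labels" by (simp add: set_labels)
  with distinct_labels obtain xs r where r: "(xs, r) \<in> set (picks 2 labels)" "set xs = ab"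
    "set r = set labels - ab" "distinct r"
    using card(1) by (rule picksE)
  have r': "set r = cde \<union> fgh" using r(3) u g by (auto simp: set_labels)
  then have "r \<noteq> []" using card(2) by auto
  note hd = hd_tl[OF r(4) this]
  obtain p q where pq: "{p, q} = {cde, fgh}" "hd r \<in> p" "card p = 3" "card q = 3" "p \<inter> q = {}" "p \<union> q = cde \<union> fgh"
    "ab \<inter> p = {}" "ab \<inter> q = {}"
  proof (cases "hd r \<in> cde")
    case True
    then show thesis using that[of cde fgh] card g by auto
  next
    case False
    then have "hd r \<in> fgh" using hd(1) r' by auto
    then show thesis using that[of fgh cde] card g by auto
  qed
  have "p - {hd r} \<subseteq> set (tl r)" "card (p - {hd r}) = 2" using pq(2,3,6) hd(2) r' by auto
  with hd(3) obtain ys zs where ys: "(ys, zs) \<in> set (picks 2 (tl r))" "set ys = p - {hd r}"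
    "set zs = set (tl r) - (p - {hd r})"
    by (rule picksE)
  have sets: "set (hd r # ys) = p" "set zs = q"
    using ys(2,3) pq(2,5,6) hd(2) r' by auto
  have vs: "valid_symbol (Chi1 ab p q)" using card(1) pq(3,4,6) u by auto
  have "x \<in> ab \<or> x \<in> p \<or> x \<in> q" for x using vs by auto
  then have "colour_by xs (hd r # ys) zs = palette_of (colouring (Chi1 ab p q))"
    unfolding colour_by_def r(2) sets by (intro arg_cong[where f = palette_of] ext) auto
  moreover have "colour_by xs (hd r # ys) zs \<in> set (palettes Chi1_kind)"
    using r(1) ys(1) by force
  moreover have "symbol_picture (Chi1 ab p q) = symbol_picture s"
    using pq(1) Chi1 by simp
  ultimately show ?thesis
    using vs by (intro exI[of _ "Chi1 ab p q"]) (simp add: Chi1 del: palettes.simps colouring.simps)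
next
  case (Phi2 abc fgh)
  note v = assms(1)[unfolded Phi2]
  have card: "card abc = 3" "card fgh = 3" and g: "abc \<inter> fgh = {}" using v by auto
  then have "card (abc \<union> fgh) = 6" by (simp add: card_Un_disjoint)
  then have "card (- (abc \<union> fgh)) = 2" by (subst card_Compl_label) simp
  moreover have "- (abc \<union> fgh) \<subseteq> set labels" by (simp add: set_labels)
  moreover note distinct_labels
  ultimately obtain zs r where r: "(zs, r) \<in> set (picks 2 labels)" "set zs = - (abc \<union> fgh)"
    "set r = set labels - - (abc \<union> fgh)" "distinct r"
    by (metis picksE)
  have r': "set r = abc \<union> fgh" using r(3) by (auto simp: set_labels)
  then have "r \<noteq> []" using card(2) by auto
  note hd = hd_tl[OF r(4) this]
  obtain p q where pq: "{p, q} = {abc, fgh}" "hd r \<in> p" "card p = 3" "card q = 3" "p \<inter> q = {}" "p \<union> q = abc \<union> fgh"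
  proof (cases "hd r \<in> abc")
    case True
    then show thesis using that[of abc fgh] card g by auto
  next
    case False
    then have "hd r \<in> fgh" using hd(1) r' by auto
    then show thesis using that[of fgh abc] card g by auto
  qed
  have "p - {hd r} \<subseteq> set (tl r)" "card (p - {hd r}) = 2" using pq(2,3,6) hd(2) r' by auto
  with hd(3) obtain xs ys where xs: "(xs, ys) \<in> set (picks 2 (tl r))" "set xs = p - {hd r}"
    "set ys = set (tl r) - (p - {hd r})"
    by (rule picksE)
  have sets: "set (hd r # xs) = p" "set ys = q"
    using xs(2,3) pq(2,5,6) hd(2) r' by auto
  have "x \<in> - (abc \<union> fgh) \<longleftrightarrow> x \<notin> p \<and> x \<notin> q" for x using pq(6) by auto
  then have "colour_by (hd r # xs) ys zs = palette_of (colouring (Phi2 p q))"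
    unfolding colour_by_def r(2) sets by (intro arg_cong[where f = palette_of] ext) auto
  moreover have "colour_by (hd r # xs) ys zs \<in> set (palettes Phi2_kind)"
    using r(1) xs(1) by force
  moreover have "symbol_picture (Phi2 p q) = symbol_picture s"
    using pq(1) Phi2 by simp
  ultimately show ?thesis
    using pq(3-5) by (intro exI[of _ "Phi2 p q"]) (simp add: Phi2 del: palettes.simps colouring.simps)
next
  case (Phi1 ab cd ef gh)
  have "\<exists>p q r s. {{p, q}, {r, s}} = {{ab, cd}, {ef, gh}} \<and> lA \<in> p \<and> valid_symbol (Phi1 p q r s)"
  proof -
    have v: "valid_symbol (Phi1 ab cd ef gh)" "valid_symbol (Phi1 cd ab ef gh)"
      "valid_symbol (Phi1 ef gh ab cd)" "valid_symbol (Phi1 gh ef ab cd)"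
      using assms(1) Phi1 by auto
    have e: "{{cd, ab}, {ef, gh}} = {{ab, cd}, {ef, gh}}" "{{ef, gh}, {ab, cd}} = {{ab, cd}, {ef, gh}}"
      "{{gh, ef}, {ab, cd}} = {{ab, cd}, {ef, gh}}"
      by (simp_all add: insert_commute)
    have "lA \<in> ab \<or> lA \<in> cd \<or> lA \<in> ef \<or> lA \<in> gh" using v(1) by auto
    then show ?thesis using v e by blast
  qed
  then obtain p q r s where pqrs: "{{p, q}, {r, s}} = {{ab, cd}, {ef, gh}}" "lA \<in> p"
    "valid_symbol (Phi1 p q r s)" by blast
  note v = pqrs(3)
  note g = Phi1_groups[OF v]
  have card: "card p = 2" "card q = 2" "card r = 2" "card s = 2" and u: "p \<union> q \<union> r \<union> s = UNIV" using v by auto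
  have "p - {lA} \<subseteq> set (tl labels)" "card (p - {lA}) = 1" using pqrs(2) card(1) by (auto simp: labels_hd_tl)
  with labels_hd_tl(2) obtain ws l where ws: "(ws, l) \<in> set (picks 1 (tl labels))" "set ws = p - {lA}"
    "set l = set (tl labels) - (p - {lA})" "distinct l"
    by (rule picksE)
  have l: "set l = q \<union> r \<union> s" using ws(3) pqrs(2) g u by (auto simp: labels_hd_tl)
  then have "q \<subseteq> set l" by auto
  with ws(4) obtain xs l' where xs: "(xs, l') \<in> set (picks 2 l)" "set xs = q" "set l' = set l - q" "distinct l'"
    using card(2) by (rule picksE)
  have l': "set l' = r \<union> s" using xs(3) l g by auto
  then have "l' \<noteq> []" using card(3) by auto
  note hd = hd_tl[OF xs(4) this]
  obtain r' s' where rs: "{r', s'} = {r, s}" "hd l' \<in> r'" "card r' = 2" "card s' = 2" "r' \<inter> s' = {}" "r' \<union> s' = r \<union> s"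
    "valid_symbol (Phi1 p q r' s')"
  proof (cases "hd l' \<in> r")
    case True
    then show thesis using that[of r s] card g v by auto
  next
    case False
    then have "hd l' \<in> s" using hd(1) l' by auto
    moreover have "valid_symbol (Phi1 p q s r)" using v by auto
    ultimately show thesis using that[of s r] card g(6) by (simp add: insert_commute Un_commute Int_commute)
  qed
  have "r' - {hd l'} \<subseteq> set (tl l')" "card (r' - {hd l'}) = 1" using rs(2,3,6) hd(2) l' by auto
  with hd(3) obtain ys zs where ys: "(ys, zs) \<in> set (picks 1 (tl l'))" "set ys = r' - {hd l'}"
    by (rule picksE)
  have sets: "set (hd labels # ws) = p" "set (hd l' # ys) = r'"
    using ys(2) ws(2) pqrs(2) rs(2) by (auto simp: labels_hd_tl)
  have "colour_by (hd labels # ws) xs (hd l' # ys) = palette_of (colouring (Phi1 p q r' s'))"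
    unfolding colour_by_def xs(2) sets by (intro arg_cong[where f = palette_of] ext) auto
  moreover have "colour_by (hd labels # ws) xs (hd l' # ys) \<in> set (palettes Phi1_kind)"
    using ws(1) xs(1) ys(1) by force
  moreover have "symbol_picture (Phi1 p q r' s') = symbol_picture (Phi1 ab cd ef gh)"
    using rs(1) pqrs(1) by simp
  ultimately show ?thesis
    using rs(7) by (intro exI[of _ "Phi1 p q r' s'"])
      (simp add: Phi1 del: palettes.simps colouring.simps valid_symbol.simps)
next
  case TCu
  then show ?thesis using assms(2) by simp
qed

section \<open>Isolating a picture by a search tree\<close>

definition opposed :: "sign list \<Rightarrow> sign list \<Rightarrow> bool" where
  "opposed u v = list_ex (\<lambda>(x, y). opposite x y) (zip u v)"

text \<open>
  The vectors in \<open>N\<close> list the signs of certain tests at the candidates for the other pictures.  A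
  test \<open>k\<close> fails to isolate only if it is positive at some candidate \<open>v\<close> that is present; this
  excludes the candidates opposed to \<open>v\<close>, and the search goes on with the tests that are not positive at \<open>v\<close>.
\<close>

function refutes :: "nat list \<Rightarrow> sign list list \<Rightarrow> bool" where
  "refutes [] N = False"
| "refutes (k # ks) N = list_all (\<lambda>v. refutes (filter (\<lambda>j. v ! j \<noteq> Pos) ks) (filter (\<lambda>w. \<not> opposed v w) N))
     (filter (\<lambda>v. v ! k = Pos) N)"
  by pat_completeness auto
termination by (relation "Wellfounded.measure (\<lambda>(ks, N). length ks)") (auto simp: le_imp_less_Suc)

lemma refutes_sound:
  assumes "refutes ks N" "V \<subseteq> set N" "\<And>v w. v \<in> V \<Longrightarrow> w \<in> V \<Longrightarrow> \<not> opposed v w"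
  shows "\<exists>k\<in>set ks. \<forall>v\<in>V. v ! k \<noteq> Pos"
  using assms
proof (induction ks N rule: refutes.induct)
  case (1 N)
  then show ?case by simp
next
  case (2 k ks N)
  show ?case
  proof (cases "\<exists>v\<in>V. v ! k = Pos")
    case True
    then obtain v where v: "v \<in> V" "v ! k = Pos" by blast
    have "refutes (filter (\<lambda>j. v ! j \<noteq> Pos) ks) (filter (\<lambda>w. \<not> opposed v w) N)"
      using 2(2) 2(3) v by (auto simp: list_all_iff)
    moreover have "V \<subseteq> set (filter (\<lambda>w. \<not> opposed v w) N)"
      using 2(3) 2(4)[OF v(1)] by auto
    ultimately have "\<exists>j\<in>set (filter (\<lambda>j. v ! j \<noteq> Pos) ks). \<forall>v\<in>V. v ! j \<noteq> Pos"
      using 2(1)[of v] 2(3,4) v by auto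
    then show ?thesis by auto
  next
    case False
    then show ?thesis by auto
  qed
qed

text \<open>
  The tests in \<open>Ls\<close> are positive at \<open>x\<close>; a picture on which one of them is negative cannot occur
  together with \<open>x\<close>.
\<close>

definition rivals :: "kind list \<Rightarrow> code \<Rightarrow> label test list \<Rightarrow> code list" where
  "rivals ks x Ls = concat (map (\<lambda>k. filter (\<lambda>y. y \<noteq> x \<and> list_all (\<lambda>T. code_sign y T \<noteq> Neg) Ls)
     (map (\<lambda>p. (k, p)) (palettes k))) ks)"

text \<open>
  \<open>Ks\<close> are the tests among which the isolating one is found, \<open>Ls\<close> separate \<open>s\<close> from all but a few
  pictures, and \<open>Ms\<close> only serve to recognise opposed pairs of candidates.
\<close>

definition certifies ::
    "label test list \<Rightarrow> label test list \<Rightarrow> label test list \<Rightarrow> kind list \<Rightarrow> symbol \<Rightarrow> bool" where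
  "certifies Ks Ls Ms ks s \<longleftrightarrow>
    list_all (\<lambda>T. code_sign (code_of s) T = Pos) (Ks @ Ls) \<and>
    list_all (\<lambda>T. distinct (labels_of T)) (Ks @ Ls @ Ms) \<and>
    refutes [0..<length Ks] (map (\<lambda>y. map (code_sign y) (Ks @ Ls @ Ms)) (rivals ks (code_of s) Ls))"

lemma palette_of_inject: "palette_of f = palette_of g \<Longrightarrow> f = g"
  by (metis paint_palette_of)

definition unopposed :: "symbol set \<Rightarrow> bool" where
  "unopposed R \<longleftrightarrow> (\<forall>r\<in>R. \<forall>r'\<in>R. \<forall>T. proper T \<longrightarrow> \<not> (0 < symbol_value r T \<and> symbol_value r' T < 0))"

lemma code_sign_iff:
  assumes "proper T"
  shows "code_sign (code_of s) T = Pos \<longleftrightarrow> 0 < symbol_value s T"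
    and "code_sign (code_of s) T = Neg \<longleftrightarrow> symbol_value s T < 0"
  using sign_iff[OF assms, of s] by (simp_all add: code_sign_code_of)

text \<open>
  The symbols of \<open>R\<close> are first replaced by the enumerated ones with the same pictures.  Those different from \<open>s\<close> are
  rivals because \<open>R\<close> contains \<open>s\<close>, and their sign vectors are unopposed, as the search requires.
\<close>

lemma certifies_sound:
  assumes cert: "certifies Ks Ls Ms ks s" and s: "valid_symbol s" "s \<in> R"
    and R: "\<And>r. r \<in> R \<Longrightarrow> valid_symbol r \<and> kind_of r \<in> set ks \<and> kind_of r \<noteq> TCu_kind"
    and unopp: "unopposed R"
  shows "\<exists>T. proper T \<and> 0 < symbol_value s T \<and>
    (\<forall>r\<in>R. symbol_picture r \<noteq> symbol_picture s \<longrightarrow> symbol_value r T \<le> 0)"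
proof -
  let ?M = "Ks @ Ls @ Ms"
  let ?N = "map (\<lambda>y. map (code_sign y) ?M) (rivals ks (code_of s) Ls)"
  have pos: "code_sign (code_of s) T = Pos" if "T \<in> set Ks \<union> set Ls" for T
    using cert that by (auto simp: certifies_def list_all_iff)
  have proper: "proper T" if "T \<in> set ?M" for T
    using cert that by (auto simp: certifies_def list_all_iff proper_def)
  have solved: "refutes [0..<length Ks] ?N" using cert by (simp add: certifies_def)
  have "\<forall>r\<in>R. \<exists>r'. valid_symbol r' \<and> symbol_picture r' = symbol_picture r \<and> kind_of r' = kind_of r \<and>
      palette_of (colouring r') \<in> set (palettes (kind_of r))"
    using palettes_complete R by blast
  then obtain c where c: "\<And>r. r \<in> R \<Longrightarrow> valid_symbol (c r) \<and> symbol_picture (c r) = symbol_picture r \<and>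
      kind_of (c r) = kind_of r \<and> palette_of (colouring (c r)) \<in> set (palettes (kind_of r))"
    by metis
  have val: "symbol_value (c r) T = symbol_value r T" if "r \<in> R" "proper T" for r T
    using symbol_value_picture[OF _ _ _ that(2)] c[OF that(1)] R[OF that(1)] by blast
  define R' where "R' = {r \<in> R. symbol_picture r \<noteq> symbol_picture s}"
  define V where "V = (\<lambda>r. map (code_sign (code_of (c r))) ?M) ` R'"
  have "code_of (c r) \<in> set (rivals ks (code_of s) Ls)" if r: "r \<in> R'" for r
  proof -
    have rR: "r \<in> R" "symbol_picture r \<noteq> symbol_picture s" using r by (auto simp: R'_def)
    have "code_of (c r) \<noteq> code_of s"
    proof
      assume "code_of (c r) = code_of s"
      then have "c r = s"
        using c[OF rR(1)] s(1) by (intro symbol_eqI) (auto simp: code_of_def dest: palette_of_inject)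
      then show False using c[OF rR(1)] rR(2) by simp
    qed
    moreover have "code_sign (code_of (c r)) T \<noteq> Neg" if T: "T \<in> set Ls" for T
    proof -
      have p: "proper T" using proper T by simp
      have "0 < symbol_value s T" using pos[of T] T code_sign_iff(1)[OF p] by simp
      then have "\<not> symbol_value r T < 0"
        using unopp s(2) rR(1) p unfolding unopposed_def by blast
      then show ?thesis using code_sign_iff(2)[OF p, of "c r"] val[OF rR(1) p] by simp
    qed
    moreover have "code_of (c r) \<in> (\<lambda>p. (kind_of r, p)) ` set (palettes (kind_of r))"
      using c[OF rR(1)] by (simp add: code_of_def)
    ultimately show ?thesis
      using R[OF rR(1)] unfolding rivals_def by (auto simp: list_all_iff)
  qed
  then have "V \<subseteq> set ?N" by (auto simp: V_def)
  moreover have "\<not> opposed v w" if vw: "v \<in> V" "w \<in> V" for v w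
  proof
    assume opp: "opposed v w"
    obtain r r' where r: "r \<in> R'" "r' \<in> R'" "v = map (code_sign (code_of (c r))) ?M"
      "w = map (code_sign (code_of (c r'))) ?M"
      using vw by (auto simp: V_def)
    have "\<exists>T\<in>set ?M. opposite (code_sign (code_of (c r)) T) (code_sign (code_of (c r')) T)"
      using opp unfolding opposed_def r(3,4) list_ex_iff by (auto simp: zip_map1 zip_map2 zip_same)
    then obtain T where T: "T \<in> set ?M" "opposite (code_sign (code_of (c r)) T) (code_sign (code_of (c r')) T)"
      by blast
    have p: "proper T" by (rule proper[OF T(1)])
    have rR: "r \<in> R" "r' \<in> R" using r by (auto simp: R'_def)
    have "opposite x y \<Longrightarrow> x = Pos \<and> y = Neg \<or> x = Neg \<and> y = Pos" for x y
      by (cases x; cases y) auto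
    from this[OF T(2)] have "0 < symbol_value r T \<and> symbol_value r' T < 0 \<or>
        symbol_value r T < 0 \<and> 0 < symbol_value r' T"
      using code_sign_iff[OF p] val[OF _ p] rR by metis
    then show False using unopp rR p unfolding unopposed_def by blast
  qed
  ultimately obtain k where k: "k \<in> set [0..<length Ks]" "\<forall>v\<in>V. v ! k \<noteq> Pos"
    using refutes_sound[OF solved, of V] by blast
  then have kl: "k < length Ks" by simp
  define T where "T = Ks ! k"
  have T: "T \<in> set Ks" using kl by (simp add: T_def)
  have p: "proper T" using proper T by simp
  have "0 < symbol_value s T" using pos[of T] T code_sign_iff(1)[OF p] by simp
  moreover have "symbol_value r T \<le> 0" if r: "r \<in> R" "symbol_picture r \<noteq> symbol_picture s" for r
  proof -
    have "map (code_sign (code_of (c r))) ?M \<in> V" using r by (auto simp: V_def R'_def)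
    then have "map (code_sign (code_of (c r))) ?M ! k \<noteq> Pos" using k(2) by blast
    moreover have "map (code_sign (code_of (c r))) ?M ! k = code_sign (code_of (c r)) T"
      using kl by (simp add: nth_append T_def)
    ultimately show ?thesis
      using code_sign_iff(1)[OF p, of "c r"] val[OF r(1) p] by simp
  qed
  ultimately show ?thesis using p by blast
qed

section \<open>Every picture is isolated from those of later kinds\<close>

text \<open>
  The order in which coefficients are determined.  Few other pictures can occur together with a
  \<open>\<phi>\<close>-picture, many with an \<open>\<alpha>\<close>-picture; disposing of the former first keeps the searches for the
  latter small.
\<close>

fun stage :: "kind \<Rightarrow> nat" where
  "stage Phi1_kind = 0" | "stage Phi2_kind = 1" | "stage Phi3_kind = 2" | "stage Line_kind = 3" | "stage Chi1_kind = 4"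
| "stage Chi2_kind = 5" | "stage Alpha1_kind = 6" | "stage Alpha2_kind = 7" | "stage TCu_kind = 8"

definition witnessed :: "symbol \<Rightarrow> symbol set \<Rightarrow> bool" where
  "witnessed s R \<longleftrightarrow> (\<exists>T. proper T \<and> 0 < symbol_value s T \<and>
    (\<forall>r\<in>R. symbol_picture r \<noteq> symbol_picture s \<longrightarrow> symbol_value r T \<le> 0))"

definition admissible :: "kind \<Rightarrow> symbol set \<Rightarrow> bool" where
  "admissible k R \<longleftrightarrow> unopposed R \<and>
     (\<forall>r\<in>R. valid_symbol r \<and> kind_of r \<noteq> TCu_kind \<and> stage k \<le> stage (kind_of r))"

definition kinds_from :: "nat \<Rightarrow> kind list" where
  "kinds_from n = filter (\<lambda>k. n \<le> stage k) [Phi1_kind, Phi2_kind, Phi3_kind, Line_kind, Chi1_kind, Chi2_kind, Alpha1_kind, Alpha2_kind]"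

text \<open>
  In each certificate \<open>Ks\<close> is chosen such that the search tree is small, and \<open>Ls\<close> and \<open>Ms\<close> are small
  covers of the pairs to be separated.
\<close>

lemma certificate_Phi1: "certifies
    [T8 lA lH lB lE lC lF lD lG, T4 lA lF lB lH lE lC, T4 lA lG lD lH lF lE,
     T4 lB lE lA lH lF lD, T4 lC lD lA lB lG lF, T4 lA lE lB lG lF lC, T4 lA lB lC lD lH lG,
     T8 lA lE lB lH lC lG lD lF, T4 lA lC lD lE lH lG, T4 lB lH lA lF lG lD,
     T4 lA lH lB lE lD lC, T4 lA lF lB lG lE lD]
    [T4 lA lB lC lD lF lE, T4 lA lB lC lD lE lF, T4 lA lE lB lG lF lC, T4 lA lE lC lF lH lG,
     T4 lA lE lB lH lC lF, T4 lA lG lB lF lH lC, T4 lA lG lB lE lC lH, T4 lB lF lA lH lE lC,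
     T4 lD lF lA lB lC lG, T4 lC lD lA lB lG lE, T4 lA lD lC lG lE lF, T4 lA lF lB lG lD lE,
     T4 lA lC lD lF lG lH, T4 lB lC lA lE lH lG, T4 lA lG lB lF lC lD, T4 lA lD lB lC lG lH,
     T4 lA lB lC lD lE lH, T4 lC lG lA lB lD lF, T4 lC lD lA lB lF lH]
    [T4 lA lE lB lD lF lC, T4 lA lE lB lC lF lD, T4 lA lE lB lC lD lF, T4 lA lB lC lF lH lE,
     T4 lA lB lC lE lH lF, T4 lA lB lC lE lF lH, T4 lA lG lB lD lH lC, T4 lA lG lB lC lH lD,
     T4 lA lG lB lC lD lH, T4 lA lB lC lG lH lE, T4 lA lB lC lE lH lG, T4 lA lB lC lE lG lH,
     T4 lC lE lA lD lF lB, T4 lC lE lA lB lF lD, T4 lC lE lA lB lD lF, T4 lA lB lC lG lH lF,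
     T4 lA lB lC lF lH lG, T4 lA lB lC lF lG lH, T4 lA lC lB lE lG lD, T4 lA lC lB lD lG lE,
     T4 lA lC lB lD lE lG]
    (kinds_from (stage Phi1_kind)) (Phi1 {lA, lB} {lC, lD} {lE, lF} {lG, lH})"
  by code_simp

lemma certificate_Phi2: "certifies
    [T4 lA lH lB lC lE lD, T4 lA lH lB lD lG lF, T8 lG lA lB lH lC lE lD lF,
     T4 lB lE lA lC lH lF, T4 lA lE lB lC lH lF, T8 lG lA lB lD lC lH lE lF,
     T4 lB lD lA lC lH lF, T4 lC lF lA lB lE lD, T4 lA lD lB lC lG lF, T4 lA lB lD lE lH lG,
     T8 lD lA lB lF lC lH lE lG, T4 lA lE lC lD lH lG]
    [T4 lA lB lD lE lG lF, T4 lA lB lD lE lF lG, T4 lA lF lB lC lG lD, T4 lA lH lB lC lD lG,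
     T4 lA lF lC lD lH lG, T4 lA lG lC lD lF lH, T4 lB lG lA lC lH lD, T4 lC lG lA lB lD lH,
     T4 lA lD lB lC lF lH, T4 lB lF lA lC lE lG, T4 lC lG lA lB lF lE, T4 lA lC lD lE lH lG,
     T8 lG lA lB lE lC lF lD lH, T4 lB lD lA lE lG lH, T4 lA lB lC lF lE lD,
     T4 lA lE lB lD lH lF, T4 lC lF lA lB lE lD, T4 lB lF lA lC lD lH, T4 lA lF lB lE lH lG,
     T4 lA lB lC lF lD lE]
    [T4 lA lB lC lF lG lD, T4 lA lB lC lD lF lG, T4 lA lD lB lE lF lC, T4 lA lD lB lC lF lE,
     T4 lA lD lB lC lE lF, T4 lA lB lC lF lH lD, T4 lA lB lC lD lH lF, T4 lA lB lC lD lF lH,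
     T4 lB lD lA lE lF lC, T4 lB lD lA lC lF lE, T4 lB lD lA lC lE lF, T4 lA lB lC lG lH lD,
     T4 lA lB lC lD lH lG, T4 lA lB lC lD lG lH, T4 lC lD lA lE lF lB, T4 lC lD lA lB lE lF,
     T4 lA lB lC lG lH lF, T4 lA lF lB lE lG lD, T4 lA lF lB lD lG lE, T4 lA lF lB lD lE lG]
    (kinds_from (stage Phi2_kind)) (Phi2 {lA, lB, lC} {lF, lG, lH})"
  by code_simp

lemma certificate_Phi3: "certifies
    [T4 lA lG lC lD lF lE, T4 lC lF lA lB lG lE, T4 lB lE lA lC lH lG, T4 lB lC lA lD lG lF,
     T4 lA lE lB lD lG lF, T4 lA lD lB lC lH lE, T4 lA lF lB lC lH lE, T4 lB lD lA lC lH lG,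
     T4 lC lD lA lB lF lE, T4 lB lE lA lC lG lF, T4 lA lC lB lD lG lE, T4 lA lE lC lD lH lG,
     T4 lA lB lC lD lH lF]
    [T4 lA lB lC lD lF lE, T4 lA lB lC lD lE lF, T4 lA lE lB lC lF lG, T4 lA lE lB lC lG lH,
     T4 lC lE lA lB lF lH, T4 lB lE lA lC lH lF, T4 lA lC lB lD lE lG, T4 lA lF lB lD lG lE,
     T4 lB lC lA lD lE lH, T4 lB lF lA lD lH lE, T4 lC lD lA lB lH lG, T4 lB lC lA lD lG lE,
     T4 lA lG lC lD lF lE, T4 lA lC lB lD lH lE, T4 lA lF lB lD lE lH, T4 lA lD lB lC lG lF,
     T4 lA lG lC lD lE lF, T4 lB lE lA lD lF lG, T4 lA lD lB lC lF lG, T4 lA lH lB lD lG lE,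
     T4 lB lD lA lC lH lF, T4 lB lE lA lC lG lF, T4 lB lF lA lC lE lG]
    [T4 lA lB lC lF lH lE, T4 lA lB lC lE lH lF, T4 lA lB lC lE lF lH, T4 lB lE lA lD lF lC,
     T4 lB lE lA lC lF lD, T4 lB lE lA lC lD lF, T4 lA lB lC lG lH lE, T4 lA lB lC lE lH lG,
     T4 lA lB lC lE lG lH, T4 lC lE lA lD lF lB, T4 lC lE lA lB lF lD, T4 lC lE lA lB lD lF,
     T4 lA lB lC lG lH lF, T4 lA lB lC lF lH lG, T4 lA lB lC lF lG lH, T4 lD lE lA lC lF lB,
     T4 lD lE lA lB lF lC, T4 lD lE lA lB lC lF, T8 lA lE lB lF lC lG lD lH]
    (kinds_from (stage Phi3_kind)) (Phi3 {lA, lB, lC, lD})"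
  by code_simp

lemma certificate_Line: "certifies
    [T8 lH lA lB lG lC lE lD lF, T4 lC lH lA lB lF lE, T8 lE lA lB lF lC lH lD lG,
     T4 lB lE lA lD lG lF, T8 lH lA lB lF lC lG lD lE, T4 lA lE lC lD lH lF,
     T4 lC lG lA lB lH lE, T4 lA lF lB lC lH lE]
    [T4 lA lE lB lC lG lF, T4 lA lE lB lC lF lG, T4 lA lE lB lD lH lF, T4 lB lH lA lC lG lE,
     T4 lA lG lB lD lF lH, T4 lB lF lA lC lE lG, T4 lA lE lC lD lH lG, T4 lB lF lA lD lH lE,
     T4 lB lF lA lD lE lH, T4 lC lH lA lB lF lE, T4 lA lF lC lD lG lH, T4 lC lG lA lB lE lF,
     T8 lE lA lB lF lC lG lD lH]
    [T4 lA lB lC lE lF lD, T4 lA lB lC lD lF lE, T4 lC lD lA lG lH lB, T4 lC lD lA lB lH lG,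
     T4 lA lB lC lG lH lD, T4 lA lB lC lD lH lG, T4 lC lD lA lB lF lE, T4 lC lD lA lB lE lF,
     T4 lA lB lE lG lH lF, T4 lB lD lA lC lH lF, T4 lA lB lE lF lH lG, T4 lE lF lA lB lD lC,
     T4 lB lD lA lE lG lC, T4 lA lC lB lD lH lE, T4 lA lD lB lC lG lE, T4 lB lD lA lC lE lG,
     T4 lB lC lA lD lG lF, T4 lA lC lB lD lF lG, T4 lA lB lC lE lH lF, T4 lB lC lA lD lF lH,
     T4 lD lG lA lB lC lE, T4 lA lC lD lF lG lH, T4 lA lD lB lC lE lF, T4 lC lD lA lB lF lG,
     T4 lA lB lC lF lG lE, T4 lA lH lB lD lE lC, T4 lA lG lB lF lH lE, T4 lC lD lA lE lH lB,
     T4 lC lF lA lB lE lD, T4 lA lB lD lE lG lH, T4 lA lG lB lC lE lD, T4 lA lH lB lC lD lE,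
     T4 lB lD lA lG lH lC, T4 lB lD lA lC lH lE, T4 lB lC lA lE lG lD, T4 lB lF lA lD lE lC,
     T4 lA lB lC lF lG lD, T4 lA lC lB lE lF lD, T4 lA lD lB lF lH lC, T4 lA lF lB lE lH lG]
    (kinds_from (stage Line_kind)) (Line {lA, lB, lC, lD})"
  by code_simp

lemma certificate_Chi1: "certifies
    [T4 lB lH lA lC lG lF, T4 lA lG lB lC lH lF, T4 lC lE lA lB lG lF, T4 lA lF lB lD lH lG,
     T8 lG lA lB lE lC lH lD lF, T4 lB lG lA lD lH lF, T8 lD lA lB lG lC lH lE lF]
    [T4 lA lC lD lE lG lF, T4 lA lC lD lE lF lG, T4 lA lF lC lD lG lH, T4 lC lH lA lB lF lE,
     T8 lF lA lB lE lC lG lD lH, T4 lC lG lA lB lE lF, T4 lA lG lC lE lH lF,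
     T4 lA lG lB lE lF lH, T4 lC lF lA lB lD lH, T4 lC lF lA lB lG lD, T4 lB lF lA lD lH lG,
     T4 lA lD lB lF lE lC, T4 lE lF lA lB lD lC, T4 lD lH lA lB lC lG, T4 lB lD lA lG lC lE,
     T4 lA lF lB lE lG lH, T4 lA lC lB lH lD lE, T4 lA lC lB lF lE lD]
    [T4 lA lB lC lD lF lE, T4 lA lB lC lD lH lG, T4 lA lB lC lD lG lH, T4 lA lB lC lG lH lD,
     T4 lA lB lE lF lH lG, T4 lA lB lE lF lG lH, T4 lA lB lE lG lH lF, T4 lA lB lC lF lH lD,
     T4 lA lB lD lE lH lF, T4 lA lB lC lE lF lG, T4 lA lB lC lG lH lE, T4 lA lB lD lE lG lH,
     T4 lA lB lD lF lH lE, T4 lA lB lC lD lH lF, T4 lA lB lC lD lE lH, T4 lA lB lC lF lG lD,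
     T4 lA lB lC lD lG lF, T4 lA lB lC lD lF lG, T4 lC lD lA lE lF lB, T4 lC lD lA lB lF lE,
     T4 lC lD lA lB lE lF]
    (kinds_from (stage Chi1_kind)) (Chi1 {lA, lB} {lC, lD, lE} {lF, lG, lH})"
  by code_simp

lemma certificate_Chi2: "certifies
    [T4 lB lE lA lC lG lF, T4 lC lF lA lB lG lE, T4 lA lG lB lC lF lE, T4 lC lF lA lB lE lD,
     T4 lB lF lA lC lH lE]
    [T4 lA lD lB lC lF lE, T4 lA lD lB lC lE lF, T4 lB lD lA lC lH lG, T4 lB lD lA lC lG lH,
     T4 lC lE lA lB lF lD, T4 lC lG lA lB lD lH, T4 lC lD lA lB lH lF, T4 lA lE lB lC lD lG,
     T4 lA lH lB lC lG lE, T4 lB lF lA lC lE lD, T4 lB lF lA lC lG lE, T4 lA lF lB lC lH lG,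
     T4 lA lG lB lC lE lH, T4 lA lH lB lC lE lF, T4 lB lE lA lC lD lG, T4 lB lE lA lC lD lH,
     T4 lB lF lA lC lD lG, T4 lB lF lA lC lD lH]
    [T4 lA lB lC lF lG lE, T4 lA lB lC lE lG lF, T4 lA lB lC lE lF lG, T4 lA lB lC lF lH lE,
     T4 lA lB lD lG lH lE, T4 lA lB lD lE lH lG, T4 lA lB lC lD lF lG, T4 lD lE lA lC lF lB,
     T4 lD lE lA lB lF lC, T4 lD lE lA lB lC lF]
    (kinds_from (stage Chi2_kind)) (Chi2 {lA, lB, lC})"
  by code_simp

lemma certificate_Alpha1: "certifies
    [T4 lC lF lA lB lG lD, T4 lD lE lA lB lH lC, T4 lC lE lA lB lG lD, T4 lC lG lA lB lH lF]
    [T4 lC lD lA lB lF lE, T4 lC lD lA lB lE lF, T4 lC lD lA lB lH lG, T4 lC lD lA lB lG lH,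
     T4 lE lF lA lB lD lC, T4 lE lF lA lB lC lD, T4 lC lE lA lB lH lG, T4 lC lE lA lB lG lH,
     T4 lC lF lA lB lH lG, T4 lC lF lA lB lG lH]
    [T4 lA lB lE lG lH lF, T4 lA lB lC lE lG lD, T4 lA lB lC lD lH lF, T4 lA lB lC lD lF lH]
    (kinds_from (stage Alpha1_kind)) (Alpha1 {lA, lB})"
  by code_simp

lemma certificate_Alpha2: "certifies
    [T4 lA lD lB lC lG lF, T4 lA lB lC lD lH lE]
    [T8 lA lE lB lF lC lG lD lH, T8 lA lF lB lE lC lH lD lG, T8 lA lG lB lH lC lE lD lF,
     T8 lA lH lB lG lC lF lD lE]
    [T8 lA lC lB lD lE lG lF lH]
    (kinds_from (stage Alpha2_kind)) (Alpha2 {lA, lB, lC, lD})"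
  by code_simp

lemma set_kinds_from: "set (kinds_from n) = {k. k \<noteq> TCu_kind \<and> n \<le> stage k}"
proof (rule Set.set_eqI)
  show "k \<in> set (kinds_from n) \<longleftrightarrow> k \<in> {k. k \<noteq> TCu_kind \<and> n \<le> stage k}" for k
    by (cases k) (simp_all add: kinds_from_def)
qed

lemma certified_witness:
  assumes "certifies Ks Ls Ms (kinds_from (stage k)) s"
    and "valid_symbol s" "s \<in> R" "admissible k R"
  shows "witnessed s R"
  unfolding witnessed_def
proof (rule certifies_sound[OF assms(1-3)])
  show "unopposed R" using assms(4) by (simp add: admissible_def)
  show "valid_symbol r \<and> kind_of r \<in> set (kinds_from (stage k)) \<and> kind_of r \<noteq> TCu_kind"
    if "r \<in> R" for r
    using assms(4) that by (simp add: admissible_def set_kinds_from)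
qed

definition standard :: "kind \<Rightarrow> symbol" where
  "standard k = (case k of Alpha1_kind \<Rightarrow> Alpha1 {lA, lB} | Alpha2_kind \<Rightarrow> Alpha2 {lA, lB, lC, lD}
    | Chi1_kind \<Rightarrow> Chi1 {lA, lB} {lC, lD, lE} {lF, lG, lH} | Chi2_kind \<Rightarrow> Chi2 {lA, lB, lC}
    | Phi1_kind \<Rightarrow> Phi1 {lA, lB} {lC, lD} {lE, lF} {lG, lH} | Phi2_kind \<Rightarrow> Phi2 {lA, lB, lC} {lF, lG, lH}
    | Phi3_kind \<Rightarrow> Phi3 {lA, lB, lC, lD} | TCu_kind \<Rightarrow> TCu | Line_kind \<Rightarrow> Line {lA, lB, lC, lD})"

lemma valid_symbol_standard: "valid_symbol (standard k)" "kind_of (standard k) = k"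
proof -
  have u: "x \<in> {lA, lB} \<union> {lC, lD} \<union> {lE, lF} \<union> {lG, lH}" "x \<in> {lA, lB} \<union> {lC, lD, lE} \<union> {lF, lG, lH}" for x
    by (cases x; simp)+
  then show "valid_symbol (standard k)"
    by (cases k) (simp_all only: standard_def kind.case valid_symbol.simps set_eq_iff UNIV_I, simp_all)
  show "kind_of (standard k) = k"
    by (cases k) (simp_all add: standard_def)
qed

lemma standard_witness:
  assumes "k \<noteq> TCu_kind" "standard k \<in> R" "admissible k R"
  shows "witnessed (standard k) R"
proof -
  have "\<exists>Ks Ls Ms. certifies Ks Ls Ms (kinds_from (stage k)) (standard k)"
    using assms(1) certificate_Phi1 certificate_Phi2 certificate_Phi3 certificate_Line certificate_Chi1
      certificate_Chi2 certificate_Alpha1 certificate_Alpha2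
    unfolding standard_def by (cases k) (simp_all only: kind.case, blast+)
  then show ?thesis
    using certified_witness valid_symbol_standard(1) assms(2,3) by blast
qed

fun relabel_picture :: "(label \<Rightarrow> label) \<Rightarrow> picture \<Rightarrow> picture" where
  "relabel_picture \<pi> (Alpha1_pic T) = Alpha1_pic (\<pi> ` T)"
| "relabel_picture \<pi> (Alpha2_pic V) = Alpha2_pic ((`) \<pi> ` V)"
| "relabel_picture \<pi> (Chi1_pic T V) = Chi1_pic (\<pi> ` T) ((`) \<pi> ` V)"
| "relabel_picture \<pi> (Chi2_pic T) = Chi2_pic (\<pi> ` T)"
| "relabel_picture \<pi> (Phi1_pic V) = Phi1_pic ((`) ((`) \<pi>) ` V)"
| "relabel_picture \<pi> (Phi2_pic V) = Phi2_pic ((`) \<pi> ` V)"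
| "relabel_picture \<pi> (Phi3_pic V) = Phi3_pic ((`) \<pi> ` V)"
| "relabel_picture \<pi> TCu_pic = TCu_pic"
| "relabel_picture \<pi> (Line_pic V) = Line_pic ((`) \<pi> ` V)"

lemma symbol_picture_relabel:
  "bij \<pi> \<Longrightarrow> symbol_picture (relabel \<pi> s) = relabel_picture \<pi> (symbol_picture s)"
  by (cases s) (simp_all add: bij_image_Compl_eq)

text \<open>
  The isolating test for a standard symbol is carried over by a relabelling.
\<close>

lemma admissible_witnessed:
  assumes s: "valid_symbol s" "kind_of s \<noteq> TCu_kind" "s \<in> R" and R: "admissible (kind_of s) R"
  shows "witnessed s R"
proof -
  obtain \<pi> where \<pi>: "bij \<pi>" "s = relabel \<pi> (standard (kind_of s))"
    using relabel_transitive[OF valid_symbol_standard(1) s(1)] valid_symbol_standard(2) by metis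
  define \<sigma> where "\<sigma> = inv_into UNIV \<pi>"
  have \<sigma>: "bij \<sigma>" "\<pi> \<circ> \<sigma> = id" "\<sigma> \<circ> \<pi> = id"
    using \<pi>(1)
    by (auto simp: \<sigma>_def bij_imp_bij_inv bij_is_surj surj_f_inv_f bij_is_inj fun_eq_iff)
  define R' where "R' = relabel \<sigma> ` R"
  have st: "relabel \<sigma> s = standard (kind_of s)"
    using arg_cong[OF \<pi>(2), of "relabel \<sigma>"] by (simp add: relabel_comp \<sigma>(3) relabel_id)
  have cancel: "relabel \<pi> (relabel \<sigma> r) = r" for r
    by (simp add: relabel_comp \<sigma>(2) relabel_id)
  have val: "symbol_value (relabel \<sigma> r) T = symbol_value r (map_test \<pi> T)" for r T
    using symbol_value_relabel[OF bij_is_inj[OF \<pi>(1)], of "relabel \<sigma> r" T] by (simp add: cancel)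
  have keep: "proper (map_test \<pi> T) = proper T" for T
    by (rule proper_map_test[OF bij_is_inj[OF \<pi>(1)]])
  have "admissible (kind_of s) R'"
    using R keep valid_symbol_relabel[OF \<sigma>(1)]
    by (auto simp: admissible_def R'_def unopposed_def val kind_of_relabel)
  moreover have "standard (kind_of s) \<in> R'" unfolding R'_def st[symmetric] using s(3) by (rule imageI)
  ultimately obtain T where T: "proper T" "0 < symbol_value (standard (kind_of s)) T"
    "\<forall>r\<in>R'. symbol_picture r \<noteq> symbol_picture (standard (kind_of s)) \<longrightarrow> symbol_value r T \<le> 0"
    using standard_witness[OF s(2)] unfolding witnessed_def by blast
  have "symbol_value r (map_test \<pi> T) \<le> 0" if r: "r \<in> R" "symbol_picture r \<noteq> symbol_picture s" for r
  proof -
    have "symbol_picture (relabel \<sigma> r) \<noteq> symbol_picture (relabel \<sigma> s)"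
      using symbol_picture_relabel[OF \<pi>(1), of "relabel \<sigma> r"]
        symbol_picture_relabel[OF \<pi>(1), of "relabel \<sigma> s"] r(2)
      by (auto simp: cancel)
    then have "symbol_value (relabel \<sigma> r) T \<le> 0" using T(3) r(1) st by (simp add: R'_def)
    then show ?thesis by (simp add: val)
  qed
  moreover have "0 < symbol_value s (map_test \<pi> T)" using T(2) val[of s T] st by simp
  moreover have "proper (map_test \<pi> T)" using T(1) keep by simp
  ultimately show ?thesis unfolding witnessed_def by blast
qed

section \<open>Comparison of two decompositions\<close>

definition sample :: "picture \<Rightarrow> symbol" where
  "sample P = (SOME s. valid_symbol s \<and> symbol_picture s = P)"

lemma valid_symbol_block: "b \<in> building_blocks \<Longrightarrow> valid_symbol (fst b)"
  by (auto simp: building_blocks_def)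

lemma sample:
  assumes "b \<in> building_blocks"
  shows "valid_symbol (sample (picture b))" "symbol_picture (sample (picture b)) = picture b"
proof -
  have "valid_symbol (fst b) \<and> symbol_picture (fst b) = picture b"
    using assms by (auto simp: building_blocks_def picture_def)
  then have "valid_symbol (sample (picture b)) \<and> symbol_picture (sample (picture b)) = picture b"
    unfolding sample_def by (rule someI)
  then show "valid_symbol (sample (picture b))" "symbol_picture (sample (picture b)) = picture b"
    by blast+
qed

lemma test_value_combination:
  "test_value (\<lambda>S. (\<Sum>b\<in>V. m b * g b S) + (\<Sum>b\<in>W. l b * g b S)) T =
     (\<Sum>b\<in>V. m b * test_value (g b) T) + (\<Sum>b\<in>W. l b * test_value (g b) T)"
  by (cases T) (simp_all add: test_value_def sum.distrib sum_subtractf distrib_left right_diff_distrib)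

text \<open>
  Blocks with the same picture, also main and auxiliary ones, are taken together, since tests
  cannot tell them apart.
\<close>

definition coefficient :: "block set \<Rightarrow> (block \<Rightarrow> rat) \<Rightarrow> block set \<Rightarrow> (block \<Rightarrow> rat) \<Rightarrow> picture \<Rightarrow> rat" where
  "coefficient Bs m bs l P = (\<Sum>b | b \<in> Bs \<and> picture b = P. m b) + (\<Sum>b | b \<in> bs \<and> picture b = P. l b)"

lemma sum_by_picture:
  assumes "finite Bs" "finite V" "picture ` Bs \<subseteq> V"
  shows "(\<Sum>b\<in>Bs. m b * (g (picture b) :: rat)) = (\<Sum>P\<in>V. (\<Sum>b | b \<in> Bs \<and> picture b = P. m b) * g P)"
proof -
  have "(\<Sum>b\<in>Bs. m b * g (picture b)) = (\<Sum>P\<in>V. \<Sum>b | b \<in> Bs \<and> picture b = P. m b * g (picture b))"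
    by (rule sum.group[OF assms, symmetric])
  also have "\<dots> = (\<Sum>P\<in>V. (\<Sum>b | b \<in> Bs \<and> picture b = P. m b) * g P)"
    by (rule sum.cong) (auto simp: sum_distrib_right)
  finally show ?thesis .
qed

locale decomposition =
  fixes v :: "coord \<Rightarrow> rat" and Bs :: "block set" and m :: "block \<Rightarrow> rat" and bs :: "block set" and l :: "block \<Rightarrow> rat"
  assumes dec: "compatible_block_decomposition v Bs m bs l"
begin

abbreviation "coeff_of \<equiv> coefficient Bs m bs l"
abbreviation "pics \<equiv> decomposition_pictures Bs m bs l"

lemma decomposition_basics:
  "finite Bs" "finite bs" "Bs \<subseteq> building_blocks" "bs \<subseteq> building_blocks"
  "\<And>b. b \<in> Bs \<Longrightarrow> 0 < m b" "\<And>b. b \<in> bs \<Longrightarrow> 0 \<le> l b"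
  using dec by (auto simp: compatible_block_decomposition_def auxiliary_blocks_def)

lemma finite_pics: "finite pics"
  using decomposition_basics by (simp add: decomposition_pictures_def)

text \<open>
  All coefficients are nonnegative, so there is no cancellation between blocks of the same picture.
\<close>

lemma coefficient_pos_iff: "0 < coeff_of P \<longleftrightarrow> P \<in> pics" and coefficient_nonneg: "0 \<le> coeff_of P"
proof -
  have nn: "0 \<le> m b" if "b \<in> Bs" for b using decomposition_basics(5)[OF that] by simp
  have 1: "0 \<le> (\<Sum>b | b \<in> Bs \<and> picture b = P. m b)" "0 \<le> (\<Sum>b | b \<in> bs \<and> picture b = P. l b)"
    by (rule sum_nonneg, use nn decomposition_basics(6) in blast)+
  then show "0 \<le> coeff_of P" by (simp add: coefficient_def)
  have "(\<Sum>b | b \<in> Bs \<and> picture b = P. m b) = 0 \<longleftrightarrow> (\<forall>b\<in>{b. b \<in> Bs \<and> picture b = P}. m b = 0)"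
    using decomposition_basics(1) nn by (intro sum_nonneg_eq_0_iff) auto
  moreover have "(\<Sum>b | b \<in> bs \<and> picture b = P. l b) = 0 \<longleftrightarrow> (\<forall>b\<in>{b. b \<in> bs \<and> picture b = P}. l b = 0)"
    using decomposition_basics(2,6) by (intro sum_nonneg_eq_0_iff) auto
  ultimately have "coeff_of P = 0 \<longleftrightarrow> P \<notin> pics"
    using 1 by (auto simp: coefficient_def decomposition_pictures_def add_nonneg_eq_0_iff)
  then show "0 < coeff_of P \<longleftrightarrow> P \<in> pics"
    using \<open>0 \<le> coeff_of P\<close> by auto
qed

lemma coefficient_zero: "P \<notin> pics \<Longrightarrow> coeff_of P = 0"
  using coefficient_pos_iff[of P] coefficient_nonneg[of P] by linarith

lemma sample_pics:
  assumes "P \<in> pics"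
  shows "valid_symbol (sample P)" "symbol_picture (sample P) = P"
  using assms sample decomposition_basics(3,4) by (auto simp: decomposition_pictures_def)

text \<open>
  Two auxiliary blocks of a decomposition conform because they have the same picture.
\<close>

lemma conform_pics:
  assumes "P \<in> pics" "Q \<in> pics"
  shows "conform (sample P) (sample Q)"
proof -
  have *: "conform (fst b) (fst c)" if bc: "b \<in> Bs \<union> bs" "c \<in> Bs \<union> bs" for b c
  proof -
    have comp: "compatible b c" if "b \<in> Bs" "c \<in> Bs" for b c
      using dec that by (simp add: compatible_block_decomposition_def)
    have same: "picture b = picture c" if "b \<in> bs" "c \<in> bs" for b c
      using dec that unfolding compatible_block_decomposition_def by blast
    have aux: "\<exists>d\<in>Bs. b \<in> auxiliary_blocks d" if "b \<in> bs" for b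
      using dec that by (auto simp: compatible_block_decomposition_def)
    have blocks: "b \<in> building_blocks" if "b \<in> Bs \<union> bs" for b using that decomposition_basics by blast
    have mixed: "conform (fst b) (fst c)" if "b \<in> bs" "c \<in> Bs" for b c
      using aux[OF that(1)] compatible_conform comp blocks that(2) by blast
    consider "b \<in> Bs" "c \<in> Bs" | "b \<in> bs" "c \<in> Bs" | "b \<in> Bs" "c \<in> bs" | "b \<in> bs" "c \<in> bs"
      using bc by blast
    then show ?thesis
    proof cases
      case 1
      then show ?thesis using compatible_conform comp blocks by blast
    next
      case 2
      then show ?thesis by (rule mixed)
    next
      case 3
      then show ?thesis using mixed conform_sym by blast
    next
      case 4
      have "valid_symbol (fst b)" "valid_symbol (fst c)" "symbol_picture (fst b) = symbol_picture (fst c)"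
        using valid_symbol_block blocks[OF bc(1)] blocks[OF bc(2)] same[OF 4]
        by (simp_all add: picture_def)
      then show ?thesis using conform_picture conform_refl by blast
    qed
  qed
  obtain b c where b: "b \<in> Bs \<union> bs" "P = picture b" and c: "c \<in> Bs \<union> bs" "Q = picture c"
    using assms by (auto simp: decomposition_pictures_def)
  have v: "valid_symbol (fst b)" "valid_symbol (fst c)"
    using valid_symbol_block b c decomposition_basics(3,4) by blast+
  have "conform (sample P) (fst c)"
    using conform_picture[OF sample_pics(1)[OF assms(1)] v(1) _ *[OF b(1) c(1)]] sample_pics(2)[OF assms(1)] b(2)
    by (simp add: picture_def)
  then show ?thesis
    using conform_picture[OF sample_pics(1)[OF assms(2)] v(2) _ conform_sym] sample_pics(2)[OF assms(2)] c(2) conform_sym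
    by (metis picture_def)
qed

lemma test_value_decomposition:
  assumes "proper T"
  shows "test_value (split_sum v) T = (\<Sum>P\<in>pics. coeff_of P * symbol_value (sample P) T)"
proof -
  have vz: "v z = (\<Sum>b\<in>Bs. m b * block_vector b z) + (\<Sum>b\<in>bs. l b * block_vector b z)" if "z \<in> coords" for z
    using dec that by (simp add: compatible_block_decomposition_def)
  have "split_sum v S = ((\<Sum>b\<in>Bs. m b * split_sum (block_vector b) S)
      + (\<Sum>b\<in>bs. l b * split_sum (block_vector b) S)) + 0" if "card S = 4" for S
  proof -
    have "Pl S \<in> coords" "Pl (- S) \<in> coords" using that by (auto simp: coords_def card_Compl_label)
    then show ?thesis by (simp add: split_sum_def vz distrib_left sum.distrib)
  qed
  then have "test_value (split_sum v) T = test_value (\<lambda>S. (\<Sum>b\<in>Bs. m b * split_sum (block_vector b) S)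
      + (\<Sum>b\<in>bs. l b * split_sum (block_vector b) S)) T"
    by (rule test_value_cong_const[OF assms])
  also have "\<dots> = (\<Sum>b\<in>Bs. m b * test_value (split_sum (block_vector b)) T)
      + (\<Sum>b\<in>bs. l b * test_value (split_sum (block_vector b)) T)"
    by (rule test_value_combination)
  also have "\<dots> = (\<Sum>b\<in>Bs. m b * symbol_value (sample (picture b)) T)
      + (\<Sum>b\<in>bs. l b * symbol_value (sample (picture b)) T)"
  proof -
    have "test_value (split_sum (block_vector b)) T = symbol_value (sample (picture b)) T"
      if "b \<in> building_blocks" for b
      unfolding test_value_block[OF that assms]
      by (rule symbol_value_picture[OF valid_symbol_block[OF that] sample(1)[OF that] _ assms])
        (simp only: sample(2)[OF that], simp only: picture_def)
    then have "V \<subseteq> building_blocks \<Longrightarrow> (\<Sum>b\<in>V. w b * test_value (split_sum (block_vector b)) T)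
        = (\<Sum>b\<in>V. w b * symbol_value (sample (picture b)) T)" for V and w :: "block \<Rightarrow> rat"
      by (intro sum.cong) auto
    then show ?thesis using decomposition_basics(3,4) by simp
  qed
  also have "\<dots> = (\<Sum>P\<in>picture ` (Bs \<union> bs). coeff_of P * symbol_value (sample P) T)"
  proof -
    have "finite (picture ` (Bs \<union> bs))" "picture ` Bs \<subseteq> picture ` (Bs \<union> bs)"
      "picture ` bs \<subseteq> picture ` (Bs \<union> bs)"
      using decomposition_basics(1,2) by auto
    from sum_by_picture[OF decomposition_basics(1) this(1,2), of m "\<lambda>P. symbol_value (sample P) T"]
      sum_by_picture[OF decomposition_basics(2) this(1,3), of l "\<lambda>P. symbol_value (sample P) T"]
    show ?thesis by (simp add: coefficient_def distrib_right sum.distrib)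
  qed
  also have "\<dots> = (\<Sum>P\<in>pics. coeff_of P * symbol_value (sample P) T)"
  proof (rule sum.mono_neutral_right)
    show "\<forall>P\<in>picture ` (Bs \<union> bs) - pics. coeff_of P * symbol_value (sample P) T = 0"
      using coefficient_zero by simp
    show "finite (picture ` (Bs \<union> bs))" using decomposition_basics(1,2) by simp
    show "pics \<subseteq> picture ` (Bs \<union> bs)" by (auto simp: decomposition_pictures_def)
  qed
  finally show ?thesis .
qed

lemma positive_test_value:
  assumes "proper T" "P \<in> pics" "0 < symbol_value (sample P) T"
  shows "\<And>Q. Q \<in> pics \<Longrightarrow> 0 \<le> symbol_value (sample Q) T" "0 < test_value (split_sum v) T"
proof -
  show 1: "0 \<le> symbol_value (sample Q) T" if "Q \<in> pics" for Q
    using conform_pics[OF assms(2) that] assms(1,3) by (auto simp: conform_def zero_le_mult_iff)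
  have "0 < coeff_of P * symbol_value (sample P) T"
    using assms(2,3) coefficient_pos_iff by simp
  moreover have "0 \<le> coeff_of Q * symbol_value (sample Q) T" if "Q \<in> pics" for Q
    using coefficient_nonneg 1[OF that] by simp
  ultimately have "0 < (\<Sum>P\<in>pics. coeff_of P * symbol_value (sample P) T)"
    by (rule sum_pos2[OF finite_pics assms(2)])
  then show "0 < test_value (split_sum v) T" by (simp add: test_value_decomposition[OF assms(1)])
qed

lemma negative_test_value:
  assumes "proper T" "P \<in> pics" "symbol_value (sample P) T < 0"
  shows "test_value (split_sum v) T < 0"
proof -
  have 1: "symbol_value (sample Q) T \<le> 0" if "Q \<in> pics" for Q
    using conform_pics[OF assms(2) that] assms(1,3) by (auto simp: conform_def zero_le_mult_iff)
  have "0 < - (coeff_of P * symbol_value (sample P) T)"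
    using assms(2,3) coefficient_pos_iff by (simp add: mult_pos_neg)
  moreover have "0 \<le> - (coeff_of Q * symbol_value (sample Q) T)" if "Q \<in> pics" for Q
    using coefficient_nonneg 1[OF that] by (simp add: mult_nonneg_nonpos)
  ultimately have "0 < (\<Sum>P\<in>pics. - (coeff_of P * symbol_value (sample P) T))"
    by (rule sum_pos2[OF finite_pics assms(2)])
  then show ?thesis by (simp add: test_value_decomposition[OF assms(1)] sum_negf)
qed

text \<open>
  All pictures of a decomposition have weakly the same sign on a test, so either all terms
  are equal to their positive parts or all positive parts vanish.
\<close>

lemma positive_part:
  assumes "proper T"
  shows "max 0 (test_value (split_sum v) T) = (\<Sum>P\<in>pics. coeff_of P * max 0 (symbol_value (sample P) T))"
proof (cases "\<exists>P\<in>pics. 0 < symbol_value (sample P) T")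
  case True
  then obtain P where P: "P \<in> pics" "0 < symbol_value (sample P) T" by blast
  note s = positive_test_value[OF assms P]
  have "max 0 (test_value (split_sum v) T) = (\<Sum>P\<in>pics. coeff_of P * symbol_value (sample P) T)"
    using s(2) test_value_decomposition[OF assms] by simp
  also have "\<dots> = (\<Sum>P\<in>pics. coeff_of P * max 0 (symbol_value (sample P) T))"
    by (rule sum.cong) (simp_all add: max_absorb2 s(1))
  finally show ?thesis .
next
  case False
  then have 1: "symbol_value (sample Q) T \<le> 0" if "Q \<in> pics" for Q using that by force
  have "test_value (split_sum v) T \<le> 0"
    unfolding test_value_decomposition[OF assms] by (intro sum_nonpos mult_nonneg_nonpos coefficient_nonneg 1)
  moreover have "(\<Sum>P\<in>pics. coeff_of P * max 0 (symbol_value (sample P) T)) = 0"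
    by (intro sum.neutral ballI) (simp add: max_absorb1 1)
  ultimately show ?thesis by simp
qed

lemma Dagger_coefficient: "v Dagger = coeff_of TCu_pic"
proof -
  have *: "block_vector b Dagger = (if picture b = TCu_pic then 1 else 0)" if b: "b \<in> building_blocks" for b
  proof -
    obtain s t where "b = (s, t)" "t \<in> letters s"
      using b by (auto simp: building_blocks_def)
    then show ?thesis by (cases s) (auto simp: picture_def)
  qed
  have e: "(\<Sum>b\<in>V. w b * block_vector b Dagger) = (\<Sum>b | b \<in> V \<and> picture b = TCu_pic. w b)"
    if "V \<subseteq> building_blocks" "finite V" for V and w :: "block \<Rightarrow> rat"
  proof -
    have "(\<Sum>b\<in>V. w b * block_vector b Dagger) = (\<Sum>b\<in>V. if picture b = TCu_pic then w b else 0)"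
      using that * by (intro sum.cong) auto
    also have "\<dots> = (\<Sum>b | b \<in> V \<and> picture b = TCu_pic. w b)"
      by (rule sum.inter_filter[symmetric]) (rule that)
    finally show ?thesis .
  qed
  have "Dagger \<in> coords" by (simp add: coords_def)
  then have "v Dagger = (\<Sum>b\<in>Bs. m b * block_vector b Dagger) + (\<Sum>b\<in>bs. l b * block_vector b Dagger)"
    using dec by (simp add: compatible_block_decomposition_def)
  then show ?thesis using e decomposition_basics by (simp add: coefficient_def)
qed

end

text \<open>
  By induction along \<open>stage\<close> the coefficients of every picture in the two decompositions agree.
\<close>

lemma pictures_unique:
  assumes "compatible_block_decomposition v Bs m bs l"
    and "compatible_block_decomposition v Bs' m' bs' l'"
  shows "decomposition_pictures Bs m bs l = decomposition_pictures Bs' m' bs' l'"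
proof -
  interpret d: decomposition v Bs m bs l by unfold_locales (rule assms)
  interpret d': decomposition v Bs' m' bs' l' by unfold_locales (rule assms)
  define U where "U = d.pics \<union> d'.pics"
  define diff where "diff P = d.coeff_of P - d'.coeff_of P" for P
  have fin: "finite U" using d.finite_pics d'.finite_pics by (simp add: U_def)
  have valid: "valid_symbol (sample P)" "symbol_picture (sample P) = P" if "P \<in> U" for P
    using that d.sample_pics d'.sample_pics by (auto simp: U_def)
  have kind_TC: "kind_of (sample P) = TCu_kind \<longleftrightarrow> P = TCu_pic" if "P \<in> U" for P
    using valid[OF that] by (cases "sample P") auto
  have unopposed: "unopposed (sample ` U)"
  proof -
    have "0 < test_value (split_sum v) T" if "proper T" "P \<in> U" "0 < symbol_value (sample P) T" for P T
      using that d.positive_test_value(2) d'.positive_test_value(2) unfolding U_def by blast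
    moreover have "test_value (split_sum v) T < 0" if "proper T" "P \<in> U" "symbol_value (sample P) T < 0" for P T
      using that d.negative_test_value d'.negative_test_value unfolding U_def by blast
    ultimately show ?thesis
      unfolding unopposed_def by (metis imageE not_less_iff_gr_or_eq)
  qed
  \<comment> \<open>Both decompositions compute the positive part of the same number.\<close>
  have relation: "(\<Sum>P\<in>U. diff P * max 0 (symbol_value (sample P) T)) = 0" if "proper T" for T
  proof -
    have "(\<Sum>P\<in>U. d.coeff_of P * max 0 (symbol_value (sample P) T)) = (\<Sum>P\<in>d.pics. d.coeff_of P * max 0 (symbol_value (sample P) T))"
      using fin by (intro sum.mono_neutral_right) (auto simp: U_def d.coefficient_zero)
    moreover have "(\<Sum>P\<in>U. d'.coeff_of P * max 0 (symbol_value (sample P) T)) = (\<Sum>P\<in>d'.pics. d'.coeff_of P * max 0 (symbol_value (sample P) T))"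
      using fin by (intro sum.mono_neutral_right) (auto simp: U_def d'.coefficient_zero)
    ultimately show ?thesis
      using d.positive_part[OF that] d'.positive_part[OF that]
      by (simp add: diff_def left_diff_distrib sum_subtractf)
  qed
  have "diff P = 0" if "P \<in> U" for P
    using that
  proof (induction "stage (kind_of (sample P))" arbitrary: P rule: less_induct)
    case less
    show ?case
    proof (cases "P = TCu_pic")
      case True
      then show ?thesis using d.Dagger_coefficient d'.Dagger_coefficient by (simp add: diff_def)
    next
      case False
      \<comment> \<open>By induction hypothesis only pictures of the same or a later kind are left in \<open>R\<close>.\<close>
      define R where "R = insert (sample P) (sample ` {Q \<in> U. diff Q \<noteq> 0 \<and> Q \<noteq> TCu_pic})"
      have "R \<subseteq> sample ` U" using less.prems by (auto simp: R_def)
      then have "unopposed R" using unopposed unfolding unopposed_def by blast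
      moreover have "valid_symbol r \<and> kind_of r \<noteq> TCu_kind \<and> stage (kind_of (sample P)) \<le> stage (kind_of r)" if "r \<in> R" for r
        using that valid less False kind_TC by (fastforce simp: R_def not_less[symmetric])
      ultimately have "admissible (kind_of (sample P)) R" by (auto simp: admissible_def)
      then have "witnessed (sample P) R"
        using valid(1)[OF less.prems] kind_TC[OF less.prems] False by (intro admissible_witnessed) (auto simp: R_def)
      then obtain T where T: "proper T" "0 < symbol_value (sample P) T"
        "\<And>r. r \<in> R \<Longrightarrow> symbol_picture r \<noteq> symbol_picture (sample P) \<Longrightarrow> symbol_value r T \<le> 0"
        unfolding witnessed_def by blast
      have "diff Q * max 0 (symbol_value (sample Q) T) = 0" if Q: "Q \<in> U - {P}" for Q
      proof (cases "diff Q = 0 \<or> Q = TCu_pic")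
        case True
        have "diff TCu_pic = 0" using d.Dagger_coefficient d'.Dagger_coefficient by (simp add: diff_def)
        then show ?thesis using True by auto
      next
        case False
        then have "sample Q \<in> R" using Q by (auto simp: R_def)
        then have "symbol_value (sample Q) T \<le> 0" using T(3) valid(2) Q less.prems by auto
        then show ?thesis by simp
      qed
      then have "(\<Sum>Q\<in>U - {P}. diff Q * max 0 (symbol_value (sample Q) T)) = 0"
        by (intro sum.neutral ballI)
      then have "(\<Sum>Q\<in>U. diff Q * max 0 (symbol_value (sample Q) T)) = diff P * max 0 (symbol_value (sample P) T)"
        using sum.remove[OF fin less.prems, of "\<lambda>Q. diff Q * max 0 (symbol_value (sample Q) T)"]
        by simp
      then show ?thesis using relation[OF T(1)] T(2) by simp
    qed
  qed
  then have "P \<in> d.pics \<longleftrightarrow> P \<in> d'.pics" if "P \<in> U" for P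
    using d.coefficient_pos_iff[of P] d'.coefficient_pos_iff[of P] that by (simp add: diff_def)
  then show ?thesis by (auto simp: U_def)
qed

theorem theorem5p5:
  fixes \<nu> :: "'k::field alg_closure \<Rightarrow> rat"
    and p :: nat
    and oct :: "label \<Rightarrow> ('k alg_closure ^ 4) set"
    and v :: "coord \<Rightarrow> rat"
    and Bs Bs' bs bs' :: "block set"
    and m m' l l' :: "block \<Rightarrow> rat"
  assumes "local_field_valuation \<nu>"
    and "residue_characteristic (\<lambda>x :: 'k. \<nu> (to_ac x)) = p"
    and "p \<noteq> 2"
    and "cayley_octad oct"
    and "valuation_data \<nu> oct v"
    and "compatible_block_decomposition v Bs m bs l"
    and "compatible_block_decomposition v Bs' m' bs' l'"
  shows "decomposition_pictures Bs m bs l = decomposition_pictures Bs' m' bs' l'"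
  using assms(6,7) by (rule pictures_unique)

end
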